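(* Let $F\in\mathcal F$ be integrable in a neighbourhood of $|\mathbf x|=+\infty$, and let $s_1,s_2>0$. Then $$\mathrm{Pf}_{s_1,s_2}\int d^3\mathbf x\,F=4\pi\,\mathrm{Pf}_{s_1}\int_0^{r_{12}}dr_1\,r_1^2\,\widetilde I_2(r_1)+4\pi\int_{r_{12}}^{+\infty}dr_1\Bigl[r_1^2\,\widetilde J_2(r_1)+\frac1{r_1}\bigl(r_2^3F\bigr)_2\Bigr]+4\pi\bigl(r_2^3F\bigr)_2\ln\Bigl(\frac{r_{12}}{s_2}\Bigr),$$ and similarly with the roles of the points $1$ and $2$ interchanged.
   Context: Fix two distinct points $\mathbf y_1,\mathbf y_2\in\mathbb R^3$, $r_{12}=|\mathbf y_1-\mathbf y_2|$. For $\mathbf x\in\mathbb R^3$ put $r_1=|\mathbf x-\mathbf y_1|$, $\mathbf n_1=(\mathbf x-\mathbf y_1)/r_1$, $r_2=|\mathbf x-\mathbf y_2|$, $\mathbf n_2=(\mathbf x-\mathbf y_2)/r_2$; $d\Omega_1$, $d\Omega_2$ are the solid angle elements of $\mathbf n_1$, $\mathbf n_2$. Class $\mathcal F$: real functions $F$, smooth on $\mathbb R^3\setminus\{\mathbf y_1,\mathbf y_2\}$, for which there are real exponents $a_0<a_1<a_2<\cdots$ (only finitely many below any bound) and functions ${}_1f_{a}$ on the unit sphere such that for all $N\in\mathbb N$, $F=\sum_{a\le N}r_1^{a}\,{}_1f_{a}(\mathbf n_1)+o(r_1^N)$ as $r_1\to0$ (uniformly in $\mathbf n_1$); and similarly at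 $\mathbf y_2$ with exponents $b$ and coefficients ${}_2f_b(\mathbf n_2)$. Put ${}_1f_a=0$ if $a$ is not one of the exponents (same for 2). Partie finie at a point: $(F)_2=\int\frac{d\Omega_2}{4\pi}\,{}_2f_0(\mathbf n_2)$ (angular average of the coefficient of $r_2^0$); in particular $(r_2^3F)_2=\int\frac{d\Omega_2}{4\pi}\,{}_2f_{-3}(\mathbf n_2)$. Partie finie of an integral: with $\mathcal B_{1}(s),\mathcal B_2(s)$ the closed balls of radius $s$ centred at $\mathbf y_{1},\mathbf y_2$, $$\mathrm{Pf}_{s_1,s_2}\int d^3\mathbf x\,F=\lim_{s\to0}\Bigl\{\int_{\mathbb R^3\setminus\mathcal B_1(s)\cup\mathcal B_2(s)}d^3\mathbf x\,F+\sum_{a+3<0}\frac{s^{a+3}}{a+3}\int d\Omega_1\,{}_1f_a+\ln\Bigl(\frac s{s_1}\Bigr)\int d\Omega_1\,{}_1f_{-3}+\sum_{b+3<0}\frac{s^{b+3}}{b+3}\int d\Omega_2\,{}_2f_b+\ln\Bigl(\frac s{s_2}\Bigr)\int d\Omega_2\,{}_2f_{-3}\Bigr\}.$$ Regularized function and angular averages: $\widetilde F_2=F-\sum_{b+3\le0}r_2^b\,{}_2f_b(\mathbf n_2)$, and $\int\frac{d\Omega_1}{4\pi}\widetilde F_2$ (average over the sphere of radius $r_1$ centred at $\mathbf y_1$) is denoted $\widetilde I_2(r_1)$ when $r_1\le r_{12}$ and $\widetilde J_2(r_1)$ when $r_1>r_{12}$. The radial partie finie is $$4\pi\,\mathrm{Pf}_{s_1}\int_0^{r_{12}}dr_1\,r_1^2\widetilde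 I_2=\lim_{s\to0}\Bigl\{4\pi\int_s^{r_{12}}dr_1\,r_1^2\widetilde I_2+\sum_{a+3<0}\frac{s^{a+3}}{a+3}\int d\Omega_1\,{}_1f_a+\ln\Bigl(\frac s{s_1}\Bigr)\int d\Omega_1\,{}_1f_{-3}\Bigr\}.$$ *)

theory Defs
  imports "HOL-Analysis.Analysis"
begin

text \<open>The classes \<open>C\<^sup>k\<close>; the recursion is meaningful for open \<open>S\<close> only.\<close>

primrec Ck_on :: "nat \<Rightarrow> 'a::euclidean_space set \<Rightarrow> ('a \<Rightarrow> real) \<Rightarrow> bool" where
  "Ck_on 0 S f \<longleftrightarrow> continuous_on S f"
| "Ck_on (Suc k) S f \<longleftrightarrow>
     (\<forall>x\<in>S. f differentiable (at x)) \<and> (\<forall>v. Ck_on k S (\<lambda>x. frechet_derivative f (at x) v))"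

definition smooth_on :: "'a::euclidean_space set \<Rightarrow> ('a \<Rightarrow> real) \<Rightarrow> bool" where
  "smooth_on S f \<longleftrightarrow> (\<forall>k. Ck_on k S f)"

text \<open>The solid angle element \<open>d\<Omega> = sin \<theta> d\<theta> d\<phi>\<close>, as a measure whose space is the unit sphere
  (so that values of integrands off the sphere, and their measurability there, are irrelevant).\<close>

definition sph :: "real \<times> real \<Rightarrow> real^3" where
  "sph = (\<lambda>(\<theta>, \<phi>). vector [sin \<theta> * cos \<phi>, sin \<theta> * sin \<phi>, cos \<theta>])"

definition solid_angle :: "(real^3) measure" where
  "solid_angle =
     distr (density lborel (\<lambda>(\<theta>, \<phi>). ennreal (indicator ({0..pi} \<times> {0..2*pi}) (\<theta>, \<phi>) * sin \<theta>)))
       (restrict_space borel (sphere 0 1)) sph"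

text \<open>Expansion of \<open>F\<close> at \<open>y\<close> with exponents \<open>e 0 < e 1 < \<dots>\<close> and coefficient functions \<open>f a\<close>
  on the unit sphere, with \<open>f a = 0\<close> if \<open>a\<close> is not an exponent. The uniform limit says that the
  remainder of order \<open>N\<close> is \<open>o(r\<^sup>N)\<close> uniformly in the direction \<open>n\<close>.\<close>

definition has_expansion ::
    "(real^3 \<Rightarrow> real) \<Rightarrow> real^3 \<Rightarrow> (nat \<Rightarrow> real) \<Rightarrow> (real \<Rightarrow> real^3 \<Rightarrow> real) \<Rightarrow> bool" where
  "has_expansion F y e f \<longleftrightarrow>
     strict_mono e \<and> (\<forall>B. finite {k. e k \<le> B}) \<and>
     (\<forall>a n. a \<notin> range e \<longrightarrow> f a n = 0) \<and>
     (\<forall>N::nat. uniform_limit (sphere 0 1)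
        (\<lambda>r n. (F (y + r *\<^sub>R n) - (\<Sum>a\<in>{a \<in> range e. a \<le> real N}. r powr a * f a n)) / r ^ N)
        (\<lambda>_. 0) (at_right 0))"

definition class_F :: "real^3 \<Rightarrow> real^3 \<Rightarrow> (real^3 \<Rightarrow> real) set" where
  "class_F y1 y2 =
     {F. smooth_on (- {y1, y2}) F \<and> (\<exists>e f. has_expansion F y1 e f) \<and> (\<exists>e f. has_expansion F y2 e f)}"

lemma has_expansion_coeff_unique:
  assumes E: "has_expansion F y e f" and E': "has_expansion F y e' f'" and n: "n \<in> sphere 0 1"
  shows "f a n = f' a n"
proof (rule ccontr)
  assume ne: "f a n \<noteq> f' a n"
  define c where "c b = f b n - f' b n" for b
  have fin: "finite {b \<in> range g. b \<le> B}" if "\<forall>B. finite {k. g k \<le> B}" for g :: "nat \<Rightarrow> real" and B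
  proof -
    have "{b \<in> range g. b \<le> B} = g ` {k. g k \<le> B}" by auto
    then show ?thesis using that by simp
  qed
  define R where "R B = {b \<in> range e. b \<le> B} \<union> {b \<in> range e'. b \<le> B}" for B
  have finR: "finite (R B)" for B
    using E E' by (auto simp: R_def has_expansion_def intro!: fin)
  have c0: "c b = 0" if "b \<notin> range e" "b \<notin> range e'" for b
    using E E' that by (auto simp: c_def has_expansion_def)
  define D where "D = {b \<in> R a. c b \<noteq> 0}"
  have aD: "a \<in> D" using ne c0[of a] by (auto simp: D_def R_def c_def)
  have finD: "finite D" using finR by (simp add: D_def)
  define m where "m = Min D"
  have mD: "m \<in> D" using aD finD unfolding m_def by (intro Min_in) auto
  have least: "c b = 0" if "b < m" for b
  proof (rule ccontr)
    assume "c b \<noteq> 0"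
    moreover have "m \<le> a" using aD finD by (simp add: m_def)
    ultimately have "b \<in> D" using that c0[of b] by (auto simp: D_def R_def)
    then show False using that finD by (simp add: m_def leD)
  qed
  obtain N :: nat where N: "m < real N" using reals_Archimedean2 by blast
  have lim: "((\<lambda>r. (F (y + r *\<^sub>R n) - (\<Sum>b\<in>R N. r powr b * g b n)) / r ^ N) \<longlongrightarrow> 0) (at_right 0)"
    if G: "has_expansion F y d g" and sub: "{b \<in> range d. b \<le> real N} \<subseteq> R N" for d g
  proof -
    have "(\<Sum>b\<in>{b \<in> range d. b \<le> real N}. r powr b * g b n) = (\<Sum>b\<in>R N. r powr b * g b n)" for r
      using G sub finR by (intro sum.mono_neutral_left) (auto simp: has_expansion_def R_def)
    moreover have "((\<lambda>r. (F (y + r *\<^sub>R n) -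
        (\<Sum>b\<in>{b \<in> range d. b \<le> real N}. r powr b * g b n)) / r ^ N) \<longlongrightarrow> 0) (at_right 0)"
    proof -
      have "uniform_limit (sphere 0 1) (\<lambda>r n. (F (y + r *\<^sub>R n) -
          (\<Sum>b\<in>{b \<in> range d. b \<le> real N}. r powr b * g b n)) / r ^ N) (\<lambda>_. 0) (at_right 0)"
        using G unfolding has_expansion_def by blast
      from tendsto_uniform_limitI[OF this n] show ?thesis .
    qed
    ultimately show ?thesis by simp
  qed
  have l0: "((\<lambda>r. (\<Sum>b\<in>R N. r powr b * c b) / r ^ N) \<longlongrightarrow> 0) (at_right 0)"
  proof -
    have "((\<lambda>r. (F (y + r *\<^sub>R n) - (\<Sum>b\<in>R N. r powr b * f' b n)) / r ^ N
        - (F (y + r *\<^sub>R n) - (\<Sum>b\<in>R N. r powr b * f b n)) / r ^ N) \<longlongrightarrow> 0 - 0) (at_right 0)"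
      using lim[OF E] lim[OF E'] by (intro tendsto_diff) (auto simp: R_def)
    then show ?thesis
      by (simp add: c_def diff_divide_distrib[symmetric] right_diff_distrib sum_subtractf)
  qed
  have p0: "((\<lambda>r. r powr p) \<longlongrightarrow> 0) (at_right 0)" if "0 < p" for p :: real
  proof -
    have "((\<lambda>r. r powr p) \<longlongrightarrow> 0 powr p) (at_right (0::real))"
      using that by (intro tendsto_powr') (auto simp: eventually_at_filter intro!: tendsto_eq_intros)
    then show ?thesis by simp
  qed
  have "((\<lambda>r. r powr (real N - m) * ((\<Sum>b\<in>R N. r powr b * c b) / r ^ N)) \<longlongrightarrow> 0 * 0) (at_right 0)"
    using p0[of "real N - m"] N l0 by (intro tendsto_mult) auto
  moreover have "\<forall>\<^sub>F r in at_right (0::real).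
      r powr (real N - m) * ((\<Sum>b\<in>R N. r powr b * c b) / r ^ N) = (\<Sum>b\<in>R N. r powr (b - m) * c b)"
    unfolding eventually_at_filter
    by (auto simp: powr_diff powr_realpow sum_distrib_left sum_divide_distrib
        intro!: always_eventually sum.cong)
  ultimately have z: "((\<lambda>r. \<Sum>b\<in>R N. r powr (b - m) * c b) \<longlongrightarrow> 0) (at_right 0)"
    by (auto elim: Lim_transform_eventually)
  have "((\<lambda>r. \<Sum>b\<in>R N. r powr (b - m) * c b) \<longlongrightarrow> (\<Sum>b\<in>R N. if b = m then c m else 0)) (at_right 0)"
  proof (rule tendsto_sum)
    fix b assume "b \<in> R N"
    consider "b < m" | "b = m" | "b > m" by linarith
    then show "((\<lambda>r. r powr (b - m) * c b) \<longlongrightarrow> (if b = m then c m else 0)) (at_right 0)"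
    proof cases
      case 1 then show ?thesis using least by simp
    next
      case 2
      have "\<forall>\<^sub>F r in at_right (0::real). c m = r powr (b - m) * c b"
        using 2 by (auto simp: eventually_at_filter)
      then show ?thesis using 2 by (auto intro: tendsto_eventually elim: eventually_mono)
    next
      case 3 then show ?thesis using tendsto_mult_right[OF p0[of "b - m"], of "c b"] by simp
    qed
  qed
  moreover have "m \<in> R N" using mD N by (auto simp: D_def R_def)
  ultimately have "((\<lambda>r. \<Sum>b\<in>R N. r powr (b - m) * c b) \<longlongrightarrow> c m) (at_right 0)"
    using finR by simp
  with z have "c m = 0" by (intro tendsto_unique[OF _ _ z]) auto
  then show False using mD by (simp add: D_def)
qed

text \<open>By the lemma the coefficients do not depend on the expansion chosen, and neither do the sums
  over exponents below: two choices of exponents differ only by terms with zero coefficient.\<close>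

definition expansion :: "(real^3 \<Rightarrow> real) \<Rightarrow> real^3 \<Rightarrow> (nat \<Rightarrow> real) \<times> (real \<Rightarrow> real^3 \<Rightarrow> real)" where
  "expansion F y = (SOME (e, f). has_expansion F y e f)"

definition exponents :: "(real^3 \<Rightarrow> real) \<Rightarrow> real^3 \<Rightarrow> real set" where
  "exponents F y = range (fst (expansion F y))"

definition coeff_at :: "(real^3 \<Rightarrow> real) \<Rightarrow> real^3 \<Rightarrow> real \<Rightarrow> real^3 \<Rightarrow> real" where
  "coeff_at F y = snd (expansion F y)"

text \<open>The partie finie \<open>(F)\<^sub>y\<close> of \<open>F\<close> at the point \<open>y\<close>.\<close>

definition pf_at :: "(real^3 \<Rightarrow> real) \<Rightarrow> real^3 \<Rightarrow> real" where
  "pf_at F y = (LINT n|solid_angle. coeff_at F y 0 n) / (4 * pi)"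

definition pf_counterterm :: "(real^3 \<Rightarrow> real) \<Rightarrow> real^3 \<Rightarrow> real \<Rightarrow> real \<Rightarrow> real" where
  "pf_counterterm F y \<sigma> s =
     (\<Sum>a\<in>{a \<in> exponents F y. a + 3 < 0}.
        s powr (a + 3) / (a + 3) * (LINT n|solid_angle. coeff_at F y a n))
     + ln (s / \<sigma>) * (LINT n|solid_angle. coeff_at F y (- 3) n)"

definition has_Pf_integral ::
    "real^3 \<Rightarrow> real^3 \<Rightarrow> real \<Rightarrow> real \<Rightarrow> (real^3 \<Rightarrow> real) \<Rightarrow> real \<Rightarrow> bool" where
  "has_Pf_integral y1 y2 s1 s2 F L \<longleftrightarrow>
     (\<forall>s>0. set_integrable lborel (- (cball y1 s \<union> cball y2 s)) F) \<and>
     ((\<lambda>s. (LINT x:- (cball y1 s \<union> cball y2 s)|lborel. F x)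
           + pf_counterterm F y1 s1 s + pf_counterterm F y2 s2 s) \<longlongrightarrow> L) (at_right 0)"

definition Pf_integral :: "real^3 \<Rightarrow> real^3 \<Rightarrow> real \<Rightarrow> real \<Rightarrow> (real^3 \<Rightarrow> real) \<Rightarrow> real" where
  "Pf_integral y1 y2 s1 s2 F = (THE L. has_Pf_integral y1 y2 s1 s2 F L)"

text \<open>\<open>regularized F y\<close> is \<open>F\<close> minus the part of its expansion at \<open>y\<close> that is not locally integrable;
  \<open>sgn (x - y)\<close> is the unit vector from \<open>y\<close> to \<open>x\<close>.\<close>

definition regularized :: "(real^3 \<Rightarrow> real) \<Rightarrow> real^3 \<Rightarrow> real^3 \<Rightarrow> real" where
  "regularized F y x =
     F x - (\<Sum>b\<in>{b \<in> exponents F y. b + 3 \<le> 0}. norm (x - y) powr b * coeff_at F y b (sgn (x - y)))"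

definition sphere_avg :: "real^3 \<Rightarrow> (real^3 \<Rightarrow> real) \<Rightarrow> real \<Rightarrow> real" where
  "sphere_avg y G r = (LINT n|solid_angle. G (y + r *\<^sub>R n)) / (4 * pi)"

text \<open>With \<open>y\<close> the centre of the spheres and \<open>z\<close> the other point, \<open>reg_avg F y z r\<close> is the average of
  the function regularized at \<open>z\<close>: the \<open>I\<close>-average for \<open>r \<le> dist y z\<close> and the \<open>J\<close>-average for
  \<open>r > dist y z\<close>.\<close>

definition reg_avg :: "(real^3 \<Rightarrow> real) \<Rightarrow> real^3 \<Rightarrow> real^3 \<Rightarrow> real \<Rightarrow> real" where
  "reg_avg F y z r = sphere_avg y (regularized F z) r"

text \<open>The radial partie finie comes without the factor \<open>4 * pi\<close>, hence the division of the
  counterterm.\<close>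

definition has_Pf_radial ::
    "real^3 \<Rightarrow> real^3 \<Rightarrow> real \<Rightarrow> (real^3 \<Rightarrow> real) \<Rightarrow> real \<Rightarrow> bool" where
  "has_Pf_radial y z \<sigma> F L \<longleftrightarrow>
     (\<forall>s>0. set_integrable lborel {s..dist y z} (\<lambda>r. r\<^sup>2 * reg_avg F y z r)) \<and>
     ((\<lambda>s. (LINT r:{s..dist y z}|lborel. r\<^sup>2 * reg_avg F y z r)
           + pf_counterterm F y \<sigma> s / (4 * pi)) \<longlongrightarrow> L) (at_right 0)"

definition Pf_radial :: "real^3 \<Rightarrow> real^3 \<Rightarrow> real \<Rightarrow> (real^3 \<Rightarrow> real) \<Rightarrow> real" where
  "Pf_radial y z \<sigma> F = (THE L. has_Pf_radial y z \<sigma> F L)"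

text \<open>The integrand of the radial integral over \<open>r > dist y z\<close>.\<close>

definition outer_integrand :: "(real^3 \<Rightarrow> real) \<Rightarrow> real^3 \<Rightarrow> real^3 \<Rightarrow> real \<Rightarrow> real" where
  "outer_integrand F y z r =
     r\<^sup>2 * reg_avg F y z r + 1 / r * pf_at (\<lambda>x. norm (x - z) ^ 3 * F x) z"

end

theory Submission
  imports Defs
begin

text \<open>Subtracting the singular part of \<open>F\<close> at \<open>z\<close> makes \<open>F\<close> locally integrable there, so polar
  coordinates around \<open>y\<close> turn both radial integrals into integrals of \<open>F\<close> and of the terms
  \<open>\<bar>x - z\<bar> powr b * f\<^sub>b (n\<^sub>z)\<close> over regions bounded by spheres around \<open>y\<close> and a small sphere around \<open>z\<close>.
  In polar coordinates around \<open>z\<close> the latter are elementary radial integrals up to the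
  distance at which the ray in direction \<open>n\<^sub>z\<close> leaves the ball of radius \<open>R\<close> around \<open>y\<close>; that distance is
  \<open>R + O(1)\<close> with derivative \<open>1 + O(1/R)\<close> in \<open>R\<close>. Hence only the \<open>b = -3\<close> term survives for \<open>R \<rightarrow> \<infinity>\<close>, as a
  logarithm, which \<open>1/r\<close> in the outer integrand cancels. The bound on the derivative yields the
  absolute integrability of that integrand although the coefficients \<open>f\<^sub>b\<close> are merely continuous.\<close>

subsection \<open>Polar coordinates\<close>

text \<open>The expansion hypothesis contains no regularity of the coefficients, and a Taylor
  expansion of a singular term on a large sphere around \<open>y\<close> would need their
  derivatives. This obstacle decides the variables: with directions taken at \<open>z\<close>, a
  coefficient is a fixed weight and all dependence on the radius \<open>R\<close> sits in the
  explicit function \<open>exit_dist\<close>. The price is that only integrals over shells are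
  reached this way; the pointwise size of the outer integrand is recovered by differentiating in
  \<open>R\<close>. Continuity of the coefficients comes from the uniformity of the remainder in the
  direction, and gives their boundedness and every integrability over directions. The limits in
  \<open>s\<close> and \<open>R\<close> never meet. A ball of fixed radius around each point absorbs
  the first into a number \<open>local_pf\<close>, since the inner boundary terms cancel the
  counterterms exactly for every small \<open>s\<close>. What remains is an identity at finite
  \<open>R\<close>. In it the lower end of the integral of \<open>1 / r\<close> leaves
  \<open>ln (dist y z)\<close>, which combines with the \<open>ln s2\<close> of the counterterm into
  the logarithm of the theorem.\<close>

definition sph3 :: "real^3 \<Rightarrow> real^3" where
  "sph3 v = vector [v$1 * (sin (v$2) * cos (v$3)), v$1 * (sin (v$2) * sin (v$3)), v$1 * cos (v$2)]"

text \<open>The open ranges of the angles make \<open>sph3\<close> injective. What the image misses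
  lies in the plane \<open>x$2 = 0\<close>, a null set.\<close>

definition sph3_dom :: "(real^3) set" where
  "sph3_dom = {v. 0 < v$1 \<and> 0 < v$2 \<and> v$2 < pi \<and> 0 < v$3 \<and> v$3 < 2 * pi}"

lemma vec3_eq_iff: "(a::real^3) = b \<longleftrightarrow> a$1 = b$1 \<and> a$2 = b$2 \<and> a$3 = b$3"
  by (simp add: vec_eq_iff forall_3)

lemma sph3_nth: "sph3 v $ 1 = v$1 * (sin (v$2) * cos (v$3))"
  "sph3 v $ 2 = v$1 * (sin (v$2) * sin (v$3))" "sph3 v $ 3 = v$1 * cos (v$2)"
  by (simp_all add: sph3_def)

lemma norm_real3: "norm (x::real^3) = sqrt ((x$1)\<^sup>2 + (x$2)\<^sup>2 + (x$3)\<^sup>2)"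
  by (simp add: norm_vec_def L2_set_def sum_3)

lemma norm_sph3: "norm (sph3 v) = \<bar>v$1\<bar>"
proof -
  have "(sph3 v$1)\<^sup>2 + (sph3 v$2)\<^sup>2 + (sph3 v$3)\<^sup>2
    = (v$1)\<^sup>2 * ((sin (v$2))\<^sup>2 * ((cos (v$3))\<^sup>2 + (sin (v$3))\<^sup>2) + (cos (v$2))\<^sup>2)"
    unfolding sph3_nth by algebra
  also have "\<dots> = (v$1)\<^sup>2" by simp
  finally show ?thesis by (simp add: norm_real3)
qed

lemma inj_on_sph3: "inj_on sph3 sph3_dom"
proof (rule inj_onI)
  fix v w assume v: "v \<in> sph3_dom" and w: "w \<in> sph3_dom" and eq: "sph3 v = sph3 w"
  have 1: "v$1 = w$1" using norm_sph3[of v] norm_sph3[of w] eq v w by (simp add: sph3_dom_def)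
  have "sph3 v $ 3 = sph3 w $ 3" using eq by simp
  then have c: "cos (v$2) = cos (w$2)" using 1 w by (simp add: sph3_nth sph3_dom_def)
  have 2: "v$2 = w$2" by (rule cos_inj_pi[OF _ _ _ _ c]) (use v w in \<open>simp_all add: sph3_dom_def\<close>)
  have s: "sin (w$2) > 0" using w by (auto simp: sph3_dom_def intro!: sin_gt_zero)
  have "sph3 v $ 1 = sph3 w $ 1" "sph3 v $ 2 = sph3 w $ 2" using eq by simp_all
  then have "sin (v$3) = sin (w$3) \<and> cos (v$3) = cos (w$3)"
    using s w unfolding sph3_nth 1 2 by (simp add: sph3_dom_def)
  then obtain n :: int where n: "v$3 = w$3 + 2 * pi * n" using sin_cos_eq_iff by blast
  have "\<bar>v$3 - w$3\<bar> < 2 * pi" using v w by (auto simp: sph3_dom_def)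
  then have "2 * pi * \<bar>real_of_int n\<bar> < 2 * pi * 1" using n by (simp add: abs_mult)
  then have "\<bar>real_of_int n\<bar> < 1" by simp
  then have "n = 0" by linarith
  then show "v = w" using n 1 2 by (simp add: vec3_eq_iff)
qed

text \<open>Here \<open>q\<close> is the distance from the polar axis. The condition
  \<open>x$2 \<noteq> 0\<close> makes it positive and keeps the azimuth \<open>p\<close> away from
  the excluded value 0.\<close>

lemma sph3_image: "- {x. x$2 = 0} \<subseteq> sph3 ` sph3_dom"
proof
  fix x :: "real^3" assume "x \<in> - {x. x$2 = 0}"
  then have x2: "x$2 \<noteq> 0" by simp
  define r where "r = norm x"
  define q where "q = sqrt ((x$1)\<^sup>2 + (x$2)\<^sup>2)"
  have q0: "q > 0" unfolding q_def using x2 by (simp add: sum_power2_gt_zero_iff)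
  have q2: "q\<^sup>2 = (x$1)\<^sup>2 + (x$2)\<^sup>2" unfolding q_def by simp
  have r2: "r\<^sup>2 = q\<^sup>2 + (x$3)\<^sup>2" unfolding r_def norm_real3 q2 by simp
  have r0: "r > 0" using x2 by (auto simp: r_def)
  have zr: "(q/r)\<^sup>2 + (x$3/r)\<^sup>2 = 1" using r0
    unfolding power_divide add_divide_distrib[symmetric] r2[symmetric] by simp
  define t where "t = arccos (x$3/r)"
  have "(x$3/r)\<^sup>2 < 1" using zr q0 r0 by (smt (verit) zero_less_power divide_pos_pos)
  then have zb: "- 1 < x$3/r" "x$3/r < 1" using abs_square_less_1[of "x$3/r"] by linarith+
  then have t: "0 < t" "t < pi" "cos t = x$3/r" unfolding t_def
    using arccos_lt_bounded[OF zb] zb by simp_all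
  have "(sin t)\<^sup>2 = (q/r)\<^sup>2" using zr t by (simp add: sin_squared_eq)
  then have st: "sin t = q/r" using sin_gt_zero[OF t(1,2)] q0 r0
    by (smt (verit) divide_pos_pos power2_eq_iff)
  have "(x$1/q)\<^sup>2 + (x$2/q)\<^sup>2 = 1" using q0
    unfolding power_divide add_divide_distrib[symmetric] q2[symmetric] by simp
  then obtain p where p: "0 \<le> p" "p < 2*pi" "x$1/q = cos p" "x$2/q = sin p"
    using sincos_total_2pi by metis
  have "p \<noteq> 0" using p x2 q0 by auto
  then have "vector [r,t,p] \<in> sph3_dom" using p t r0 by (auto simp: sph3_dom_def)
  moreover have "x = sph3 (vector [r,t,p])"
    unfolding vec3_eq_iff sph3_nth using r0 q0 by (simp add: t st p(3,4)[symmetric])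
  ultimately show "x \<in> sph3 ` sph3_dom" by blast
qed

text \<open>The Frechet derivative of \<open>sph3\<close> at \<open>v\<close>, applied to the
  increment \<open>h\<close>.\<close>

definition sph3' :: "real^3 \<Rightarrow> real^3 \<Rightarrow> real^3" where
  "sph3' v h = vector [h$1 * (sin (v$2) * cos (v$3)) + v$1 * (cos (v$2) * h$2 * cos (v$3) - sin (v$2) * (sin (v$3) * h$3)),
     h$1 * (sin (v$2) * sin (v$3)) + v$1 * (cos (v$2) * h$2 * sin (v$3) + sin (v$2) * (cos (v$3) * h$3)),
     h$1 * cos (v$2) - v$1 * (sin (v$2) * h$2)]"

lemma sph3_has_derivative: "(sph3 has_derivative sph3' v) (at v within S)"
proof -
  note d = bounded_linear.has_derivative[OF bounded_linear_vec_nth]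
  have "((\<lambda>v. sph3 v $ i) has_derivative (\<lambda>h. sph3' v h $ i)) (at v within S)" for i
  proof -
    have "i = 1 \<or> i = 2 \<or> i = 3" using exhaust_3 by blast
    moreover have "((\<lambda>v. sph3 v $ 1) has_derivative (\<lambda>h. sph3' v h $ 1)) (at v within S)"
      unfolding sph3_nth sph3'_def by (rule derivative_eq_intros d refl | simp add: algebra_simps)+
    moreover have "((\<lambda>v. sph3 v $ 2) has_derivative (\<lambda>h. sph3' v h $ 2)) (at v within S)"
      unfolding sph3_nth sph3'_def by (rule derivative_eq_intros d refl | simp add: algebra_simps)+
    moreover have "((\<lambda>v. sph3 v $ 3) has_derivative (\<lambda>h. sph3' v h $ 3)) (at v within S)"
      unfolding sph3_nth sph3'_def by (rule derivative_eq_intros d refl | simp add: algebra_simps)+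
    ultimately show ?thesis by blast
  qed
  then show ?thesis
    by (subst has_derivative_componentwise_within) (auto simp: Basis_vec_def inner_axis)
qed

text \<open>The factors sin^2 + cos^2 are left standing at first, so that the identity is polynomial
  in the sines and cosines and \<open>algebra\<close> can decide it.\<close>

lemma det_sph3': "det (matrix (sph3' v)) = (v$1)\<^sup>2 * sin (v$2)"
proof -
  have "det (matrix (sph3' v)) = (v$1)\<^sup>2 * sin (v$2) *
    (((sin (v$2))\<^sup>2 + (cos (v$2))\<^sup>2) * ((sin (v$3))\<^sup>2 + (cos (v$3))\<^sup>2))"
    unfolding det_3 matrix_def sph3'_def
    apply (simp add: axis_def power2_eq_square) by algebra
  then show ?thesis by simp
qed

lemma continuous_on_sph3: "continuous_on S sph3"
  using has_derivative_continuous[OF sph3_has_derivative]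
  by (simp add: continuous_at_imp_continuous_on)

lemma open_sph3_dom: "open sph3_dom"
  unfolding sph3_dom_def by (intro open_Collect_conj open_Collect_less continuous_on_component continuous_on_const continuous_on_id)

text \<open>Change of variables for injective differentiable maps, on the part \<open>S\<close> of
  the domain that \<open>sph3\<close> sends into the box. The image of \<open>S\<close> is the box
  up to a null set, and its finite measure gives the integrability of the Jacobian.\<close>

lemma emeasure_box_sph3:
  "emeasure lborel (box l u) =
    (\<integral>\<^sup>+v. indicator (sph3_dom \<inter> sph3 -` box l u) v * ennreal ((v$1)\<^sup>2 * sin (v$2)) \<partial>lborel)"
proof -
  define S where "S = sph3_dom \<inter> sph3 -` box l u"
  have oS: "open S" unfolding S_def using continuous_on_sph3 open_sph3_dom
    by (intro open_Int open_vimage) auto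
  have S: "S \<in> sets lebesgue" using oS by auto
  have im: "sph3 ` S \<subseteq> box l u" by (auto simp: S_def)
  have sub: "box l u - sph3 ` S \<subseteq> {x. x$2 = 0}" unfolding S_def using sph3_image by blast
  have neg: "negligible (box l u - sph3 ` S)"
    by (rule negligible_subset[OF _ sub]) (rule negligible_standard_hyperplane_cart)
  have eq: "sph3 ` S = box l u - (box l u - sph3 ` S)" using im by blast
  have meas: "sph3 ` S \<in> lmeasurable"
    by (subst eq) (intro fmeasurable.Diff lmeasurable_box negligible_imp_measurable neg)
  have m: "measure lebesgue (sph3 ` S) = measure lebesgue (box l u)"
    by (subst eq) (rule measure_Diff_null_set, use neg in \<open>auto simp: negligible_iff_null_sets\<close>)
  have inj: "inj_on sph3 S" using inj_on_sph3 by (rule inj_on_subset) (auto simp: S_def)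
  have int: "(\<lambda>x. \<bar>det (matrix (sph3' x))\<bar>) integrable_on S"
    using measurable_differentiable_image_eq[OF S sph3_has_derivative inj] meas by blast
  have "measure lebesgue (sph3 ` S) = integral S (\<lambda>x. \<bar>det (matrix (sph3' x))\<bar>)"
    using measure_differentiable_image_eq[OF S sph3_has_derivative inj int] .
  then have hi: "((\<lambda>x. \<bar>det (matrix (sph3' x))\<bar>) has_integral measure lebesgue (box l u)) S"
    using int m by (simp add: has_integral_integral)
  have "emeasure lborel (box l u) = ennreal (measure lebesgue (box l u))"
    using emeasure_lborel_box_finite[of l u]
    by (subst emeasure_eq_ennreal_measure) (simp_all add: measure_completion less_top)
  also have "\<dots> = (\<integral>\<^sup>+v. ennreal (indicator S v * \<bar>det (matrix (sph3' v))\<bar>) \<partial>lborel)"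
    using nn_integral_has_integral_lebesgue[OF _ hi] by simp
  also have "\<dots> = (\<integral>\<^sup>+v. indicator S v * ennreal ((v$1)\<^sup>2 * sin (v$2)) \<partial>lborel)"
  proof (rule nn_integral_cong)
    fix v
    have "sin (v$2) \<ge> 0" if "v \<in> S" using that by (auto simp: S_def sph3_dom_def intro!: sin_ge_zero)
    then show "ennreal (indicator S v * \<bar>det (matrix (sph3' v))\<bar>) = indicator S v * ennreal ((v$1)\<^sup>2 * sin (v$2))"
      by (auto simp: det_sph3' abs_mult split: split_indicator)
  qed
  finally show ?thesis unfolding S_def .
qed

section \<open>Lebesgue measure on \<open>real^3\<close> as a product of three lines\<close>

lemma measurable_vector_3 [measurable]:
  "(\<lambda>(a,b,c). vector [a,b,c] :: real^3) \<in> borel_measurable (borel \<Otimes>\<^sub>M borel \<Otimes>\<^sub>M borel)"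
proof -
  have "continuous_on UNIV (\<lambda>(a,b,c). vector [a,b,c] :: real^3)"
    unfolding case_prod_beta
  proof (rule continuous_on_vec_lambda[where f="\<lambda>i x. vector [fst x, fst (snd x), snd (snd x)] $ i", simplified])
    fix i :: 3
    have "i = 1 \<or> i = 2 \<or> i = 3" using exhaust_3 by blast
    then show "continuous_on UNIV (\<lambda>x::real\<times>real\<times>real. (vector [fst x, fst (snd x), snd (snd x)] ::real^3)$ i)"
      by (elim disjE) (auto intro!: continuous_intros)
  qed
  then show ?thesis
    by (simp add: borel_prod borel_measurable_continuous_onI)
qed

text \<open>The change of variables lives on \<open>real^3\<close>, while the radius and the pair of
  angles are separate factors in polar coordinates; this identity passes between the two, so that
  Fubini applies.\<close>

lemma lborel_vector_3:
  "(lborel :: (real^3) measure) = distr (lborel \<Otimes>\<^sub>M lborel \<Otimes>\<^sub>M lborel) borel (\<lambda>(a,b,c). vector [a,b,c])"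
proof (rule lborel_eqI)
  have [measurable]: "(\<lambda>(a,b,c). vector [a,b,c] :: real^3) \<in> borel_measurable (lborel \<Otimes>\<^sub>M lborel \<Otimes>\<^sub>M lborel)"
    using measurable_vector_3 by (simp add: measurable_def  space_pair_measure sets_pair_measure)
  have sf: "sigma_finite_measure (lborel \<Otimes>\<^sub>M lborel :: (real\<times>real) measure)"
    unfolding lborel_prod by (rule lborel.sigma_finite_measure_axioms)
  have Basis3: "(Basis :: (real^3) set) = (\<lambda>i. axis i 1) ` UNIV" by (auto simp: Basis_vec_def)
  fix l u :: "real^3" assume lu: "\<And>b. b \<in> Basis \<Longrightarrow> l \<bullet> b \<le> u \<bullet> b"
  have le: "l$i \<le> u$i" for i using lu[of "axis i 1"] by (simp add: inner_axis axis_in_Basis_iff)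
  have pre: "(\<lambda>(a,b,c). vector [a,b,c]) -` box l u = {l$1<..<u$1} \<times> {l$2<..<u$2} \<times> {l$3<..<u$3}"
    by (auto simp: mem_box_cart forall_3)
  have "emeasure (distr (lborel \<Otimes>\<^sub>M lborel \<Otimes>\<^sub>M lborel) borel (\<lambda>(a,b,c). vector [a,b,c])) (box l u)
    = emeasure (lborel \<Otimes>\<^sub>M lborel \<Otimes>\<^sub>M lborel) ({l$1<..<u$1} \<times> {l$2<..<u$2} \<times> {l$3<..<u$3})"
    by (subst emeasure_distr) (auto simp: pre space_pair_measure)
  also have "\<dots> = ennreal (u$1-l$1) * (ennreal (u$2-l$2) * ennreal (u$3-l$3))"
    by (subst sigma_finite_measure.emeasure_pair_measure_Times[OF sf]) (simp_all add: lborel.emeasure_pair_measure_Times le)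
  also have "\<dots> = ennreal (\<Prod>b\<in>Basis. (u - l) \<bullet> b)"
  proof -
    have "(\<Prod>b\<in>Basis. (u - l) \<bullet> b) = (\<Prod>i\<in>UNIV. (u - l) $ i)"
      unfolding Basis3 by (subst prod.reindex) (auto simp: inj_on_def axis_eq_axis inner_axis)
    also have "\<dots> = (u$1-l$1) * ((u$2-l$2) * (u$3-l$3))" unfolding UNIV_3 by simp
    finally have "(\<Prod>b\<in>Basis. (u - l) \<bullet> b) = (u$1-l$1) * ((u$2-l$2) * (u$3-l$3))" .
    moreover have "0 \<le> u$i - l$i" for i using le by simp
    ultimately show ?thesis by (simp only: ennreal_mult mult_nonneg_nonneg)
  qed
  finally show "emeasure (distr (lborel \<Otimes>\<^sub>M lborel \<Otimes>\<^sub>M lborel) borel (\<lambda>(a,b,c). vector [a,b,c])) (box l u) = ennreal (\<Prod>b\<in>Basis. (u - l) \<bullet> b)" .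
qed simp

lemma sph_eq_sph3: "sph (t, p) = sph3 (vector [1, t, p])"
  by (simp add: sph_def sph3_def)

lemma measurable_sph [measurable]: "sph \<in> lborel \<rightarrow>\<^sub>M restrict_space borel (sphere 0 1)"
proof (rule measurable_restrict_space2)
  have "(\<lambda>x. sph (fst x, snd x)) = sph3 \<circ> ((\<lambda>(a,b,c). vector [a,b,c]) \<circ> (\<lambda>x. (1, x)))"
    by (auto simp: sph_eq_sph3)
  moreover have "sph3 \<circ> ((\<lambda>(a,b,c). vector [a,b,c]) \<circ> (\<lambda>x. (1, x))) \<in> borel_measurable (borel \<Otimes>\<^sub>M borel)"
    by (intro measurable_comp[of _ _ borel] borel_measurable_continuous_onI continuous_on_sph3
        measurable_comp[OF _ measurable_vector_3] measurable_Pair1') simp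
  ultimately show "sph \<in> borel_measurable lborel" by (simp add: borel_prod)
  show "sph \<in> space lborel \<rightarrow> sphere 0 1"
    using norm_sph3 by (auto simp: sph_eq_sph3)
qed

lemma space_solid_angle [simp]: "space solid_angle = sphere 0 1"
  by (simp add: solid_angle_def space_restrict_space)

lemma sets_solid_angle [measurable_cong]: "sets solid_angle = sets (restrict_space borel (sphere 0 1))"
  by (simp add: solid_angle_def)

lemma measurable_solid_angle_continuous:
  "continuous_on (sphere 0 1) f \<Longrightarrow> (f :: real^3 \<Rightarrow> real) \<in> borel_measurable solid_angle"
  by (simp add: measurable_cong_sets[OF sets_solid_angle refl] borel_measurable_continuous_on_restrict)

lemma measurable_solid_angle_id [measurable]: "(\<lambda>n. n) \<in> solid_angle \<rightarrow>\<^sub>M borel"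
  by (simp add: measurable_cong_sets[OF sets_solid_angle refl] measurable_restrict_space1)

section \<open>The solid angle as a finite measure\<close>

definition polar_density :: "real \<times> real \<Rightarrow> ennreal" where
  "polar_density = (\<lambda>(\<theta>, \<phi>). ennreal (indicator ({0..pi} \<times> {0..2*pi}) (\<theta>, \<phi>) * sin \<theta>))"

lemma measurable_polar_density [measurable]: "polar_density \<in> borel_measurable lborel"
proof -
  have "(\<lambda>x. ennreal (indicator ({0..pi} \<times> {0..2*pi}) x * sin (fst x))) \<in> borel_measurable (borel \<Otimes>\<^sub>M borel)"
    by measurable
  then show ?thesis by (simp add: polar_density_def borel_prod case_prod_beta')
qed

lemma nn_integral_solid_angle:
  assumes "f \<in> borel_measurable solid_angle"
  shows "(\<integral>\<^sup>+n. f n \<partial>solid_angle) = (\<integral>\<^sup>+p. polar_density p * f (sph p) \<partial>lborel)"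
proof -
  have f: "f \<in> borel_measurable (restrict_space borel (sphere 0 1))"
    using assms by (simp add: measurable_cong_sets[OF sets_solid_angle refl])
  have "(\<integral>\<^sup>+n. f n \<partial>solid_angle) = (\<integral>\<^sup>+p. f (sph p) \<partial>density lborel polar_density)"
    unfolding solid_angle_def polar_density_def[symmetric] by (rule nn_integral_distr) (use f in auto)
  also have "\<dots> = (\<integral>\<^sup>+p. polar_density p * f (sph p) \<partial>lborel)"
    by (rule nn_integral_density) (use measurable_compose[OF measurable_sph f] in auto)
  finally show ?thesis .
qed

text \<open>The bound sin \<le> 1 compares the mass with the area of the rectangle of angles. The
  factors \<open>4 * pi\<close> in later formulas come from the divisions in
  \<open>sphere_avg\<close> and \<open>pf_at\<close>, not from this mass.\<close>

interpretation solid_angle: finite_measure solid_angle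
proof
  have "emeasure solid_angle (space solid_angle) = (\<integral>\<^sup>+n. 1 \<partial>solid_angle)" by simp
  also have "\<dots> = (\<integral>\<^sup>+p. polar_density p * 1 \<partial>lborel)" by (rule nn_integral_solid_angle) simp
  also have "\<dots> \<le> (\<integral>\<^sup>+p. indicator (cbox (0,0) (pi,2*pi)) p \<partial>lborel)"
  proof (rule nn_integral_mono)
    fix p :: "real \<times> real"
    have "sin (fst p) \<le> 1" by simp
    then show "polar_density p * 1 \<le> indicator (cbox (0,0) (pi,2*pi)) p"
      by (cases p) (simp add: polar_density_def cbox_Pair_eq ennreal_le_1 indicator_def)
  qed
  also have "\<dots> = emeasure lborel (cbox (0::real,0::real) (pi,2*pi))" by (rule nn_integral_indicator) simp
  also have "\<dots> < \<infinity>" by (rule emeasure_lborel_cbox_finite)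
  finally show "emeasure solid_angle (space solid_angle) \<noteq> \<infinity>" by simp
qed

interpretation lborel_solid_angle: pair_sigma_finite "lborel :: real measure" solid_angle ..

text \<open>The measure is defined over a closed rectangle of angles, \<open>sph3_dom\<close> is
  open. On the sides where the polar angle is 0 or pi the sine vanishes, so only the two sides of
  constant azimuth have to be removed as null sets.\<close>

lemma AE_polar_density:
  "AE p in lborel. polar_density p = ennreal (indicator ({0<..<pi} \<times> {0<..<2*pi}) p * sin (fst p))"
proof -
  have "negligible {p :: real \<times> real. (0,1) \<bullet> p = 0}" "negligible {p :: real \<times> real. (0,1) \<bullet> p = 2 * pi}"
    by (rule negligible_hyperplane; simp add: zero_prod_def)+
  then have "AE p in lborel. p \<notin> {p :: real \<times> real. (0,1) \<bullet> p = 0}" "AE p in lborel. p \<notin> {p :: real \<times> real. (0,1) \<bullet> p = 2 * pi}"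
    using AE_not_in AE_completion_iff unfolding negligible_iff_null_sets by blast+
  then show ?thesis
  proof eventually_elim
    case (elim p)
    then show ?case by (cases p) (auto simp: polar_density_def indicator_def less_le)
  qed
qed

text \<open>For centre 0 the two measures agree on boxes by \<open>emeasure_box_sph3\<close>: the
  Jacobian splits into the radial density r^2 and the sine in the density of the solid angle.
  Translation invariance moves the centre to \<open>y\<close>.\<close>

lemma polar_lborel:
  "lborel = distr (density (lborel \<Otimes>\<^sub>M solid_angle) (\<lambda>(r, n). ennreal (indicator {0<..} r * r\<^sup>2))) borel
     (\<lambda>(r, n). y + r *\<^sub>R n)"
proof -
  let ?D = "density (lborel \<Otimes>\<^sub>M solid_angle) (\<lambda>(r, n). ennreal (indicator {0<..} r * r\<^sup>2))"
  have 0: "lborel = distr ?D borel (\<lambda>(r, n). r *\<^sub>R n)"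
  proof (rule lborel_eqI)
    fix l u :: "real^3" assume lu: "\<And>b. b \<in> Basis \<Longrightarrow> l \<bullet> b \<le> u \<bullet> b"
    have [measurable]: "(\<lambda>(r, n). r *\<^sub>R n) \<in> borel_measurable (lborel \<Otimes>\<^sub>M solid_angle)"
      "(\<lambda>(r, n). r *\<^sub>R n) \<in> borel_measurable ?D"
      by measurable
    have [measurable]: "box l u \<in> sets borel" by simp
    have oS: "sph3_dom \<inter> sph3 -` box l u \<in> sets borel" using continuous_on_sph3 open_sph3_dom
      by (intro borel_open open_Int open_vimage) auto
    have h: "(\<lambda>v. indicator (sph3_dom \<inter> sph3 -` box l u) v * ennreal ((v$1)\<^sup>2 * sin (v$2))) \<in> borel_measurable borel"
      using oS by measurable
    have "emeasure (distr ?D borel (\<lambda>(r, n). r *\<^sub>R n)) (box l u)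
      = (\<integral>\<^sup>+x. indicator (box l u) x \<partial>distr ?D borel (\<lambda>(r, n). r *\<^sub>R n))" by simp
    also have "\<dots> = (\<integral>\<^sup>+q. indicator (box l u) ((\<lambda>(r, n). r *\<^sub>R n) q) \<partial>?D)"
      by (rule nn_integral_distr) simp_all
    also have "\<dots> = (\<integral>\<^sup>+q. (\<lambda>(r, n). ennreal (indicator {0<..} r * r\<^sup>2) * indicator (box l u) (r *\<^sub>R n)) q
       \<partial>(lborel \<Otimes>\<^sub>M solid_angle))"
      by (subst nn_integral_density) (auto intro!: nn_integral_cong)
    also have "\<dots> = (\<integral>\<^sup>+r. \<integral>\<^sup>+n. ennreal (indicator {0<..} r * r\<^sup>2) * indicator (box l u) (r *\<^sub>R n) \<partial>solid_angle \<partial>lborel)"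
      by (subst solid_angle.nn_integral_fst[symmetric]) simp_all
    also have "\<dots> = (\<integral>\<^sup>+r. \<integral>\<^sup>+p. indicator (sph3_dom \<inter> sph3 -` box l u) (vector [r, fst p, snd p]) *
      ennreal (r\<^sup>2 * sin (fst p)) \<partial>lborel \<partial>lborel)"
    proof (rule nn_integral_cong)
      fix r :: real
      have "(\<integral>\<^sup>+n. ennreal (indicator {0<..} r * r\<^sup>2) * indicator (box l u) (r *\<^sub>R n) \<partial>solid_angle) =
        (\<integral>\<^sup>+p. polar_density p * (ennreal (indicator {0<..} r * r\<^sup>2) * indicator (box l u) (r *\<^sub>R sph p)) \<partial>lborel)"
        by (rule nn_integral_solid_angle) simp
      also have "\<dots> = (\<integral>\<^sup>+p. indicator (sph3_dom \<inter> sph3 -` box l u) (vector [r, fst p, snd p]) *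
        ennreal (r\<^sup>2 * sin (fst p)) \<partial>lborel)"
      proof (rule nn_integral_cong_AE)
        have "r *\<^sub>R sph p = sph3 (vector [r, fst p, snd p])" for p
          by (simp add: sph_def sph3_def case_prod_beta' vec3_eq_iff)
        then have *: "polar_density p * (ennreal (indicator {0<..} r * r\<^sup>2) * indicator (box l u) (r *\<^sub>R sph p))
          = indicator (sph3_dom \<inter> sph3 -` box l u) (vector [r, fst p, snd p]) * ennreal (r\<^sup>2 * sin (fst p))"
          if "polar_density p = ennreal (indicator ({0<..<pi} \<times> {0<..<2*pi}) p * sin (fst p))" for p
          using that by (auto simp: sph3_dom_def ennreal_mult'' ennreal_mult' mult.commute indicator_def mem_Times_iff)
        show "AE p in lborel. polar_density p * (ennreal (indicator {0<..} r * r\<^sup>2) * indicator (box l u) (r *\<^sub>R sph p))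
          = indicator (sph3_dom \<inter> sph3 -` box l u) (vector [r, fst p, snd p]) * ennreal (r\<^sup>2 * sin (fst p))"
          by (rule AE_mp[OF AE_polar_density]) (intro AE_I2 impI *)
      qed
      finally show "(\<integral>\<^sup>+n. ennreal (indicator {0<..} r * r\<^sup>2) * indicator (box l u) (r *\<^sub>R n) \<partial>solid_angle) = \<dots>" .
    qed
    also have "\<dots> = (\<integral>\<^sup>+x. (\<lambda>v. indicator (sph3_dom \<inter> sph3 -` box l u) v * ennreal ((v$1)\<^sup>2 * sin (v$2)))
       ((\<lambda>(a,b,c). vector [a,b,c]) x) \<partial>(lborel \<Otimes>\<^sub>M lborel \<Otimes>\<^sub>M lborel))"
    proof -
      have "(\<lambda>x. (\<lambda>v. indicator (sph3_dom \<inter> sph3 -` box l u) v * ennreal ((v$1)\<^sup>2 * sin (v$2)))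
       ((\<lambda>(a,b,c). vector [a,b,c]) x)) \<in> borel_measurable (borel \<Otimes>\<^sub>M borel \<Otimes>\<^sub>M borel)"
        by (rule measurable_compose[OF measurable_vector_3 h])
      then have m: "(\<lambda>x. (\<lambda>v. indicator (sph3_dom \<inter> sph3 -` box l u) v * ennreal ((v$1)\<^sup>2 * sin (v$2)))
       ((\<lambda>(a,b,c). vector [a,b,c]) x)) \<in> borel_measurable (lborel \<Otimes>\<^sub>M (lborel :: (real \<times> real) measure))"
        by (simp add: borel_prod lborel_prod)
      show ?thesis unfolding lborel_prod[where 'a=real and 'b=real]
        by (subst lborel.nn_integral_fst[OF m, symmetric]) (simp add: case_prod_beta')
    qed
    also have "\<dots> = (\<integral>\<^sup>+v. indicator (sph3_dom \<inter> sph3 -` box l u) v * ennreal ((v$1)\<^sup>2 * sin (v$2)) \<partial>lborel)"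
    proof -
      have t: "(\<lambda>(a,b,c). vector [a,b,c] :: real^3) \<in> borel_measurable (lborel \<Otimes>\<^sub>M lborel \<Otimes>\<^sub>M lborel)"
        using measurable_vector_3 by (simp add: borel_prod lborel_prod)
      show ?thesis
        by (subst lborel_vector_3, subst nn_integral_distr) (use t h in auto)
    qed
    also have "\<dots> = emeasure lborel (box l u)" by (rule emeasure_box_sph3[symmetric])
    also have "\<dots> = ennreal (\<Prod>b\<in>Basis. (u - l) \<bullet> b)" using lu by simp
    finally show "emeasure (distr ?D borel (\<lambda>(r, n). r *\<^sub>R n)) (box l u) = ennreal (\<Prod>b\<in>Basis. (u - l) \<bullet> b)" .
  qed simp
  have "lborel = distr lborel borel ((+) y)" by (rule lborel_distr_plus[symmetric])
  also have "\<dots> = distr (distr ?D borel (\<lambda>(r, n). r *\<^sub>R n)) borel ((+) y)" using 0 by simp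
  also have "\<dots> = distr ?D borel ((+) y \<circ> (\<lambda>(r, n). r *\<^sub>R n))" by (rule distr_distr) measurable
  also have "(+) y \<circ> (\<lambda>(r, n). r *\<^sub>R n) = (\<lambda>(r, n). y + r *\<^sub>R n)" by auto
  finally show ?thesis .
qed

lemma polar_integral:
  fixes G :: "real^3 \<Rightarrow> real" and y :: "real^3"
  assumes G [measurable]: "G \<in> borel_measurable borel"
  shows "integrable lborel G \<longleftrightarrow>
      integrable (lborel \<Otimes>\<^sub>M solid_angle) (\<lambda>(r, n). indicator {0<..} r * r\<^sup>2 * G (y + r *\<^sub>R n))"
    and "(LINT x|lborel. G x) =
      (LINT q|(lborel \<Otimes>\<^sub>M solid_angle). (\<lambda>(r, n). indicator {0<..} r * r\<^sup>2 * G (y + r *\<^sub>R n)) q)"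
proof -
  let ?d = "\<lambda>q::real\<times>(real^3). indicator {0<..} (fst q) * (fst q)\<^sup>2 :: real"
  let ?D = "density (lborel \<Otimes>\<^sub>M solid_angle) (\<lambda>q. ennreal (?d q))"
  let ?h = "\<lambda>q. y + fst q *\<^sub>R snd q"
  have eq: "lborel = distr ?D borel ?h"
    using polar_lborel[of y] by (simp add: case_prod_beta')
  have [measurable]: "?h \<in> borel_measurable ?D" by measurable
  have m: "(\<lambda>q. G (?h q)) \<in> borel_measurable (lborel \<Otimes>\<^sub>M solid_angle)"
    by (rule measurable_compose[OF _ G]) measurable
  have d: "?d \<in> borel_measurable (lborel \<Otimes>\<^sub>M solid_angle)" by measurable
  show "integrable lborel G \<longleftrightarrow>
      integrable (lborel \<Otimes>\<^sub>M solid_angle) (\<lambda>(r, n). indicator {0<..} r * r\<^sup>2 * G (y + r *\<^sub>R n))"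
    unfolding case_prod_beta'
    by (subst eq, subst integrable_distr_eq, simp, simp, subst integrable_density) (use m d in auto)
  show "(LINT x|lborel. G x) =
      (LINT q|(lborel \<Otimes>\<^sub>M solid_angle). (\<lambda>(r, n). indicator {0<..} r * r\<^sup>2 * G (y + r *\<^sub>R n)) q)"
    unfolding case_prod_beta'
    by (subst eq, subst integral_distr, simp, simp, subst integral_density) (use m d in auto)
qed

section \<open>Integrals over shells, along rays and of separated functions\<close>

lemma dist_polar: "norm n = 1 \<Longrightarrow> 0 \<le> r \<Longrightarrow> dist y (y + r *\<^sub>R n) = r"
  by (simp add: dist_norm norm_minus_commute)

lemma sgn_polar: "norm n = 1 \<Longrightarrow> 0 < r \<Longrightarrow> sgn (r *\<^sub>R n) = n"
  by (simp add: sgn_div_norm)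

text \<open>Since \<open>G\<close> is integrable over the shell only, Fubini is applied to the
  truncation \<open>G'\<close>. On a null set of radii the average may fail to exist and then has
  the default value 0; this matters for the sphere through the other singular point.\<close>

lemma polar_shell:
  fixes G :: "real^3 \<Rightarrow> real"
  assumes G [measurable]: "G \<in> borel_measurable borel" and E [measurable]: "E \<in> sets borel" and E0: "E \<subseteq> {0<..}"
    and int: "set_integrable lborel {x. dist y x \<in> E} G"
  shows "set_integrable lborel E (\<lambda>r. r\<^sup>2 * sphere_avg y G r)"
    and "4 * pi * (LINT r:E|lborel. r\<^sup>2 * sphere_avg y G r) = (LINT x:{x. dist y x \<in> E}|lborel. G x)"
proof -
  define G' where "G' x = indicator {x. dist y x \<in> E} x * G x" for x
  have mE: "{x. dist y x \<in> E} \<in> sets borel" by measurable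
  have [measurable]: "G' \<in> borel_measurable borel" unfolding G'_def using mE by measurable
  have "integrable lborel G'" using int unfolding set_integrable_def G'_def by simp
  then have i: "integrable (lborel \<Otimes>\<^sub>M solid_angle) (\<lambda>(r, n). indicator {0<..} r * r\<^sup>2 * G' (y + r *\<^sub>R n))"
    by (subst (asm) polar_integral(1)[where y=y]) simp_all
  have eq: "(LINT n|solid_angle. (\<lambda>(r, n). indicator {0<..} r * r\<^sup>2 * G' (y + r *\<^sub>R n)) (r, n))
      = 4 * pi * (indicator E r *\<^sub>R (r\<^sup>2 * sphere_avg y G r))" for r
  proof -
    have "(LINT n|solid_angle. (\<lambda>(r, n). indicator {0<..} r * r\<^sup>2 * G' (y + r *\<^sub>R n)) (r, n))
        = (LINT n|solid_angle. indicator E r * r\<^sup>2 * G (y + r *\<^sub>R n))"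
      using E0 by (intro Bochner_Integration.integral_cong)
        (auto simp: G'_def dist_polar indicator_def)
    then show ?thesis by (simp add: sphere_avg_def)
  qed
  have "integrable lborel (\<lambda>r. 4 * pi * (indicator E r *\<^sub>R (r\<^sup>2 * sphere_avg y G r)))"
    using lborel_solid_angle.integrable_fst'[OF i] unfolding eq .
  then show "set_integrable lborel E (\<lambda>r. r\<^sup>2 * sphere_avg y G r)"
    unfolding set_integrable_def by simp
  have "(LINT x:{x. dist y x \<in> E}|lborel. G x) = (LINT x|lborel. G' x)"
    by (simp add: set_lebesgue_integral_def G'_def)
  also have "\<dots> = (LINT r|lborel. 4 * pi * (indicator E r *\<^sub>R (r\<^sup>2 * sphere_avg y G r)))"
    unfolding polar_integral(2)[where y=y, OF \<open>G' \<in> borel_measurable borel\<close>]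
    using lborel_solid_angle.integral_fst'[OF i] unfolding eq by simp
  finally show "4 * pi * (LINT r:E|lborel. r\<^sup>2 * sphere_avg y G r) = (LINT x:{x. dist y x \<in> E}|lborel. G x)"
    by (simp add: set_lebesgue_integral_def)
qed

text \<open>The radial integral is the inner one here: along a ray a singular term is a pure power,
  while the length of the ray inside a ball depends on the direction.\<close>

lemma polar_directional:
  fixes G :: "real^3 \<Rightarrow> real"
  assumes G [measurable]: "G \<in> borel_measurable borel" and int: "integrable lborel G"
  shows "(LINT x|lborel. G x) =
    (LINT n|solid_angle. LINT r|lborel. indicator {0<..} r * r\<^sup>2 * G (y + r *\<^sub>R n))"
proof -
  have i: "integrable (lborel \<Otimes>\<^sub>M solid_angle) (\<lambda>(r, n). indicator {0<..} r * r\<^sup>2 * G (y + r *\<^sub>R n))"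
    using int by (subst (asm) polar_integral(1)[where y=y]) simp_all
  show ?thesis
    unfolding polar_integral(2)[where y=y, OF G]
    using lborel_solid_angle.integral_snd[OF i] by (simp add: case_prod_beta')
qed

text \<open>Integrability of \<open>G\<close> is obtained rather than assumed, from Fubini's
  criterion for a product of a radial and an angular function.\<close>

lemma polar_product:
  fixes f :: "real^3 \<Rightarrow> real" and p :: "real \<Rightarrow> real"
  assumes [measurable]: "p \<in> borel_measurable borel" and G [measurable]: "G \<in> borel_measurable borel"
    and p: "integrable lborel (\<lambda>r. indicator {0<..} r * r\<^sup>2 * p r)" and f: "integrable solid_angle f"
    and Gpf: "\<And>r n. 0 < r \<Longrightarrow> n \<in> sphere 0 1 \<Longrightarrow> G (y + r *\<^sub>R n) = p r * f n"
  shows "integrable lborel G"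
    and "(LINT x|lborel. G x) = (LINT r|lborel. indicator {0<..} r * r\<^sup>2 * p r) * (LINT n|solid_angle. f n)"
proof -
  let ?g = "\<lambda>(r, n). (indicator {0<..} r * r\<^sup>2 * p r) * f n"
  have [measurable]: "f \<in> borel_measurable solid_angle" using f by auto
  have g: "integrable (lborel \<Otimes>\<^sub>M solid_angle) ?g"
  proof (rule lborel_solid_angle.Fubini_integrable)
    show "?g \<in> borel_measurable (lborel \<Otimes>\<^sub>M solid_angle)" by measurable
    show "integrable lborel (\<lambda>x. LINT y|solid_angle. norm (?g (x, y)))"
      using integrable_abs[OF p] by (simp add: abs_mult)
    show "AE x in lborel. integrable solid_angle (\<lambda>y. ?g (x, y))" using f by simp
  qed
  have eq: "(\<lambda>(r, n). indicator {0<..} r * r\<^sup>2 * G (y + r *\<^sub>R n)) q = ?g q"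
    if "q \<in> space (lborel \<Otimes>\<^sub>M solid_angle)" for q
    using that Gpf by (auto simp: space_pair_measure indicator_def)
  show "integrable lborel G"
    using g by (subst polar_integral(1)[where y=y, OF G], subst Bochner_Integration.integrable_cong[OF refl eq]) auto
  have "(LINT x|lborel. G x) = (LINT q|(lborel \<Otimes>\<^sub>M solid_angle). ?g q)"
    unfolding polar_integral(2)[where y=y, OF G] by (intro Bochner_Integration.integral_cong refl eq)
  also have "\<dots> = (LINT r|lborel. indicator {0<..} r * r\<^sup>2 * p r) * (LINT n|solid_angle. f n)"
    using lborel_solid_angle.integral_fst'[OF g, symmetric] by simp
  finally show "(LINT x|lborel. G x) = (LINT r|lborel. indicator {0<..} r * r\<^sup>2 * p r) * (LINT n|solid_angle. f n)" .
qed

text \<open>A primitive of \<open>t powr (b + 2)\<close>, which is \<open>t powr b\<close> times the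
  weight t^2 of polar coordinates. Its values at the inner radius are what the counterterms of the
  partie finie have to cancel.\<close>

definition prim :: "real \<Rightarrow> real \<Rightarrow> real" where
  "prim b t = (if b = - 3 then ln t else t powr (b + 3) / (b + 3))"

lemma prim_has_derivative:
  assumes "0 < t" shows "(prim b has_real_derivative t powr (b + 2)) (at t)"
proof (cases "b = -3")
  case True
  then have "prim b = ln" by (auto simp: prim_def)
  moreover have "t powr (b + 2) = 1 / t" using True assms by (simp add: powr_minus_divide)
  ultimately show ?thesis using DERIV_ln_divide[OF assms] by simp
next
  case False
  then have "((\<lambda>t. t powr (b + 3) / (b + 3)) has_real_derivative t powr (b + 2)) (at t)"
    using assms by (auto intro!: derivative_eq_intros simp: add.commute)
  moreover have "prim b = (\<lambda>t. t powr (b + 3) / (b + 3))" using False by (auto simp: prim_def)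
  ultimately show ?thesis by simp
qed

text \<open>Intervals are half-open so that adjacent shells are disjoint and fit the complement of a
  closed ball.\<close>

lemma set_integral_powr:
  assumes "0 < s"
  shows "set_integrable lborel {s<..t} (\<lambda>r. r powr c)"
    and "s \<le> t \<Longrightarrow> (LINT r:{s<..t}|lborel. r powr (b + 2)) = prim b t - prim b s"
proof -
  have c: "continuous_on {s..t} (\<lambda>r. r powr c)" for c
    using assms by (auto intro!: continuous_intros)
  have i: "set_integrable lborel {s..t} (\<lambda>r. r powr c)" for c
    by (rule borel_integrable_atLeastAtMost') (rule c)
  show "set_integrable lborel {s<..t} (\<lambda>r. r powr c)"
    by (rule set_integrable_subset[OF i]) auto
  assume st: "s \<le> t"
  have "(LINT r:{s<..t}|lborel. r powr (b + 2)) = (LINT r:{s..t}|lborel. r powr (b + 2))"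
  proof (rule set_integral_cong_set)
    have "AE x in lborel. x \<noteq> s" by (rule AE_lborel_singleton)
    then show "AE x in lborel. (x \<in> {s..t}) = (x \<in> {s<..t})" by eventually_elim auto
  qed (auto simp: set_borel_measurable_def)
  also have "\<dots> = prim b t - prim b s"
    unfolding set_lebesgue_integral_def
  proof (rule integral_FTC_atLeastAtMost[OF st])
    show "(prim b has_vector_derivative x powr (b + 2)) (at x within {s..t})" if "s \<le> x" "x \<le> t" for x
      using prim_has_derivative[of x b] that assms
      by (auto simp: has_real_derivative_iff_has_vector_derivative intro: has_vector_derivative_at_within)
  qed (rule c)
  finally show "(LINT r:{s<..t}|lborel. r powr (b + 2)) = prim b t - prim b s" .
qed

subsection \<open>Continuity of expansion coefficients\<close>

lemma uniform_limit_at_right_scale: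
  fixes h :: "real \<Rightarrow> 'a \<Rightarrow> real"
  assumes "uniform_limit S h (\<lambda>_. 0) (at_right 0)" and k: "0 < (k::real)"
  shows "uniform_limit S (\<lambda>r. h (k * r)) (\<lambda>_. 0) (at_right 0)"
proof -
  have "filterlim (\<lambda>r. k * r) (at_right 0) (at_right 0)"
  proof -
    have "((\<lambda>r. k * r) \<longlongrightarrow> k * 0) (at_right 0)" by (intro tendsto_intros)
    moreover have "\<forall>\<^sub>F r in at_right 0. k * r \<in> {0<..}"
      using k by (auto simp: eventually_at_filter)
    ultimately show ?thesis using k by (simp add: filterlim_at eventually_at_filter)
  qed
  then show ?thesis
    using assms(1) unfolding uniform_limit_iff by (auto dest: eventually_compose_filterlim)
qed

lemma uniform_limit_scaled_zero:
  fixes h :: "real \<Rightarrow> 'a \<Rightarrow> real"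
  assumes h: "uniform_limit S h (\<lambda>_. 0) F" and c: "\<forall>\<^sub>F r in F. \<bar>c r\<bar> \<le> C"
  shows "uniform_limit S (\<lambda>r n. c r * h r n) (\<lambda>_. 0) F"
proof (rule uniform_limitI)
  fix \<epsilon> :: real assume e: "0 < \<epsilon>"
  define C' where "C' = max C 1"
  have "0 < \<epsilon> / C'" using e by (simp add: C'_def)
  with h have "\<forall>\<^sub>F r in F. \<forall>n\<in>S. dist (h r n) 0 < \<epsilon> / C'" unfolding uniform_limit_iff by blast
  with c show "\<forall>\<^sub>F r in F. \<forall>n\<in>S. dist (c r * h r n) 0 < \<epsilon>"
  proof eventually_elim
    case (elim r)
    show ?case
    proof
      fix n assume "n \<in> S"
      then have "\<bar>h r n\<bar> < \<epsilon> / C'" using elim by simp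
      moreover have "\<bar>c r\<bar> \<le> C'" using elim by (simp add: C'_def)
      moreover have C': "0 < C'" by (simp add: C'_def)
      ultimately have "\<bar>c r\<bar> * \<bar>h r n\<bar> \<le> C' * \<bar>h r n\<bar>" "C' * \<bar>h r n\<bar> < C' * (\<epsilon> / C')"
        by (auto intro!: mult_right_mono simp: field_simps)
      then show "dist (c r * h r n) 0 < \<epsilon>" using C' by (simp add: abs_mult)
    qed
  qed
qed

text \<open>Passing from \<open>\<Phi> r\<close> to \<open>\<Phi> (2 * r) - 2 powr c * \<Phi> r\<close> removes the term with exponent \<open>c\<close>
  and multiplies the other coefficients by nonzero constants.\<close>

lemma expansion_coeffs_continuous:
  fixes \<Phi> :: "real \<Rightarrow> 'a::metric_space \<Rightarrow> real" and f :: "real \<Rightarrow> 'a \<Rightarrow> real"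
  assumes "finite A" "\<forall>\<^sub>F r in at_right 0. continuous_on S (\<Phi> r)" "\<forall>a\<in>A. a \<le> real N"
    "uniform_limit S (\<lambda>r n. (\<Phi> r n - (\<Sum>a\<in>A. r powr a * f a n)) / r ^ N) (\<lambda>_. 0) (at_right 0)"
  shows "\<forall>a\<in>A. continuous_on S (f a)"
  using assms
proof (induction A arbitrary: \<Phi> f rule: finite_induct)
  case empty
  then show ?case by simp
next
  case (insert c A)
  define R where "R = (\<lambda>r n. (\<Phi> r n - (\<Sum>a\<in>insert c A. r powr a * f a n)) / r ^ N)"
  have R: "uniform_limit S R (\<lambda>_. 0) (at_right 0)" using insert.prems unfolding R_def by simp
  define G where "G r n = \<Phi> (2 * r) n - 2 powr c * \<Phi> r n" for r n
  define g where "g a n = (2 powr a - 2 powr c) * f a n" for a n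
  have cont2: "\<forall>\<^sub>F r in at_right 0. continuous_on S (\<Phi> (2 * r))"
  proof -
    have "filterlim (\<lambda>r. 2 * r) (at_right 0) (at_right (0::real))"
      using filterlim_times_pos[of "\<lambda>r::real. r" 0 "at_right 0" 2 0] by (simp add: filterlim_ident)
    then show ?thesis using insert.prems(1) by (rule eventually_compose_filterlim[rotated])
  qed
  have gc: "\<forall>a\<in>A. continuous_on S (g a)"
  proof (rule insert.IH)
    show "\<forall>\<^sub>F r in at_right 0. continuous_on S (G r)"
      using insert.prems(1) cont2 by eventually_elim (auto simp: G_def intro!: continuous_intros)
    show "\<forall>a\<in>A. a \<le> real N" using insert.prems by simp
    \<comment> \<open>The factor \<open>2 ^ N\<close> undoes the change of the denominator from
      \<open>r ^ N\<close> to \<open>(2 * r) ^ N\<close>.\<close>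
    have "uniform_limit S (\<lambda>r n. 2 ^ N * R (2 * r) n - 2 powr c * R r n) (\<lambda>n. 0 - 0) (at_right 0)"
      using uniform_limit_scaled_zero[OF uniform_limit_at_right_scale[OF R, of 2], of "\<lambda>_. 2^N" "2^N"]
        uniform_limit_scaled_zero[OF R, of "\<lambda>_. 2 powr c" "2 powr c"]
      by (intro uniform_limit_minus) simp_all
    moreover have "\<forall>\<^sub>F r in at_right 0. \<forall>n\<in>S. 2 ^ N * R (2 * r) n - 2 powr c * R r n =
        (G r n - (\<Sum>a\<in>A. r powr a * g a n)) / r ^ N"
    proof -
      have "2 ^ N * R (2 * r) n - 2 powr c * R r n = (G r n - (\<Sum>a\<in>A. r powr a * g a n)) / r ^ N"
        if r: "0 < r" for r n
      proof -
        have 1: "2 ^ N * R (2 * r) n = (\<Phi> (2 * r) n - (\<Sum>a\<in>insert c A. (2 * r) powr a * f a n)) / r ^ N"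
          using r by (simp add: R_def power_mult_distrib)
        have 2: "(\<Sum>a\<in>insert c A. (2 * r) powr a * f a n) - 2 powr c * (\<Sum>a\<in>insert c A. r powr a * f a n)
          = (\<Sum>a\<in>insert c A. r powr a * g a n)"
          unfolding sum_distrib_left sum_subtractf[symmetric]
          using r by (intro sum.cong refl) (simp add: powr_mult g_def algebra_simps)
        have 3: "(\<Sum>a\<in>insert c A. r powr a * g a n) = (\<Sum>a\<in>A. r powr a * g a n)"
          using insert.hyps by (simp add: g_def)
        have "2 ^ N * R (2 * r) n - 2 powr c * R r n =
          (\<Phi> (2 * r) n - 2 powr c * \<Phi> r n - ((\<Sum>a\<in>insert c A. (2 * r) powr a * f a n)
            - 2 powr c * (\<Sum>a\<in>insert c A. r powr a * f a n))) / r ^ N"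
          unfolding 1 unfolding R_def by (simp add: diff_divide_distrib right_diff_distrib)
        then show ?thesis unfolding 2 3 G_def .
      qed
      then show ?thesis by (auto simp: eventually_at_filter)
    qed
    ultimately show "uniform_limit S (\<lambda>r n. (G r n - (\<Sum>a\<in>A. r powr a * g a n)) / r ^ N) (\<lambda>_. 0) (at_right 0)"
      by (subst (asm) uniform_limit_cong) (auto)
  qed
  have A: "continuous_on S (f a)" if "a \<in> A" for a
  proof -
    have "a \<noteq> c" using that insert.hyps by auto
    then have "f a = (\<lambda>n. g a n / (2 powr a - 2 powr c))" and "2 powr a - 2 powr c \<noteq> 0"
      by (auto simp: g_def powr_inj)
    moreover have "continuous_on S (g a)" using that
gc by blast
    ultimately show ?thesis by (auto intro!: continuous_intros)
  qed
  have cN: "c \<le> real N" using insert.prems by simp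
  \<comment> \<open>With the other coefficients known to be continuous, \<open>f c\<close> is a
    uniform limit of continuous functions, namely of what is left of \<open>\<Phi> r\<close> divided
    by \<open>r powr c\<close>. The error is \<open>r powr (real N - c) * R r\<close>, and
    \<open>c \<le> real N\<close> keeps its first factor at most 1 for small
    \<open>r\<close>.\<close>
  have "uniform_limit S (\<lambda>r n. r powr (real N - c) * R r n) (\<lambda>_. 0) (at_right 0)"
  proof (rule uniform_limit_scaled_zero[OF R, where C=1])
    have "\<forall>\<^sub>F r in at_right (0::real). r < 1 \<and> 0 < r"
      by (rule eventually_at_rightI[of 0 1]) auto
    then show "\<forall>\<^sub>F r in at_right 0. \<bar>r powr (real N - c)\<bar> \<le> 1"
      by eventually_elim (use cN in \<open>simp add: powr_le1\<close>)
  qed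
  then have "uniform_limit S (\<lambda>r n. r powr (real N - c) * R r n + f c n) (\<lambda>n. 0 + f c n) (at_right 0)"
    by (intro uniform_limit_intros)
  moreover have "\<forall>\<^sub>F r in at_right 0. continuous_on S (\<lambda>n. r powr (real N - c) * R r n + f c n)"
  proof -
    have pos: "\<forall>\<^sub>F r in at_right (0::real). 0 < r" by (rule eventually_at_right_less)
    from insert.prems(1) pos show ?thesis
    proof eventually_elim
      case (elim r)
      have "r powr (real N - c) * R r n + f c n = (\<Phi> r n - (\<Sum>a\<in>A. r powr a * f a n)) / r powr c" for n
      proof -
        have "r powr (real N - c) / r ^ N = 1 / r powr c"
          using elim by (simp add: powr_diff powr_realpow)
        moreover have "r powr (real N - c) * R r n =
            (\<Phi> r n - (\<Sum>a\<in>insert c A. r powr a * f a n)) * (r powr (real N - c) / r ^ N)"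
          by (simp add: R_def)
        ultimately have "r powr (real N - c) * R r n =
            (\<Phi> r n - (\<Sum>a\<in>insert c A. r powr a * f a n)) * (1 / r powr c)" by simp
        moreover have "(\<Sum>a\<in>insert c A. r powr a * f a n) = r powr c * f c n + (\<Sum>a\<in>A. r powr a * f a n)"
          using insert.hyps by simp
        ultimately show ?thesis using elim by (simp add: diff_divide_distrib add_divide_distrib)
      qed
      then show ?case using elim A by (auto intro!: continuous_intros)
    qed
  qed
  ultimately have "continuous_on S (\<lambda>n. 0 + f c n)"
    by (intro uniform_limit_theorem[rotated]) (auto simp: trivial_limit_at_right_real)
  then show ?case using A by simp
qed

subsection \<open>A single singular point\<close>

text \<open>The values on \<open>X\<close> are arbitrary; they contribute a finite sum of multiples
  of indicators of points.\<close>

lemma borel_measurable_continuous_off_finite: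
  fixes g :: "'a::euclidean_space \<Rightarrow> real"
  assumes X: "finite X" and g: "continuous_on (- X) g"
  shows "g \<in> borel_measurable borel"
proof -
  have "g x = indicator (- X) x *\<^sub>R g x + (\<Sum>p\<in>X. indicator {p} x * g p)" for x
  proof (cases "x \<in> X")
    case True
    have "(\<Sum>p\<in>X. indicator {p} x * g p) = (\<Sum>p\<in>X. if p = x then g p else 0)"
      by (intro sum.cong) (auto simp: indicator_def)
    then show ?thesis using True X by simp
  next
    case False
    then have "(\<Sum>p\<in>X. indicator {p} x * g p) = 0" by (intro sum.neutral) (auto simp: indicator_def)
    then show ?thesis using False by simp
  qed
  moreover have "(\<lambda>x. indicator (- X) x *\<^sub>R g x + (\<Sum>p\<in>X. indicator {p} x * g p)) \<in> borel_measurable borel"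
    using X by (intro borel_measurable_add borel_measurable_sum borel_measurable_continuous_on_indicator g)
      (auto intro!: borel_measurable_times borel_open simp: finite_imp_closed open_Compl)
  ultimately show ?thesis by (metis (no_types, lifting) measurable_cong)
qed

lemma set_integrable_powr_from_0:
  fixes c t :: real
  assumes "-1 < c"
  shows "set_integrable lborel {0<..t} (\<lambda>r. r powr c)"
proof (cases "0 \<le> t")
  case True
  have "(\<lambda>r. r powr c) absolutely_integrable_on {0..t}"
    using has_integral_powr_from_0[OF assms True]
    by (intro nonnegative_absolutely_integrable_1) (auto simp: has_integral_integrable)
  then have "set_integrable lebesgue {0<..t} (\<lambda>r. r powr c)"
    by (rule set_integrable_subset) auto
  then show ?thesis unfolding set_integrable_def
    by (subst (asm) integrable_completion) auto
qed (simp add: set_integrable_def)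

definition sing_term :: "(real^3 \<Rightarrow> real) \<Rightarrow> real^3 \<Rightarrow> real \<Rightarrow> real^3 \<Rightarrow> real" where
  "sing_term F y b x = norm (x - y) powr b * coeff_at F y b (sgn (x - y))"

definition sing_exponents :: "(real^3 \<Rightarrow> real) \<Rightarrow> real^3 \<Rightarrow> real set" where
  "sing_exponents F y = {b \<in> exponents F y. b + 3 \<le> 0}"

definition coeff_integral :: "(real^3 \<Rightarrow> real) \<Rightarrow> real^3 \<Rightarrow> real \<Rightarrow> real" where
  "coeff_integral F y b = (LINT n|solid_angle. coeff_at F y b n)"

lemma regularized_sing_term:
  "regularized F y x = F x - (\<Sum>b\<in>sing_exponents F y. sing_term F y b x)"
  by (simp add: regularized_def sing_term_def sing_exponents_def)

lemma sing_term_polar: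
  "0 < r \<Longrightarrow> norm n = 1 \<Longrightarrow> sing_term F y b (y + r *\<^sub>R n) = r powr b * coeff_at F y b n"
  by (simp add: sing_term_def sgn_polar)

lemma has_expansion_expansion:
  assumes "\<exists>e f. has_expansion F y e f"
  shows "has_expansion F y (fst (expansion F y)) (coeff_at F y)"
proof -
  have "\<exists>ef. case ef of (e, f) \<Rightarrow> has_expansion F y e f" using assms by auto
  from someI_ex[OF this] show ?thesis
    unfolding expansion_def[symmetric] coeff_at_def by (simp add: case_prod_beta')
qed

text \<open>Continuity is asked for on a punctured ball only, so that both points of the theorem are
  instances, with the other point outside the open ball.\<close>

locale singular_point =
  fixes F :: "real^3 \<Rightarrow> real" and y :: "real^3" and \<delta> :: real
  assumes \<delta>: "0 < \<delta>" and cont: "continuous_on (ball y \<delta> - {y}) F"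
    and F_borel [measurable]: "F \<in> borel_measurable borel"
    and expandable: "\<exists>e f. has_expansion F y e f"
begin

lemma finite_exponents: "finite {a \<in> exponents F y. a \<le> B}"
proof -
  have "{a \<in> exponents F y. a \<le> B} = fst (expansion F y) ` {k. fst (expansion F y) k \<le> B}"
    by (auto simp: exponents_def)
  then show ?thesis using has_expansion_expansion[OF expandable] by (simp add: has_expansion_def)
qed

lemma remainder:
  "uniform_limit (sphere 0 1)
     (\<lambda>r n. (F (y + r *\<^sub>R n) - (\<Sum>a\<in>{a \<in> exponents F y. a \<le> real N}. r powr a * coeff_at F y a n)) / r ^ N)
     (\<lambda>_. 0) (at_right 0)"
  using has_expansion_expansion[OF expandable] by (simp add: has_expansion_def exponents_def)

lemma coeff_off_exponents: "a \<notin> exponents F y \<Longrightarrow> coeff_at F y a n = 0"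
  using has_expansion_expansion[OF expandable] by (simp add: has_expansion_def exponents_def)

text \<open>Continuity is inherited from \<open>F\<close> on small spheres. The order
  \<open>N\<close> is taken above \<open>a\<close>, so that the truncated expansion contains the
  term in question.\<close>

lemma continuous_on_coeff: "continuous_on (sphere 0 1) (coeff_at F y a)"
proof (cases "a \<in> exponents F y")
  case True
  obtain N :: nat where N: "a \<le> real N" using real_arch_simple by blast
  have "\<forall>a\<in>{a \<in> exponents F y. a \<le> real N}. continuous_on (sphere 0 1) (coeff_at F y a)"
  proof (rule expansion_coeffs_continuous[OF finite_exponents _ _ remainder])
    have "\<forall>\<^sub>F r in at_right 0. r \<in> {0<..<\<delta>}"
      using \<delta> by (rule eventually_at_right_real)
    then show "\<forall>\<^sub>F r in at_right 0. continuous_on (sphere 0 1) (\<lambda>n. F (y + r *\<^sub>R n))"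
    proof eventually_elim
      case (elim r)
      then show ?case
        by (intro continuous_on_compose2[OF cont]) (auto intro!: continuous_intros simp: dist_norm)
    qed
  qed simp
  then show ?thesis using True N by simp
next
  case False
  then have "coeff_at F y a = (\<lambda>_. 0)" using coeff_off_exponents by auto
  then show ?thesis by simp
qed

lemma coeff_bounded:
  obtains M where "0 < M" "\<And>n. norm n = 1 \<Longrightarrow> \<bar>coeff_at F y a n\<bar> \<le> M"
proof -
  have "compact (coeff_at F y a ` sphere 0 1)"
    by (intro compact_continuous_image continuous_on_coeff compact_sphere)
  then have "bounded (coeff_at F y a ` sphere 0 1)" by (rule compact_imp_bounded)
  then show ?thesis using that unfolding bounded_pos by auto
qed

lemma integrable_coeff: "integrable solid_angle (coeff_at F y a)"
proof -
  obtain M where "\<And>n. norm n = 1 \<Longrightarrow> \<bar>coeff_at F y a n\<bar> \<le> M" using coeff_bounded by blast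
  then show ?thesis
    by (intro solid_angle.integrable_const_bound[of _ M] measurable_solid_angle_continuous
        continuous_on_coeff AE_I2) auto
qed

lemma finite_sing_exponents: "finite (sing_exponents F y)"
  using finite_exponents[of "-3"] by (simp add: sing_exponents_def add.commute le_diff_eq[symmetric])

lemma continuous_on_sing_term: "continuous_on (- {y}) (sing_term F y b)"
  unfolding sing_term_def
  by (intro continuous_intros continuous_on_compose2[OF continuous_on_coeff])
    (auto simp: norm_sgn split: if_splits)

lemma sing_term_borel [measurable]: "sing_term F y b \<in> borel_measurable borel"
  by (rule borel_measurable_continuous_off_finite[OF _ continuous_on_sing_term]) simp

lemma regularized_borel [measurable]: "regularized F y \<in> borel_measurable borel"
  unfolding regularized_sing_term by measurable

lemma sing_term_shell:
  assumes "0 < s"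
  shows "set_integrable lborel {x. dist y x \<in> {s<..t}} (sing_term F y b)"
    and "s \<le> t \<Longrightarrow> (LINT x:{x. dist y x \<in> {s<..t}}|lborel. sing_term F y b x) =
       coeff_integral F y b * (prim b t - prim b s)"
proof -
  let ?G = "\<lambda>x. indicator {x. dist y x \<in> {s<..t}} x * sing_term F y b x"
  let ?p = "\<lambda>r. indicator {s<..t} r * r powr b"
  have pe: "indicator {0<..} r * r\<^sup>2 * ?p r = indicator {s<..t} r *\<^sub>R r powr (b + 2)" for r
    using assms by (auto simp: indicator_def powr_add)
  have "{x. dist y x \<in> {s<..t}} \<in> sets borel" by measurable
  then have Gm: "?G \<in> borel_measurable borel" by measurable
  have pm: "?p \<in> borel_measurable borel" by measurable
  have pi: "integrable lborel (\<lambda>r. indicator {0<..} r * r\<^sup>2 * ?p r)"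
    using set_integral_powr(1)[OF assms, of t "b + 2"] unfolding pe set_integrable_def .
  have eq: "?G (y + r *\<^sub>R n) = ?p r * coeff_at F y b n" if "0 < r" "n \<in> sphere 0 1" for r n
    using that sing_term_polar[of r n F y b] by (auto simp: dist_polar indicator_def)
  show "set_integrable lborel {x. dist y x \<in> {s<..t}} (sing_term F y b)"
    using polar_product(1)[OF pm Gm pi integrable_coeff eq] by (simp add: set_integrable_def)
  assume "s \<le> t"
  then have "(LINT r|lborel. indicator {0<..} r * r\<^sup>2 * ?p r) = prim b t - prim b s"
    using set_integral_powr(2)[OF assms, of t b] unfolding pe set_lebesgue_integral_def by simp
  then show "(LINT x:{x. dist y x \<in> {s<..t}}|lborel. sing_term F y b x) =
       coeff_integral F y b * (prim b t - prim b s)"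
    using polar_product(2)[OF pm Gm pi integrable_coeff eq]
    by (simp add: set_lebesgue_integral_def coeff_integral_def)
qed

text \<open>Order 0 of the expansion is enough: once the exponents up to -3 are removed, finitely
  many in the interval from -3 (excluded) to 0 remain, with a remainder below 1. Taking 0 into the
  minimum \<open>\<beta>\<close> lets \<open>r powr \<beta>\<close> dominate that remainder as
  well.\<close>

lemma regularized_bound:
  obtains t \<beta> C where "0 < t" "-3 < \<beta>" "0 < C"
    "\<And>x. 0 < dist y x \<Longrightarrow> dist y x \<le> t \<Longrightarrow> \<bar>regularized F y x\<bar> \<le> C * dist y x powr \<beta>"
proof -
  define A where "A = {a \<in> exponents F y. -3 < a \<and> a \<le> 0}"
  have finA: "finite A" by (rule finite_subset[OF _ finite_exponents[of 0]]) (auto simp: A_def)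
  define \<beta> where "\<beta> = Min (insert 0 A)"
  have \<beta>A: "\<beta> \<le> a" if "a \<in> A" for a using that finA by (simp add: \<beta>_def)
  have \<beta>0: "\<beta> \<le> 0" using finA by (simp add: \<beta>_def)
  have "\<beta> \<in> insert 0 A" unfolding \<beta>_def using finA by (intro Min_in) auto
  then have \<beta>3: "-3 < \<beta>" by (auto simp: A_def)
  have "\<forall>a. \<exists>M>0. \<forall>n. norm n = 1 \<longrightarrow> \<bar>coeff_at F y a n\<bar> \<le> M" using coeff_bounded by metis
  then obtain M where M0: "\<And>a. 0 < M a" and M: "\<And>a n. norm n = 1 \<Longrightarrow> \<bar>coeff_at F y a n\<bar> \<le> M a" by metis
  define C where "C = 1 + (\<Sum>a\<in>A. M a)"
  have C0: "0 < C" using M0 by (simp add: C_def add_pos_nonneg less_imp_le sum_nonneg)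
  have "\<forall>\<^sub>F r in at_right 0. \<forall>n\<in>sphere 0 1. dist ((F (y + r *\<^sub>R n)
      - (\<Sum>a\<in>{a \<in> exponents F y. a \<le> real 0}. r powr a * coeff_at F y a n)) / r ^ 0) 0 < 1"
    by (rule uniform_limitD[OF remainder[of 0] zero_less_one])
  then obtain t0 where t0: "0 < t0" and rem: "\<And>r n. 0 < r \<Longrightarrow> r < t0 \<Longrightarrow> norm n = 1 \<Longrightarrow>
      \<bar>F (y + r *\<^sub>R n) - (\<Sum>a\<in>{a \<in> exponents F y. a \<le> 0}. r powr a * coeff_at F y a n)\<bar> < 1"
    unfolding eventually_at_right_field by auto
  \<comment> \<open>Halving gives \<open>r < t0\<close> on the closed ball, and
    \<open>r \<le> 1\<close> makes powers of \<open>r\<close> decrease in the exponent.\<close>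
  define t where "t = min (t0 / 2) 1"
  have "\<bar>regularized F y x\<bar> \<le> C * dist y x powr \<beta>" if x: "0 < dist y x" "dist y x \<le> t" for x
  proof -
    define r where "r = dist y x"
    define n where "n = sgn (x - y)"
    have r: "0 < r" "r < t0" "r \<le> 1" using x t0 by (auto simp: r_def t_def)
    have n: "norm n = 1" using x by (auto simp: n_def norm_sgn)
    have xr: "x = y + r *\<^sub>R n"
      using x by (simp add: r_def n_def sgn_div_norm dist_norm norm_minus_commute)
    have split: "{a \<in> exponents F y. a \<le> 0} = sing_exponents F y \<union> A" "sing_exponents F y \<inter> A = {}"
      by (auto simp: sing_exponents_def A_def)
    have "(\<Sum>a\<in>{a \<in> exponents F y. a \<le> 0}. r powr a * coeff_at F y a n) =
      (\<Sum>a\<in>sing_exponents F y. r powr a * coeff_at F y a n) + (\<Sum>a\<in>A. r powr a * coeff_at F y a n)"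
      unfolding split(1) using finA finite_sing_exponents split(2) by (intro sum.union_disjoint)
    moreover have "regularized F y x = F x - (\<Sum>a\<in>sing_exponents F y. r powr a * coeff_at F y a n)"
      unfolding regularized_sing_term xr using r n by (simp add: sing_term_polar)
    ultimately have "\<bar>regularized F y x\<bar> \<le> 1 + \<bar>\<Sum>a\<in>A. r powr a * coeff_at F y a n\<bar>"
      using rem[OF r(1,2) n] unfolding xr[symmetric] by linarith
    also have "\<dots> \<le> 1 + (\<Sum>a\<in>A. r powr \<beta> * M a)"
    proof -
      have "\<bar>\<Sum>a\<in>A. r powr a * coeff_at F y a n\<bar> \<le> (\<Sum>a\<in>A. \<bar>r powr a * coeff_at F y a n\<bar>)"
        by (rule sum_abs)
      also have "\<dots> \<le> (\<Sum>a\<in>A. r powr \<beta> * M a)"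
        using r \<beta>A M[OF n] by (intro sum_mono) (auto simp: abs_mult intro!: mult_mono powr_mono')
      finally show ?thesis by simp
    qed
    also have "\<dots> \<le> r powr \<beta> + (\<Sum>a\<in>A. r powr \<beta> * M a)"
      using powr_mono'[of \<beta> 0 r] r \<beta>0 by simp
    also have "\<dots> = C * r powr \<beta>" by (simp add: C_def sum_distrib_right algebra_simps)
    finally show ?thesis by (simp add: r_def)
  qed
  moreover have "0 < t" using t0 by (simp add: t_def)
  ultimately show ?thesis using that \<beta>3 C0 by blast
qed

lemma regularized_integrable_near: "\<exists>t>0. set_integrable lborel (cball y t) (regularized F y)"
proof -
  obtain t \<beta> C where t: "0 < t" and \<beta>: "-3 < \<beta>" and C: "0 < C"
    and bd: "\<And>x. 0 < dist y x \<Longrightarrow> dist y x \<le> t \<Longrightarrow> \<bar>regularized F y x\<bar> \<le> C * dist y x powr \<beta>"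
    using regularized_bound by blast
  let ?p = "\<lambda>r. indicator {0<..t} r * (C * r powr \<beta>)"
  let ?G = "\<lambda>x. ?p (dist y x)"
  have pe: "indicator {0<..} r * r\<^sup>2 * ?p r = C * (indicator {0<..t} r *\<^sub>R r powr (\<beta> + 2))" for r
    by (auto simp: indicator_def powr_add)
  have pm: "?p \<in> borel_measurable borel" by measurable
  have Gm: "?G \<in> borel_measurable borel" by measurable
  have pi: "integrable lborel (\<lambda>r. indicator {0<..} r * r\<^sup>2 * ?p r)"
    unfolding pe using set_integrable_powr_from_0[of "\<beta> + 2" t] \<beta> unfolding set_integrable_def by simp
  have i: "integrable lborel ?G"
    by (rule polar_product(1)[OF pm Gm pi, where f="\<lambda>_. 1" and y=y]) (simp_all add: dist_polar)
  have ne: "AE x in lborel. x \<noteq> y" by (rule AE_lborel_singleton)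
  have [measurable]: "cball y t \<in> sets borel" by simp
  have "set_integrable lborel (cball y t) (regularized F y)"
    unfolding set_integrable_def
  proof (rule Bochner_Integration.integrable_bound[OF i])
    show "(\<lambda>x. indicator (cball y t) x *\<^sub>R regularized F y x) \<in> borel_measurable lborel"
      using regularized_borel by simp
    show "AE x in lborel. norm (indicator (cball y t) x *\<^sub>R regularized F y x) \<le> norm (?G x)"
      using ne
    proof eventually_elim
      case (elim x)
      then show ?case using bd[of x] C by (auto simp: indicator_def abs_mult)
    qed
  qed
  then show ?thesis using t by blast
qed

lemma regularized_integrable_compact:
  assumes K: "compact K" and FK: "continuous_on (K - {y}) F"
  shows "set_integrable lborel K (regularized F y)"
proof -
  obtain t where t: "0 < t" and int: "set_integrable lborel (cball y t) (regularized F y)"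
    using regularized_integrable_near by blast
  have K2: "compact (K - ball y t)" using K by (rule compact_diff) simp
  have "continuous_on (K - ball y t) (regularized F y)"
    unfolding regularized_sing_term
    by (intro continuous_intros continuous_on_subset[OF FK] continuous_on_subset[OF continuous_on_sing_term])
      (use t in auto)
  from borel_integrable_compact[OF K2 this] have "set_integrable lborel (K - ball y t) (regularized F y)"
    by (simp add: set_integrable_def)
  then have "set_integrable lborel (cball y t \<union> (K - ball y t)) (regularized F y)"
    using int K by (intro set_integrable_Un) (auto simp: borel_compact)
  then show ?thesis
    by (rule set_integrable_subset) (use K in \<open>auto simp: borel_compact\<close>)
qed

text \<open>In terms of \<open>prim\<close> the powers and the logarithm form one sum. The length
  \<open>\<sigma>\<close> enters only with the coefficient of exponent -3, which is zero if -3 is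
  not an exponent.\<close>

lemma pf_counterterm_eq:
  assumes "0 < s" "0 < \<sigma>"
  shows "pf_counterterm F y \<sigma> s = (\<Sum>b\<in>sing_exponents F y. coeff_integral F y b * prim b s)
     - coeff_integral F y (-3) * ln \<sigma>"
proof -
  have A: "{a \<in> exponents F y. a + 3 < 0} = sing_exponents F y - {-3}"
    by (auto simp: sing_exponents_def)
  have 0: "coeff_integral F y (-3) = 0" if "-3 \<notin> sing_exponents F y"
    using that coeff_off_exponents[of "-3"] by (simp add: sing_exponents_def coeff_integral_def)
  have "(\<Sum>b\<in>sing_exponents F y. coeff_integral F y b * prim b s) =
    (\<Sum>b\<in>sing_exponents F y - {-3}. coeff_integral F y b * prim b s) + coeff_integral F y (-3) * ln s"
  proof (cases "-3 \<in> sing_exponents F y")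
    case True
    then show ?thesis using finite_sing_exponents by (subst sum.remove[of _ "-3"]) (auto simp: prim_def)
  next
    case False
    then show ?thesis using 0 by simp
  qed
  moreover have "(\<Sum>b\<in>sing_exponents F y - {-3}. coeff_integral F y b * prim b s) =
    (\<Sum>b\<in>sing_exponents F y - {-3}. s powr (b + 3) / (b + 3) * (LINT n|solid_angle. coeff_at F y b n))"
    by (intro sum.cong) (auto simp: prim_def coeff_integral_def)
  ultimately show ?thesis
    using assms unfolding pf_counterterm_def A by (simp add: coeff_integral_def ln_div algebra_simps)
qed

end

section \<open>Uniform limits and shrinking shells\<close>

lemma tendsto_powr_at_right_0:
  assumes "0 < p" shows "((\<lambda>r. r powr p) \<longlongrightarrow> (0::real)) (at_right 0)"
proof -
  have "((\<lambda>r. r powr p) \<longlongrightarrow> 0 powr p) (at_right (0::real))"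
    using assms by (intro tendsto_powr') (auto simp: eventually_at_filter intro!: tendsto_eq_intros)
  then show ?thesis by simp
qed

lemma uniform_limit_powr_bounded:
  fixes g :: "'a \<Rightarrow> real"
  assumes p: "0 < p" and g: "\<And>n. n \<in> S \<Longrightarrow> \<bar>g n\<bar> \<le> M" and M: "0 < M"
  shows "uniform_limit S (\<lambda>r n. r powr p * g n) (\<lambda>_. 0) (at_right (0::real))"
proof (rule uniform_limitI)
  fix \<epsilon> :: real assume e: "0 < \<epsilon>"
  have "\<forall>\<^sub>F r in at_right (0::real). dist (r powr p) 0 < \<epsilon> / M"
    by (rule tendstoD[OF tendsto_powr_at_right_0[OF p]]) (use e M in simp)
  then show "\<forall>\<^sub>F r in at_right (0::real). \<forall>n\<in>S. dist (r powr p * g n) 0 < \<epsilon>"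
  proof eventually_elim
    case (elim r)
    show ?case
    proof
      fix n assume "n \<in> S"
      then have "r powr p * \<bar>g n\<bar> \<le> r powr p * M" using g by (intro mult_left_mono) auto
      also have "\<dots> < \<epsilon>" using elim M by (simp add: field_simps)
      finally show "dist (r powr p * g n) 0 < \<epsilon>" by (simp add: abs_mult)
    qed
  qed
qed

lemma uniform_limit_sum_zero:
  fixes h :: "'i \<Rightarrow> real \<Rightarrow> 'a \<Rightarrow> real"
  assumes "finite I" "\<And>i. i \<in> I \<Longrightarrow> uniform_limit S (h i) (\<lambda>_. 0) F"
  shows "uniform_limit S (\<lambda>r n. \<Sum>i\<in>I. h i r n) (\<lambda>_. 0) F"
  using assms
proof (induction I rule: finite_induct)
  case empty
  show ?case by (simp add: uniform_limit_const)
next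
  case (insert i I)
  have "uniform_limit S (\<lambda>r n. h i r n + (\<Sum>i\<in>I. h i r n)) (\<lambda>n. 0 + 0) F"
    using insert by (intro uniform_limit_add) auto
  then show ?case using insert by simp
qed

text \<open>Every point of the ball other than \<open>y\<close> lies in the shell once
  \<open>s\<close> is small, and a single point is null; dominated convergence is applied along
  sequences.\<close>

lemma tendsto_shell:
  fixes G :: "real^3 \<Rightarrow> real"
  assumes "set_integrable lborel (cball y t) G"
  shows "((\<lambda>s. LINT x:{x. dist y x \<in> {s<..t}}|lborel. G x) \<longlongrightarrow> (LINT x:cball y t|lborel. G x)) (at_right 0)"
proof (rule tendsto_at_right_sequentially[of 0 1])
  fix S :: "nat \<Rightarrow> real" assume S0: "\<And>n. 0 < S n" and lim: "S \<longlonglongrightarrow> 0"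
  let ?A = "\<lambda>s. {x. dist y x \<in> {s<..t}}"
  have sub: "set_integrable lborel (?A (S n)) G" for n
  proof (rule set_integrable_subset[OF assms])
    show "?A (S n) \<in> sets lborel" by measurable
  qed auto
  have ne: "AE x in lborel. x \<noteq> y" by (rule AE_lborel_singleton)
  show "(\<lambda>n. LINT x:?A (S n)|lborel. G x) \<longlonglongrightarrow> (LINT x:cball y t|lborel. G x)"
    unfolding set_lebesgue_integral_def
  proof (rule integral_dominated_convergence)
    show "integrable lborel (\<lambda>x. norm (indicator (cball y t) x *\<^sub>R G x))"
      using assms unfolding set_integrable_def by (rule integrable_norm)
    show "AE x in lborel. (\<lambda>n. indicator (?A (S n)) x *\<^sub>R G x) \<longlonglongrightarrow> indicator (cball y t) x *\<^sub>R G x"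
      using ne
    proof eventually_elim
      case (elim x)
      then have "\<forall>\<^sub>F n in sequentially. S n < dist y x" using lim by (intro order_tendstoD(2)) auto
      then show ?case by (intro tendsto_eventually) (auto elim!: eventually_mono simp: indicator_def)
    qed
    show "AE x in lborel. norm (indicator (?A (S n)) x *\<^sub>R G x) \<le> norm (indicator (cball y t) x *\<^sub>R G x)" for n
      by (auto simp: indicator_def)
    show "(\<lambda>x. indicator (cball y t) x *\<^sub>R G x) \<in> borel_measurable lborel"
      using assms by (simp add: set_integrable_def borel_measurable_integrable)
    show "(\<lambda>x. indicator (?A (S n)) x *\<^sub>R G x) \<in> borel_measurable lborel" for n
      using sub[of n] unfolding set_integrable_def by (rule borel_measurable_integrable)
  qed
qed simp

lemma sets_dist_vimage: "E \<in> sets borel \<Longrightarrow> {x. dist (y::real^3) x \<in> E} \<in> sets lborel"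
  using measurable_sets[of "dist y" borel borel E] by (simp add: vimage_def)

section \<open>The partie finie at one point\<close>

context singular_point begin

text \<open>To order \<open>N\<close> the remainder of \<open>F\<close> of the same order is used,
  since \<open>N - 3\<close> may be negative. Multiplied by r^3 it is still small. The exponents in
  \<open>B - B1\<close> satisfy \<open>b \<le> real N < b + 3\<close>; after the shift by 3 their
  terms exceed the order \<open>N\<close> and move into the remainder.\<close>

lemma has_expansion_times_cube:
  "has_expansion (\<lambda>x. norm (x - y) ^ 3 * F x) y (\<lambda>k. fst (expansion F y) k + 3) (\<lambda>a. coeff_at F y (a - 3))"
proof -
  let ?e = "fst (expansion F y)"
  note E = has_expansion_expansion[OF expandable]
  have "uniform_limit (sphere 0 1)
        (\<lambda>r n. (norm ((y + r *\<^sub>R n) - y) ^ 3 * F (y + r *\<^sub>R n)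
           - (\<Sum>a\<in>{a \<in> range (\<lambda>k. ?e k + 3). a \<le> real N}. r powr a * coeff_at F y (a - 3) n)) / r ^ N)
        (\<lambda>_. 0) (at_right 0)" for N
  proof -
    define B where "B = {b \<in> exponents F y. b \<le> real N}"
    define B1 where "B1 = {b \<in> exponents F y. b + 3 \<le> real N}"
    define R where "R r n = (F (y + r *\<^sub>R n) - (\<Sum>b\<in>B. r powr b * coeff_at F y b n)) / r ^ N" for r n
    have finB: "finite B" using finite_exponents by (simp add: B_def)
    have B1: "B1 \<subseteq> B" by (auto simp: B1_def B_def)
    have R: "uniform_limit (sphere 0 1) R (\<lambda>_. 0) (at_right 0)"
      using remainder[of N] unfolding R_def B_def by simp
    have "\<forall>\<^sub>F r in at_right (0::real). \<bar>r ^ 3\<bar> \<le> 1"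
      by (rule eventually_at_rightI[of 0 1]) (auto simp: power_le_one)
    then have 1: "uniform_limit (sphere 0 1) (\<lambda>r n. r ^ 3 * R r n) (\<lambda>_. 0) (at_right 0)"
      by (rule uniform_limit_scaled_zero[OF R])
    have 2: "uniform_limit (sphere 0 1)
        (\<lambda>r n. \<Sum>b\<in>B - B1. r powr (b + 3 - real N) * coeff_at F y b n) (\<lambda>_. 0) (at_right 0)"
    proof (rule uniform_limit_sum_zero)
      fix b assume "b \<in> B - B1"
      then have b: "0 < b + 3 - real N" by (auto simp: B_def B1_def)
      obtain M where "0 < M" "\<And>n. norm n = 1 \<Longrightarrow> \<bar>coeff_at F y b n\<bar> \<le> M" using coeff_bounded by blast
      then show "uniform_limit (sphere 0 1) (\<lambda>r n. r powr (b + 3 - real N) * coeff_at F y b n) (\<lambda>_. 0) (at_right 0)"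
        by (intro uniform_limit_powr_bounded[OF b]) auto
    qed (use finB in simp)
    have lim: "uniform_limit (sphere 0 1)
        (\<lambda>r n. r ^ 3 * R r n + (\<Sum>b\<in>B - B1. r powr (b + 3 - real N) * coeff_at F y b n)) (\<lambda>_. 0 + 0) (at_right 0)"
      by (rule uniform_limit_add[OF 1 2])
    have "r ^ 3 * R r n + (\<Sum>b\<in>B - B1. r powr (b + 3 - real N) * coeff_at F y b n) =
        (norm ((y + r *\<^sub>R n) - y) ^ 3 * F (y + r *\<^sub>R n)
           - (\<Sum>a\<in>{a \<in> range (\<lambda>k. ?e k + 3). a \<le> real N}. r powr a * coeff_at F y (a - 3) n)) / r ^ N"
      if r: "0 < r" and n: "n \<in> sphere 0 1" for r n
    proof -
      have A: "{a \<in> range (\<lambda>k. ?e k + 3). a \<le> real N} = (\<lambda>b. b + 3) ` B1"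
        by (auto simp: B1_def exponents_def)
      have "(\<Sum>a\<in>{a \<in> range (\<lambda>k. ?e k + 3). a \<le> real N}. r powr a * coeff_at F y (a - 3) n)
        = (\<Sum>b\<in>B1. r powr (b + 3) * coeff_at F y b n)"
        unfolding A by (subst sum.reindex) (auto simp: inj_on_def)
      also have "\<dots> = r ^ 3 * (\<Sum>b\<in>B1. r powr b * coeff_at F y b n)"
        using r by (simp add: powr_add powr_realpow sum_distrib_left mult_ac)
      finally have S: "(\<Sum>a\<in>{a \<in> range (\<lambda>k. ?e k + 3). a \<le> real N}. r powr a * coeff_at F y (a - 3) n)
        = r ^ 3 * (\<Sum>b\<in>B1. r powr b * coeff_at F y b n)" .
      have "(\<Sum>b\<in>B - B1. r powr (b + 3 - real N) * coeff_at F y b n) =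
        r ^ 3 * (\<Sum>b\<in>B - B1. r powr b * coeff_at F y b n) / r ^ N"
        using r by (simp add: powr_diff powr_add powr_realpow sum_distrib_left sum_divide_distrib mult_ac)
      moreover have "(\<Sum>b\<in>B. r powr b * coeff_at F y b n) =
         (\<Sum>b\<in>B - B1. r powr b * coeff_at F y b n) + (\<Sum>b\<in>B1. r powr b * coeff_at F y b n)"
        by (rule sum.subset_diff[OF B1 finB])
      moreover have "norm ((y + r *\<^sub>R n) - y) = r" using r n by simp
      ultimately show ?thesis
        unfolding R_def S by (simp add: diff_divide_distrib[symmetric] add_divide_distrib[symmetric] algebra_simps)
    qed
    then have ev: "\<forall>\<^sub>F r in at_right 0. \<forall>n\<in>sphere 0 1.
        r ^ 3 * R r n + (\<Sum>b\<in>B - B1. r powr (b + 3 - real N) * coeff_at F y b n) =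
        (norm ((y + r *\<^sub>R n) - y) ^ 3 * F (y + r *\<^sub>R n)
           - (\<Sum>a\<in>{a \<in> range (\<lambda>k. ?e k + 3). a \<le> real N}. r powr a * coeff_at F y (a - 3) n)) / r ^ N"
      unfolding eventually_at_filter by auto
    show ?thesis
      by (rule iffD1[OF uniform_limit_cong lim]) (use ev in auto)
  qed
  moreover have "strict_mono (\<lambda>k. ?e k + 3)"
    using E by (simp add: has_expansion_def strict_mono_def)
  moreover have "finite {k. ?e k + 3 \<le> B}" for B
    using E by (simp add: has_expansion_def le_diff_eq[symmetric])
  moreover have "coeff_at F y (a - 3) n = 0" if "a \<notin> range (\<lambda>k. ?e k + 3)" for a n
  proof (rule coeff_off_exponents)
    show "a - 3 \<notin> exponents F y"
    proof
      assume "a - 3 \<in> exponents F y"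
      then obtain k where "a - 3 = ?e k" by (auto simp: exponents_def)
      then have "a = ?e k + 3" by simp
      with that show False by blast
    qed
  qed
  ultimately show ?thesis unfolding has_expansion_def by blast
qed

text \<open>The coefficients of the product are picked by \<open>SOME\<close>, independently of
  those of \<open>F\<close>; uniqueness of coefficients identifies them with the shifted
  ones.\<close>

lemma pf_at_cube: "pf_at (\<lambda>x. norm (x - y) ^ 3 * F x) y = coeff_integral F y (- 3) / (4 * pi)"
proof -
  let ?G = "\<lambda>x. norm (x - y) ^ 3 * F x"
  have "has_expansion ?G y (fst (expansion ?G y)) (coeff_at ?G y)"
    using has_expansion_times_cube by (intro has_expansion_expansion) blast
  then have "coeff_at ?G y 0 n = coeff_at F y (0 - 3) n" if "n \<in> sphere 0 1" for n
    by (rule has_expansion_coeff_unique[OF _ has_expansion_times_cube that])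
  then have "(LINT n|solid_angle. coeff_at ?G y 0 n) = (LINT n|solid_angle. coeff_at F y (- 3) n)"
    by (intro Bochner_Integration.integral_cong) auto
  then show ?thesis by (simp add: pf_at_def coeff_integral_def)
qed

text \<open>The finite part of the integral of \<open>F\<close> over the ball of radius
  \<open>t\<close>: the regularized function is integrated, and each singular term is represented by
  its primitive at the outer radius alone.\<close>

definition local_pf :: "real \<Rightarrow> real \<Rightarrow> real" where
  "local_pf \<sigma> t = (LINT x:cball y t|lborel. regularized F y x)
     + (\<Sum>b\<in>sing_exponents F y. coeff_integral F y b * prim b t) - coeff_integral F y (- 3) * ln \<sigma>"

lemma regularized_integrable_cball: "t < \<delta> \<Longrightarrow> set_integrable lborel (cball y t) (regularized F y)"
  by (intro regularized_integrable_compact compact_cball continuous_on_subset[OF cont]) auto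

lemma sum_sing_term_shell:
  assumes "0 < s"
  shows "set_integrable lborel {x. dist y x \<in> {s<..t}} (\<lambda>x. \<Sum>b\<in>sing_exponents F y. sing_term F y b x)"
    and "s \<le> t \<Longrightarrow> (LINT x:{x. dist y x \<in> {s<..t}}|lborel. \<Sum>b\<in>sing_exponents F y. sing_term F y b x) =
      (\<Sum>b\<in>sing_exponents F y. coeff_integral F y b * (prim b t - prim b s))"
proof -
  note i = sing_term_shell[OF assms, of t]
  show "set_integrable lborel {x. dist y x \<in> {s<..t}} (\<lambda>x. \<Sum>b\<in>sing_exponents F y. sing_term F y b x)"
    using i(1) unfolding set_integrable_def scaleR_sum_right by (rule Bochner_Integration.integrable_sum)
  assume "s \<le> t"
  then show "(LINT x:{x. dist y x \<in> {s<..t}}|lborel. \<Sum>b\<in>sing_exponents F y. sing_term F y b x) =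
      (\<Sum>b\<in>sing_exponents F y. coeff_integral F y b * (prim b t - prim b s))"
    using i unfolding set_integrable_def set_lebesgue_integral_def scaleR_sum_right
    by (subst Bochner_Integration.integral_sum) auto
qed

lemma shell_integrable:
  assumes "0 < s" "t < \<delta>"
  shows "set_integrable lborel {x. dist y x \<in> {s<..t}} F"
proof -
  have "set_integrable lborel {x. dist y x \<in> {s<..t}} (regularized F y)"
    by (rule set_integrable_subset[OF regularized_integrable_cball[OF assms(2)]]) (auto intro: sets_dist_vimage)
  from set_integral_add(1)[OF this sum_sing_term_shell(1)[OF assms(1)]]
  show ?thesis by (simp add: regularized_sing_term)
qed

text \<open>The values \<open>prim b s\<close> at the inner radius cancel against the counterterm
  identically in \<open>s\<close>, so only the integral of the regularized function still depends on
  \<open>s\<close>.\<close>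

lemma tendsto_local_pf:
  assumes t: "0 < t" "t < \<delta>" and \<sigma>: "0 < \<sigma>"
  shows "((\<lambda>s. (LINT x:{x. dist y x \<in> {s<..t}}|lborel. F x) + pf_counterterm F y \<sigma> s) \<longlongrightarrow> local_pf \<sigma> t) (at_right 0)"
proof -
  let ?c = "(\<Sum>b\<in>sing_exponents F y. coeff_integral F y b * prim b t) - coeff_integral F y (- 3) * ln \<sigma>"
  have "((\<lambda>s. (LINT x:{x. dist y x \<in> {s<..t}}|lborel. regularized F y x) + ?c)
     \<longlongrightarrow> (LINT x:cball y t|lborel. regularized F y x) + ?c) (at_right 0)"
    by (intro tendsto_add tendsto_const tendsto_shell regularized_integrable_cball t)
  moreover have "\<forall>\<^sub>F s in at_right 0. (LINT x:{x. dist y x \<in> {s<..t}}|lborel. regularized F y x) + ?c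
      = (LINT x:{x. dist y x \<in> {s<..t}}|lborel. F x) + pf_counterterm F y \<sigma> s"
  proof (rule eventually_at_rightI[OF _ t(1)])
    fix s assume s: "s \<in> {0<..<t}"
    then have s0: "0 < s" and st: "s \<le> t" by auto
    have "(LINT x:{x. dist y x \<in> {s<..t}}|lborel. regularized F y x) =
       (LINT x:{x. dist y x \<in> {s<..t}}|lborel. F x) -
       (\<Sum>b\<in>sing_exponents F y. coeff_integral F y b * (prim b t - prim b s))"
      unfolding regularized_sing_term
      using set_integral_diff(2)[OF shell_integrable[OF s0 t(2)] sum_sing_term_shell(1)[OF s0]]
      unfolding sum_sing_term_shell(2)[OF s0 st] .
    then show "(LINT x:{x. dist y x \<in> {s<..t}}|lborel. regularized F y x) + ?c
      = (LINT x:{x. dist y x \<in> {s<..t}}|lborel. F x) + pf_counterterm F y \<sigma> s"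
      using s \<sigma> by (simp add: pf_counterterm_eq right_diff_distrib sum_subtractf)
  qed
  ultimately show ?thesis
    unfolding local_pf_def by (auto elim: Lim_transform_eventually simp: algebra_simps)
qed

end

subsection \<open>Two singular points\<close>

text \<open>The point \<open>y\<close> is the centre of the spheres and \<open>z\<close> the point
  at which \<open>F\<close> is regularized. The hypotheses are symmetric, which later gives the
  formula with the points exchanged.\<close>

locale two_singular_points =
  fixes F :: "real^3 \<Rightarrow> real" and y z :: "real^3"
  assumes neq: "y \<noteq> z" and continuous: "continuous_on (- {y, z}) F"
    and expandable_y: "\<exists>e f. has_expansion F y e f" and expandable_z: "\<exists>e f. has_expansion F z e f"
    and integrable_infinity: "\<exists>R. set_integrable lborel {x. R < norm x} F"
begin

lemma F_borel: "F \<in> borel_measurable borel"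
  by (rule borel_measurable_continuous_off_finite[OF _ continuous]) simp

sublocale Y: singular_point F y "dist y z"
  using neq expandable_y F_borel
  by unfold_locales (auto intro!: continuous_on_subset[OF continuous])

sublocale Z: singular_point F z "dist y z"
  using neq expandable_z F_borel
  by unfold_locales (auto intro!: continuous_on_subset[OF continuous] simp: dist_commute)

lemma swap: "two_singular_points F z y"
  using neq continuous expandable_y expandable_z integrable_infinity
  by (simp add: two_singular_points_def insert_commute)

text \<open>Inside a large ball the region is contained in a compact set without singular points;
  beyond that ball the hypothesis at infinity applies.\<close>

lemma integrable_outside:
  assumes "0 < s" shows "set_integrable lborel (- (cball y s \<union> cball z s)) F"
proof -
  obtain R where R: "set_integrable lborel {x. R < norm x} F" using integrable_infinity by blast
  have K: "compact (cball 0 R - (ball y s \<union> ball z s))" by (intro compact_diff) auto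
  have "continuous_on (cball 0 R - (ball y s \<union> ball z s)) F"
    by (rule continuous_on_subset[OF continuous]) (use assms in auto)
  from borel_integrable_compact[OF K this]
  have "set_integrable lborel (cball 0 R - (ball y s \<union> ball z s)) F" by (simp add: set_integrable_def)
  from set_integrable_Un[OF this R]
  have "set_integrable lborel (cball 0 R - (ball y s \<union> ball z s) \<union> {x. R < norm x}) F" by simp
  then show ?thesis by (rule set_integrable_subset) auto
qed

text \<open>A third of the distance makes the closed balls around \<open>y\<close> and
  \<open>z\<close> disjoint.\<close>

definition radius :: real where "radius = dist y z / 3"

lemma radius: "0 < radius" "radius < dist y z" "2 * radius < dist y z"
  using neq by (auto simp: radius_def)

definition pf_value :: "real \<Rightarrow> real \<Rightarrow> real" where
  "pf_value s1 s2 = (LINT x:- (cball y radius \<union> cball z radius)|lborel. F x)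
     + Y.local_pf s1 radius + Z.local_pf s2 radius"

lemma has_Pf_integral_pf_value:
  assumes "0 < s1" "0 < s2"
  shows "has_Pf_integral y z s1 s2 F (pf_value s1 s2)"
  unfolding has_Pf_integral_def
proof (intro conjI allI impI integrable_outside)
  let ?U = "\<lambda>s. - (cball y s \<union> cball z s)"
  let ?A = "\<lambda>p s. {x. dist p x \<in> {s<..radius}}"
  have "((\<lambda>s. (LINT x:?U radius|lborel. F x)
       + ((LINT x:?A y s|lborel. F x) + pf_counterterm F y s1 s)
       + ((LINT x:?A z s|lborel. F x) + pf_counterterm F z s2 s)) \<longlongrightarrow> pf_value s1 s2) (at_right 0)"
    unfolding pf_value_def
    by (intro tendsto_add tendsto_const Y.tendsto_local_pf Z.tendsto_local_pf assms radius)
  moreover have "\<forall>\<^sub>F s in at_right 0. (LINT x:?U radius|lborel. F x)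
       + ((LINT x:?A y s|lborel. F x) + pf_counterterm F y s1 s)
       + ((LINT x:?A z s|lborel. F x) + pf_counterterm F z s2 s)
     = (LINT x:?U s|lborel. F x) + pf_counterterm F y s1 s + pf_counterterm F z s2 s"
  proof (rule eventually_at_rightI[OF _ radius(1)])
    fix s assume s: "s \<in> {0<..<radius}"
    have disj: "\<not> (dist y x \<le> radius \<and> dist z x \<le> radius)" for x
      using dist_triangle[of y z x] radius(3) by (auto simp: dist_commute)
    have iA: "set_integrable lborel (?A y s) F" "set_integrable lborel (?A z s) F"
      using s radius by (auto intro!: Y.shell_integrable Z.shell_integrable simp del: greaterThanAtMost_iff)
    have iU: "set_integrable lborel (?U radius) F" by (rule integrable_outside[OF radius(1)])
    have iUA: "set_integrable lborel (?U radius \<union> ?A y s) F"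
      by (intro set_integrable_Un iU iA sets_dist_vimage) auto
    have "?U s = (?U radius \<union> ?A y s) \<union> ?A z s"
    proof (rule set_eqI)
      fix x show "x \<in> ?U s \<longleftrightarrow> x \<in> (?U radius \<union> ?A y s) \<union> ?A z s"
        using s disj[of x] by (simp add: not_le) (smt (verit))
    qed
    then have "(LINT x:?U s|lborel. F x) = (LINT x:(?U radius \<union> ?A y s) \<union> ?A z s|lborel. F x)" by simp
    also have "\<dots> = (LINT x:?U radius \<union> ?A y s|lborel. F x) + (LINT x:?A z s|lborel. F x)"
      using disj by (intro set_integral_Un iUA iA) auto
    also have "(LINT x:?U radius \<union> ?A y s|lborel. F x) = (LINT x:?U radius|lborel. F x) + (LINT x:?A y s|lborel. F x)"
      by (intro set_integral_Un iU iA) auto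
    finally show "(LINT x:?U radius|lborel. F x)
       + ((LINT x:?A y s|lborel. F x) + pf_counterterm F y s1 s)
       + ((LINT x:?A z s|lborel. F x) + pf_counterterm F z s2 s)
     = (LINT x:?U s|lborel. F x) + pf_counterterm F y s1 s + pf_counterterm F z s2 s" by simp
  qed
  ultimately show "((\<lambda>s. (LINT x:?U s|lborel. F x) + pf_counterterm F y s1 s + pf_counterterm F z s2 s)
      \<longlongrightarrow> pf_value s1 s2) (at_right 0)"
    by (rule Lim_transform_eventually)
qed

lemma Pf_integral_eq:
  assumes "0 < s1" "0 < s2" shows "Pf_integral y z s1 s2 F = pf_value s1 s2"
  unfolding Pf_integral_def
proof (rule the_equality)
  show "has_Pf_integral y z s1 s2 F (pf_value s1 s2)" by (rule has_Pf_integral_pf_value[OF assms])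
  then show "L = pf_value s1 s2" if "has_Pf_integral y z s1 s2 F L" for L
    using that unfolding has_Pf_integral_def by (blast intro: tendsto_unique[OF trivial_limit_at_right_real])
qed

section \<open>The radial integral up to the sphere through the other point\<close>

abbreviation sing_z :: "real^3 \<Rightarrow> real" where
  "sing_z x \<equiv> \<Sum>b\<in>sing_exponents F z. sing_term F z b x"

lemma continuous_on_sing_z: "continuous_on (- {z}) sing_z"
  by (intro continuous_on_sum Z.continuous_on_sing_term)

lemma sing_z_integrable: "compact K \<Longrightarrow> z \<notin> K \<Longrightarrow> set_integrable lborel K sing_z"
  using borel_integrable_compact[of K sing_z] continuous_on_subset[OF continuous_on_sing_z, of K]
  by (auto simp: set_integrable_def)

text \<open>The annulus may contain \<open>z\<close>, where the subtraction has made the function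
  integrable, but it stays away from \<open>y\<close>, where nothing has been subtracted.\<close>

lemma regularized_z_shell_integrable:
  assumes s: "0 < s" and E: "E \<in> sets borel" "E \<subseteq> {s..t}"
  shows "set_integrable lborel {x. dist y x \<in> E} (regularized F z)"
proof (rule set_integrable_subset)
  have "compact (cball y t - ball y s)" by (intro compact_diff) auto
  then show "set_integrable lborel (cball y t - ball y s) (regularized F z)"
    by (rule Z.regularized_integrable_compact) (rule continuous_on_subset[OF continuous], use s in auto)
  show "{x. dist y x \<in> E} \<in> sets lborel" using E by (intro sets_dist_vimage)
  show "{x. dist y x \<in> E} \<subseteq> cball y t - ball y s" using E by auto
qed

lemma reg_avg_shell:
  assumes s: "0 < s" and E: "E \<in> sets borel" "E \<subseteq> {s..t}"
  shows "set_integrable lborel E (\<lambda>r. r\<^sup>2 * reg_avg F y z r)"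
    and "4 * pi * (LINT r:E|lborel. r\<^sup>2 * reg_avg F y z r) = (LINT x:{x. dist y x \<in> E}|lborel. regularized F z x)"
  unfolding reg_avg_def
  using polar_shell[OF Z.regularized_borel E(1) _ regularized_z_shell_integrable[OF s E]] s E(2) by force+

text \<open>Near \<open>y\<close> the regularized function is \<open>F - sing_z\<close>: the first
  part has the finite part \<open>local_pf\<close>, the second is continuous on the ball because
  \<open>z\<close> lies outside it. Between \<open>radius\<close> and \<open>dist y z\<close> no
  limit is involved.\<close>

definition radial_value :: "real \<Rightarrow> real" where
  "radial_value \<sigma> = (Y.local_pf \<sigma> radius + (LINT x:{x. dist y x \<in> {radius<..dist y z}}|lborel. regularized F z x)
     - (LINT x:cball y radius|lborel. sing_z x)) / (4 * pi)"

lemma has_Pf_radial_radial_value: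
  assumes \<sigma>: "0 < \<sigma>"
  shows "has_Pf_radial y z \<sigma> F (radial_value \<sigma>)"
  unfolding has_Pf_radial_def
proof (intro conjI allI impI)
  let ?A = "\<lambda>s t. {x. dist y x \<in> {s<..t}}"
  show "set_integrable lborel {s..dist y z} (\<lambda>r. r\<^sup>2 * reg_avg F y z r)" if "0 < s" for s
    by (rule reg_avg_shell(1)[OF that]) auto
  have zr: "z \<notin> cball y radius" using radius by auto
  have "((\<lambda>s. (((LINT x:?A s radius|lborel. F x) + pf_counterterm F y \<sigma> s)
      + (LINT x:?A radius (dist y z)|lborel. regularized F z x)
      - (LINT x:?A s radius|lborel. sing_z x)) / (4 * pi)) \<longlongrightarrow> radial_value \<sigma>) (at_right 0)"
    unfolding radial_value_def
    by (intro tendsto_intros Y.tendsto_local_pf radius \<sigma> tendsto_shell sing_z_integrable zr compact_cball) simp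
  moreover have "\<forall>\<^sub>F s in at_right 0. (((LINT x:?A s radius|lborel. F x) + pf_counterterm F y \<sigma> s)
      + (LINT x:?A radius (dist y z)|lborel. regularized F z x)
      - (LINT x:?A s radius|lborel. sing_z x)) / (4 * pi)
     = (LINT r:{s..dist y z}|lborel. r\<^sup>2 * reg_avg F y z r) + pf_counterterm F y \<sigma> s / (4 * pi)"
  proof (rule eventually_at_rightI[OF _ radius(1)])
    fix s assume s: "s \<in> {0<..<radius}"
    then have s0: "0 < s" by simp
    \<comment> \<open>The radial partie finie is defined with a closed interval, the shells are
      half-open; one radius is null.\<close>
    have "(LINT r:{s..dist y z}|lborel. r\<^sup>2 * reg_avg F y z r) = (LINT r:{s<..dist y z}|lborel. r\<^sup>2 * reg_avg F y z r)"
    proof (rule set_integral_cong_set)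
      have "AE r in lborel. r \<noteq> s" by (rule AE_lborel_singleton)
      then show "AE r in lborel. (r \<in> {s<..dist y z}) = (r \<in> {s..dist y z})" by eventually_elim auto
      have "set_integrable lborel {s..dist y z} (\<lambda>r. r\<^sup>2 * reg_avg F y z r)"
        by (rule reg_avg_shell(1)[OF s0]) auto
      then show "set_borel_measurable lborel {s..dist y z} (\<lambda>r. r\<^sup>2 * reg_avg F y z r)"
        unfolding set_borel_measurable_def set_integrable_def by (rule borel_measurable_integrable)
      have "set_integrable lborel {s<..dist y z} (\<lambda>r. r\<^sup>2 * reg_avg F y z r)"
        by (rule reg_avg_shell(1)[OF s0]) auto
      then show "set_borel_measurable lborel {s<..dist y z} (\<lambda>r. r\<^sup>2 * reg_avg F y z r)"
        unfolding set_borel_measurable_def set_integrable_def by (rule borel_measurable_integrable)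
    qed
    also have "4 * pi * \<dots> = (LINT x:?A s (dist y z)|lborel. regularized F z x)"
      by (rule reg_avg_shell(2)[OF s0]) auto
    also have "?A s (dist y z) = ?A s radius \<union> ?A radius (dist y z)"
      using s radius by auto
    also have "(LINT x:\<dots>|lborel. regularized F z x) =
        (LINT x:?A s radius|lborel. regularized F z x) + (LINT x:?A radius (dist y z)|lborel. regularized F z x)"
      using s radius
      by (intro set_integral_Un regularized_z_shell_integrable[OF s0, where t="dist y z"]) auto
    also have "(LINT x:?A s radius|lborel. regularized F z x) =
      (LINT x:?A s radius|lborel. F x) - (LINT x:?A s radius|lborel. sing_z x)"
    proof -
      have "set_integrable lborel (?A s radius) sing_z"
        by (rule set_integrable_subset[OF sing_z_integrable[OF compact_cball zr]]) (auto intro: sets_dist_vimage)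
      from set_integral_diff(2)[OF Y.shell_integrable[OF s0 radius(2)] this]
      show ?thesis unfolding regularized_sing_term .
    qed
    finally show "(((LINT x:?A s radius|lborel. F x) + pf_counterterm F y \<sigma> s)
      + (LINT x:?A radius (dist y z)|lborel. regularized F z x)
      - (LINT x:?A s radius|lborel. sing_z x)) / (4 * pi)
     = (LINT r:{s..dist y z}|lborel. r\<^sup>2 * reg_avg F y z r) + pf_counterterm F y \<sigma> s / (4 * pi)"
      by (simp add: field_simps)
  qed
  ultimately show "((\<lambda>s. (LINT r:{s..dist y z}|lborel. r\<^sup>2 * reg_avg F y z r) + pf_counterterm F y \<sigma> s / (4 * pi))
     \<longlongrightarrow> radial_value \<sigma>) (at_right 0)"
    by (rule Lim_transform_eventually)
qed

lemma Pf_radial_eq: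
  assumes "0 < \<sigma>" shows "Pf_radial y z \<sigma> F = radial_value \<sigma>"
  unfolding Pf_radial_def
proof (rule the_equality)
  show "has_Pf_radial y z \<sigma> F (radial_value \<sigma>)" by (rule has_Pf_radial_radial_value[OF assms])
  then show "L = radial_value \<sigma>" if "has_Pf_radial y z \<sigma> F L" for L
    using that unfolding has_Pf_radial_def by (blast intro: tendsto_unique[OF trivial_limit_at_right_real])
qed

end

subsection \<open>Spheres seen from an interior point\<close>

text \<open>For \<open>norm v < r\<close> and a unit vector \<open>n\<close>, the ray \<open>v + \<rho> *\<^sub>R n\<close> leaves the ball of radius \<open>r\<close>
  around the origin at \<open>\<rho> = exit_dist v r n\<close>.\<close>

definition exit_dist :: "real^3 \<Rightarrow> real \<Rightarrow> real^3 \<Rightarrow> real" where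
  "exit_dist v r n = sqrt (r\<^sup>2 - (norm v)\<^sup>2 + (v \<bullet> n)\<^sup>2) - v \<bullet> n"

lemma inner_unit_bounds: "norm n = 1 \<Longrightarrow> \<bar>v \<bullet> n\<bar> \<le> norm v"
  using Cauchy_Schwarz_ineq2[of v n] by simp

text \<open>Completing the square turns \<open>norm (v + \<rho> *\<^sub>R n) \<le> r\<close> into
  \<open>\<bar>\<rho> + u\<bar> \<le> w\<close>. As \<open>v\<close> lies inside the ball,
  \<open>\<bar>u\<bar> < w\<close>, and for nonnegative \<open>\<rho>\<close> only the upper bound
  is a restriction.\<close>

lemma norm_ray_le_iff:
  assumes n: "norm n = 1" and r: "norm v < r" and \<rho>: "0 \<le> \<rho>"
  shows "norm (v + \<rho> *\<^sub>R n) \<le> r \<longleftrightarrow> \<rho> \<le> exit_dist v r n"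
proof -
  define u where "u = v \<bullet> n"
  define w where "w = sqrt (r\<^sup>2 - (norm v)\<^sup>2 + u\<^sup>2)"
  have r0: "0 < r" using r norm_ge_zero[of v] by linarith
  have rv: "(norm v)\<^sup>2 < r\<^sup>2" using r by (intro power_strict_mono) auto
  have w2: "w\<^sup>2 = r\<^sup>2 - (norm v)\<^sup>2 + u\<^sup>2" using rv by (simp add: w_def)
  have uw: "\<bar>u\<bar> < w" unfolding w_def using rv by (intro real_less_rsqrt) simp
  have "(norm (v + \<rho> *\<^sub>R n))\<^sup>2 = (norm v)\<^sup>2 + 2 * \<rho> * u + \<rho>\<^sup>2"
  proof -
    have "(norm (v + \<rho> *\<^sub>R n))\<^sup>2 = v \<bullet> v + 2 * \<rho> * (v \<bullet> n) + \<rho>\<^sup>2 * (n \<bullet> n)"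
      unfolding power2_norm_eq_inner
      by (simp add: inner_add_left inner_add_right inner_commute[of n v] power2_eq_square algebra_simps)
    also have "n \<bullet> n = 1" using n by (simp add: norm_eq_1)
    finally show ?thesis by (simp add: power2_norm_eq_inner u_def)
  qed
  then have e: "(norm (v + \<rho> *\<^sub>R n))\<^sup>2 - r\<^sup>2 = (\<rho> + u)\<^sup>2 - w\<^sup>2"
    using w2 by (simp add: power2_sum)
  have "norm (v + \<rho> *\<^sub>R n) \<le> r \<longleftrightarrow> (norm (v + \<rho> *\<^sub>R n))\<^sup>2 \<le> r\<^sup>2"
    using r0 by (simp add: power2_le_iff_abs_le)
  also have "\<dots> \<longleftrightarrow> (\<rho> + u)\<^sup>2 \<le> w\<^sup>2" using e by linarith
  also have "\<dots> \<longleftrightarrow> \<bar>\<rho> + u\<bar> \<le> w" using uw by (simp add: power2_le_iff_abs_le)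
  also have "\<dots> \<longleftrightarrow> \<rho> \<le> w - u" using uw \<rho> by linarith
  finally show ?thesis by (simp add: exit_dist_def w_def u_def)
qed

lemma exit_dist_bounds:
  assumes n: "norm n = 1" and r: "norm v < r"
  shows "r - norm v \<le> exit_dist v r n" "exit_dist v r n \<le> r + norm v"
proof -
  have "norm (v + (r - norm v) *\<^sub>R n) \<le> norm v + (r - norm v)"
    using norm_triangle_ineq[of v "(r - norm v) *\<^sub>R n"] n r by simp
  then show 1: "r - norm v \<le> exit_dist v r n"
    using norm_ray_le_iff[OF n r, of "r - norm v"] r by simp
  have "norm (v + exit_dist v r n *\<^sub>R n) \<le> r"
    using norm_ray_le_iff[OF n r, of "exit_dist v r n"] 1 r by simp
  moreover have "exit_dist v r n = norm (exit_dist v r n *\<^sub>R n)" using 1 r n by simp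
  ultimately show "exit_dist v r n \<le> r + norm v"
    using norm_triangle_ineq4[of "v + exit_dist v r n *\<^sub>R n" v] by simp
qed

lemma exit_dist_has_derivative:
  assumes n: "norm n = 1" and r: "norm v < r"
  shows "((\<lambda>r. exit_dist v r n) has_real_derivative r / sqrt (r\<^sup>2 - (norm v)\<^sup>2 + (v \<bullet> n)\<^sup>2)) (at r)"
proof -
  have "(norm v)\<^sup>2 < r\<^sup>2" using r by (intro power_strict_mono) auto
  then have "0 < r\<^sup>2 - (norm v)\<^sup>2 + (v \<bullet> n)\<^sup>2" by (simp add: add_pos_nonneg)
  then show ?thesis unfolding exit_dist_def
    by (auto intro!: derivative_eq_intros simp: field_simps)
qed

lemma continuous_on_exit_dist: "continuous_on S (exit_dist v r)"
  unfolding exit_dist_def by (intro continuous_intros)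

section \<open>Decay of the primitives at the exit distance\<close>

lemma ln_one_plus_abs_bound:
  assumes "\<bar>t\<bar> \<le> 1 / 2" shows "\<bar>ln (1 + t)\<bar> \<le> 2 * \<bar>t::real\<bar>"
proof (cases "0 \<le> t")
  case True
  then have "0 \<le> ln (1 + t)" "ln (1 + t) \<le> t" using ln_add_one_self_le_self by auto
  then show ?thesis by simp
next
  case False
  then have "- (-t) - 2 * (-t)\<^sup>2 \<le> ln (1 - (-t))" using assms by (intro ln_one_minus_pos_lower_bound) auto
  moreover have "2 * (-t)\<^sup>2 \<le> - t"
    using False assms mult_left_mono[of "-t" "1/2" "-t"] by (simp add: power2_eq_square)
  moreover have "ln (1 + t) \<le> t" using assms by (intro ln_add_one_self_le_self2) auto
  ultimately show ?thesis using False by simp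
qed

text \<open>Subtracting \<open>ln r\<close> in the case \<open>b = -3\<close> makes this decay at infinity.\<close>

definition exit_prim :: "real^3 \<Rightarrow> real \<Rightarrow> real \<Rightarrow> real^3 \<Rightarrow> real" where
  "exit_prim v b r n = prim b (exit_dist v r n) - (if b = - 3 then ln r else 0)"

text \<open>The power of \<open>r\<close> that bounds the derivative of \<open>exit_prim\<close> in
  \<open>r\<close>. It is below -1 throughout; for \<open>b = - 3\<close> this is due to the
  subtracted logarithm, as \<open>b + 2\<close> would be exactly -1.\<close>

definition decay_exponent :: "real \<Rightarrow> real" where
  "decay_exponent b = (if b = - 3 then - 2 else b + 2)"

text \<open>For \<open>b = - 3\<close> the value is \<open>ln (1 + t)\<close> with
  \<open>\<bar>t\<bar> \<le> norm v / r \<le> 1 / 2\<close>. Otherwise the exit distance is at least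
  \<open>r / 2\<close> and is raised to a negative power.\<close>

lemma exit_prim_small:
  assumes b: "b \<le> -3" and v: "0 < norm v"
  shows "\<exists>C>0. \<forall>r n. 2 * norm v \<le> r \<longrightarrow> norm n = 1 \<longrightarrow> \<bar>exit_prim v b r n\<bar> \<le> C * r powr (decay_exponent b + 1)"
proof (cases "b = -3")
  case True
  have "\<bar>exit_prim v b r n\<bar> \<le> (2 * norm v) * r powr (decay_exponent b + 1)"
    if r: "2 * norm v \<le> r" and n: "norm n = 1" for r n
  proof -
    have r0: "0 < r" "norm v < r" using r v by linarith+
    note bd = exit_dist_bounds[OF n r0(2)]
    define t where "t = (exit_dist v r n - r) / r"
    have t: "\<bar>t\<bar> \<le> norm v / r" using bd r0 by (auto simp: t_def abs_le_iff field_simps)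
    also have "norm v / r \<le> 1 / 2" using r r0 by (simp add: field_simps)
    finally have t2: "\<bar>t\<bar> \<le> 1 / 2" .
    have "exit_dist v r n = (1 + t) * r" using r0 by (simp add: t_def field_simps)
    then have "exit_prim v b r n = ln (1 + t)"
      using r0 t2 True by (simp add: exit_prim_def prim_def ln_mult)
    then have "\<bar>exit_prim v b r n\<bar> \<le> 2 * (norm v / r)" using ln_one_plus_abs_bound[OF t2] t by linarith
    also have "\<dots> = 2 * norm v * r powr (decay_exponent b + 1)"
      using r0 True by (simp add: decay_exponent_def powr_minus_divide)
    finally show ?thesis .
  qed
  then show ?thesis using v by (intro exI[of _ "2 * norm v"]) auto
next
  case False
  then have b: "b + 3 < 0" using b by simp
  define C where "C = (1/2) powr (b + 3) / \<bar>b + 3\<bar>"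
  have "\<bar>exit_prim v b r n\<bar> \<le> C * r powr (decay_exponent b + 1)"
    if r: "2 * norm v \<le> r" and n: "norm n = 1" for r n
  proof -
    have r0: "0 < r" "norm v < r" using r v by linarith+
    have "r / 2 \<le> exit_dist v r n" using exit_dist_bounds(1)[OF n r0(2)] r by simp
    then have "exit_dist v r n powr (b + 3) \<le> (r / 2) powr (b + 3)"
      using r0 b by (intro powr_mono2') auto
    also have "(r / 2) powr (b + 3) = (1/2) powr (b + 3) * r powr (b + 3)"
      using powr_mult[of "1/2" r "b + 3"] r0 by simp
    finally have "exit_dist v r n powr (b + 3) / \<bar>b + 3\<bar> \<le> C * r powr (b + 3)"
      using b by (simp add: C_def divide_right_mono)
    then show ?thesis using False by (simp add: exit_prim_def prim_def decay_exponent_def abs_divide add.commute)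
  qed
  moreover have "0 < C" using b by (simp add: C_def)
  ultimately show ?thesis by blast
qed

text \<open>With \<open>e = w - u\<close> the exit distance has derivative \<open>r / w\<close>. For
  \<open>b = - 3\<close> the derivative \<open>r / (e * w) - 1 / r\<close> has, over the denominator
  \<open>r * e * w\<close>, a numerator from which r^2 has cancelled; this gains one power of
  \<open>r\<close>.\<close>

lemma exit_prim_derivative:
  assumes b: "b \<le> -3" and v: "0 < norm v"
  shows "\<exists>C>0. \<forall>r n. 2 * norm v \<le> r \<longrightarrow> norm n = 1 \<longrightarrow>
    (\<exists>D. ((\<lambda>r. exit_prim v b r n) has_real_derivative D) (at r) \<and> \<bar>D\<bar> \<le> C * r powr decay_exponent b)"
proof -
  \<comment> \<open>The 8 is the quotient of the constants 2 in \<open>num\<close> and 1/4 in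
    \<open>den\<close> below. In the other case 2 bounds \<open>r / w\<close>, and the power of 1/2
    comes from \<open>r / 2 \<le> e\<close>.\<close>
  define C where "C = (if b = -3 then 8 * norm v else 2 * (1/2) powr (b + 2))"
  have C: "0 < C" using v by (simp add: C_def)
  have "\<exists>D. ((\<lambda>r. exit_prim v b r n) has_real_derivative D) (at r) \<and> \<bar>D\<bar> \<le> C * r powr decay_exponent b"
    if r: "2 * norm v \<le> r" and n: "norm n = 1" for r n
  proof -
    have r0: "0 < r" "norm v < r" "norm v \<le> r" using r v by linarith+
    define u where "u = v \<bullet> n"
    define w where "w = sqrt (r\<^sup>2 - (norm v)\<^sup>2 + u\<^sup>2)"
    define e where "e = exit_dist v r n"
    have eu: "e = w - u" by (simp add: e_def w_def u_def exit_dist_def)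
    have u: "\<bar>u\<bar> \<le> norm v" unfolding u_def by (rule inner_unit_bounds[OF n])
    have u2: "u\<^sup>2 \<le> (norm v)\<^sup>2" using u by (simp add: abs_le_square_iff[symmetric])
    have "(norm v)\<^sup>2 \<le> (r/2)\<^sup>2" using r by (intro power_mono) auto
    then have rv: "(norm v)\<^sup>2 \<le> r\<^sup>2 / 4" by (simp add: power_divide)
    have r4: "r\<^sup>2 / 4 \<le> r\<^sup>2 - (norm v)\<^sup>2 + u\<^sup>2"
      using rv zero_le_power2[of r] zero_le_power2[of u] by linarith
    then have w2: "w\<^sup>2 = r\<^sup>2 - (norm v)\<^sup>2 + u\<^sup>2"
      unfolding w_def using zero_le_power2[of r] by (intro real_sqrt_pow2) linarith
    have w_lo: "r / 2 \<le> w" unfolding w_def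
      using r4 by (intro real_le_rsqrt) (simp add: power_divide)
    have w_hi: "w \<le> r" unfolding w_def using u2 r0 by (intro real_le_lsqrt) auto
    have e_lo: "r / 2 \<le> e" unfolding e_def using exit_dist_bounds(1)[OF n r0(2)] r by simp
    have e0: "0 < e" and w0: "0 < w" using e_lo w_lo r0 by linarith+
    have de: "((\<lambda>r. exit_dist v r n) has_real_derivative r / w) (at r)"
      using exit_dist_has_derivative[OF n r0(2)] unfolding w_def u_def .
    have dp: "((\<lambda>r. prim b (exit_dist v r n)) has_real_derivative e powr (b + 2) * (r / w)) (at r)"
      using DERIV_chain2[OF prim_has_derivative de] e0 unfolding e_def by blast
    show ?thesis
    proof (cases "b = -3")
      case True
      have "((\<lambda>r. exit_prim v b r n) has_real_derivative e powr (b + 2) * (r / w) - 1 / r) (at r)"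
        unfolding exit_prim_def using True dp DERIV_ln_divide[OF r0(1)] by (auto intro: DERIV_diff)
      moreover have "\<bar>e powr (b + 2) * (r / w) - 1 / r\<bar> \<le> C * r powr decay_exponent b"
      proof -
        have "e powr (b + 2) * (r / w) - 1 / r = r / (e * w) - 1 / r"
          using True e0 by (simp add: powr_minus_divide)
        also have "\<dots> = (r\<^sup>2 - e * w) / (r * e * w)"
          using r0 e0 w0 by (simp add: field_simps power2_eq_square)
        also have "r\<^sup>2 - e * w = (norm v)\<^sup>2 - u\<^sup>2 + w * u"
          using w2 by (simp add: eu power2_eq_square algebra_simps)
        finally have eq: "e powr (b + 2) * (r / w) - 1 / r = ((norm v)\<^sup>2 - u\<^sup>2 + w * u) / (r * e * w)" .
        have "\<bar>w * u\<bar> \<le> r * norm v" using w_hi w0 u by (simp add: abs_mult mult_mono)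
        moreover have "(norm v)\<^sup>2 \<le> r * norm v" using r0 by (simp add: power2_eq_square mult_right_mono)
        ultimately have num: "\<bar>(norm v)\<^sup>2 - u\<^sup>2 + w * u\<bar> \<le> 2 * (r * norm v)"
          using u2 zero_le_power2[of u] zero_le_power2[of "norm v"] by linarith
        have "r * (r / 2) * (r / 2) \<le> r * e * w" using e_lo w_lo r0
          by (intro mult_mono) auto
        then have den: "r ^ 3 / 4 \<le> r * e * w" by (simp add: power3_eq_cube)
        have "\<bar>((norm v)\<^sup>2 - u\<^sup>2 + w * u) / (r * e * w)\<bar> = \<bar>(norm v)\<^sup>2 - u\<^sup>2 + w * u\<bar> / (r * e * w)"
          using r0 e0 w0 by (simp add: abs_divide abs_mult)
        also have "\<dots> \<le> 2 * (r * norm v) / (r ^ 3 / 4)"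
          using num den r0 by (intro frac_le) auto
        also have "\<dots> = 8 * norm v / r\<^sup>2" using r0 by (simp add: power3_eq_cube power2_eq_square)
        also have "\<dots> = C * r powr decay_exponent b"
          using True r0 by (simp add: C_def decay_exponent_def powr_minus_divide powr_numeral)
        finally show ?thesis unfolding eq .
      qed
      ultimately show ?thesis by blast
    next
      case False
      have "((\<lambda>r. exit_prim v b r n) has_real_derivative e powr (b + 2) * (r / w)) (at r)"
        unfolding exit_prim_def using False dp by simp
      moreover have "\<bar>e powr (b + 2) * (r / w)\<bar> \<le> C * r powr decay_exponent b"
      proof -
        have "e powr (b + 2) \<le> (r / 2) powr (b + 2)" using e_lo r0 b by (intro powr_mono2') auto
        also have "(r / 2) powr (b + 2) = (1/2) powr (b + 2) * r powr (b + 2)"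
          using powr_mult[of "1/2" r "b + 2"] r0 by simp
        finally have 1: "e powr (b + 2) \<le> (1/2) powr (b + 2) * r powr (b + 2)" .
        have 2: "r / w \<le> 2" using w_lo w0 by (simp add: field_simps)
        have "e powr (b + 2) * (r / w) \<le> (1/2) powr (b + 2) * r powr (b + 2) * 2"
          using 1 2 r0 w0 by (intro mult_mono) auto
        then show ?thesis using False r0 w0 by (simp add: C_def decay_exponent_def abs_mult mult_ac)
      qed
      ultimately show ?thesis by blast
    qed
  qed
  then show ?thesis using C by blast
qed

text \<open>Mean value theorem in the radius; the bound on the derivative decreases, so its value at
  the left end serves for the whole interval. Being uniform in \<open>n\<close>, the estimate
  survives integration against a bounded coefficient.\<close>

lemma exit_prim_lipschitz:
  assumes b: "b \<le> -3" and v: "0 < norm v"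
  shows "\<exists>C>0. \<forall>r s n. 2 * norm v \<le> r \<longrightarrow> r < s \<longrightarrow> norm n = 1 \<longrightarrow>
    \<bar>exit_prim v b s n - exit_prim v b r n\<bar> \<le> C * (s - r) * r powr decay_exponent b"
proof -
  obtain C where C: "0 < C" and der: "\<And>r n. 2 * norm v \<le> r \<Longrightarrow> norm n = 1 \<Longrightarrow>
    \<exists>D. ((\<lambda>r. exit_prim v b r n) has_real_derivative D) (at r) \<and> \<bar>D\<bar> \<le> C * r powr decay_exponent b"
    using exit_prim_derivative[OF assms] by blast
  have "\<bar>exit_prim v b s n - exit_prim v b r n\<bar> \<le> C * (s - r) * r powr decay_exponent b"
    if r: "2 * norm v \<le> r" and rs: "r < s" and n: "norm n = 1" for r s n
  proof -
    obtain D where D: "\<And>t. r \<le> t \<Longrightarrow> ((\<lambda>r. exit_prim v b r n) has_real_derivative D t) (at t)"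
      "\<And>t. r \<le> t \<Longrightarrow> \<bar>D t\<bar> \<le> C * t powr decay_exponent b"
      using der[OF order_trans[OF r] n] by metis
    obtain t where t: "r < t" "t < s" "exit_prim v b s n - exit_prim v b r n = (s - r) * D t"
      using MVT2[OF rs, of "\<lambda>r. exit_prim v b r n" D] D(1) by blast
    have r0: "0 < r" using r v by linarith
    have "decay_exponent b \<le> 0" using b by (simp add: decay_exponent_def)
    then have "t powr decay_exponent b \<le> r powr decay_exponent b"
      using t r0 by (intro powr_mono2') auto
    then have "\<bar>D t\<bar> \<le> C * r powr decay_exponent b"
      using D(2)[of t] t C mult_left_mono[of "t powr decay_exponent b" "r powr decay_exponent b" C] by linarith
    then show ?thesis using t rs by (simp add: abs_mult mult_left_mono mult.assoc mult.left_commute)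
  qed
  then show ?thesis using C by blast
qed

subsection \<open>Singular terms averaged over distant spheres\<close>

lemma set_integral_left_open:
  fixes h :: "real \<Rightarrow> real"
  assumes "set_integrable lborel {a..c} h"
  shows "(LINT r:{a<..c}|lborel. h r) = (LINT r:{a..c}|lborel. h r)"
proof (rule set_integral_cong_set)
  have i: "set_integrable lborel {a<..c} h" by (rule set_integrable_subset[OF assms]) auto
  have "AE r in lborel. r \<noteq> a" by (rule AE_lborel_singleton)
  then show "AE r in lborel. (r \<in> {a..c}) = (r \<in> {a<..c})" by eventually_elim auto
  show "set_borel_measurable lborel {a..c} h"
    using assms unfolding set_borel_measurable_def set_integrable_def by (rule borel_measurable_integrable)
  show "set_borel_measurable lborel {a<..c} h"
    using i unfolding set_borel_measurable_def set_integrable_def by (rule borel_measurable_integrable)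
qed

text \<open>By the fundamental theorem of calculus \<open>h a\<close> is the limit of its mean
  values over \<open>{a<..c}\<close>. This converts Lipschitz bounds for shell integrals into
  pointwise bounds for spherical averages.\<close>

lemma continuous_bound_by_integrals:
  fixes h :: "real \<Rightarrow> real"
  assumes h: "continuous_on {a..a+1} h"
    and B: "\<And>c. a < c \<Longrightarrow> \<bar>LINT r:{a<..c}|lborel. h r\<bar> \<le> B * (c - a)"
  shows "\<bar>h a\<bar> \<le> B"
proof -
  let ?V = "\<lambda>x. integral {a..x} h"
  have "(?V has_real_derivative h a) (at a within {a..a+1})"
    using integral_has_real_derivative[OF h, of a] by simp
  then have "((\<lambda>c. (?V c - ?V a) / (c - a)) \<longlongrightarrow> h a) (at a within {a..a+1})"
    by (simp add: has_field_derivative_iff)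
  then have lim: "((\<lambda>c. \<bar>(?V c - ?V a) / (c - a)\<bar>) \<longlongrightarrow> \<bar>h a\<bar>) (at a within {a..a+1})"
    by (rule tendsto_rabs)
  show ?thesis
  proof (rule tendsto_upperbound[OF lim])
    have "\<bar>(?V c - ?V a) / (c - a)\<bar> \<le> B" if c: "c \<in> {a..a+1}" "c \<noteq> a" for c
    proof -
      have "continuous_on {a..c} h" using c by (intro continuous_on_subset[OF h]) auto
      then have i: "set_integrable lborel {a..c} h" by (rule borel_integrable_atLeastAtMost')
      have "?V c = (LINT r:{a<..c}|lborel. h r)"
        using set_borel_integral_eq_integral(2)[OF i] set_integral_left_open[OF i] by simp
      then show ?thesis using B[of c] c by (simp add: abs_divide field_simps)
    qed
    then show "\<forall>\<^sub>F c in at a within {a..a+1}. \<bar>(?V c - ?V a) / (c - a)\<bar> \<le> B"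
      by (auto simp: eventually_at_filter)
    show "at a within {a..a+1} \<noteq> bot" by (simp add: at_within_Icc_at_right trivial_limit_at_right_real)
  qed
qed

lemma set_integrable_powr_to_inf:
  fixes a c :: real
  assumes "0 < a" "c < -1"
  shows "set_integrable lborel {a<..} (\<lambda>r. r powr c)"
proof -
  have "(\<lambda>r. r powr c) absolutely_integrable_on {a..}"
    using has_integral_powr_to_inf[OF assms(2,1)]
    by (intro nonnegative_absolutely_integrable_1) (auto simp: has_integral_integrable)
  then have "set_integrable lebesgue {a<..} (\<lambda>r. r powr c)"
    by (rule set_integrable_subset) auto
  then show ?thesis unfolding set_integrable_def
    by (subst (asm) integrable_completion) auto
qed

section \<open>Volume integrals of a singular term inside a growing sphere\<close>

context singular_point begin

text \<open>The outer boundary term in the integral of one singular term inside the sphere of radius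
  \<open>R\<close> around \<open>p\<close>, freed of \<open>ln R\<close> if \<open>b = - 3\<close>.
  The vector \<open>y - p\<close> is the singular point seen from the centre.\<close>

definition exit_sum :: "real^3 \<Rightarrow> real \<Rightarrow> real \<Rightarrow> real" where
  "exit_sum p b R = (LINT n|solid_angle. coeff_at F y b n * exit_prim (y - p) b R n)"

lemma integrable_coeff_times:
  assumes "continuous_on (sphere 0 1) g"
  shows "integrable solid_angle (\<lambda>n. coeff_at F y b n * g n)"
proof -
  have c: "continuous_on (sphere 0 1) (\<lambda>n. coeff_at F y b n * g n)"
    by (intro continuous_on_mult continuous_on_coeff assms)
  then have "bounded ((\<lambda>n. coeff_at F y b n * g n) ` sphere 0 1)"
    by (intro compact_imp_bounded compact_continuous_image) auto
  then obtain M where "\<forall>n\<in>sphere 0 1. norm (coeff_at F y b n * g n) \<le> M"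
    unfolding bounded_iff by auto
  then show ?thesis
    by (intro solid_angle.integrable_const_bound[of _ M] measurable_solid_angle_continuous c AE_I2) auto
qed

lemma continuous_on_prim_exit:
  assumes R: "norm v < R"
  shows "continuous_on (sphere 0 1) (\<lambda>n. prim b (exit_dist v R n))"
proof -
  have "continuous_on {0<..} (prim b)"
    by (intro continuous_at_imp_continuous_on ballI DERIV_isCont[OF prim_has_derivative]) auto
  then show ?thesis
  proof (rule continuous_on_compose2[OF _ continuous_on_exit_dist])
    show "exit_dist v R ` sphere 0 1 \<subseteq> {0<..}"
      using exit_dist_bounds(1)[OF _ R] R by fastforce
  qed
qed

text \<open>On the ray from \<open>y\<close> in direction \<open>n\<close> the region is the
  interval \<open>{s<..exit_dist (y - p) R n}\<close>. The assumption on \<open>R\<close> puts the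
  small ball inside the large one, so that this interval is oriented correctly.\<close>

lemma sing_term_region:
  assumes s: "0 < s" and R: "s < R - norm (y - p)"
  shows "set_integrable lborel {x. s < dist y x \<and> dist p x \<le> R} (sing_term F y b)"
    and "(LINT x:{x. s < dist y x \<and> dist p x \<le> R}|lborel. sing_term F y b x) =
      exit_sum p b R + (if b = - 3 then coeff_integral F y b * ln R else 0) - coeff_integral F y b * prim b s"
proof -
  let ?A = "{x. s < dist y x \<and> dist p x \<le> R}"
  let ?v = "y - p"
  let ?G = "\<lambda>x. indicator ?A x * sing_term F y b x"
  have A: "?A \<in> sets borel"
  proof -
    have "?A = {x. dist y x \<in> {s<..}} \<inter> {x. dist p x \<in> {..R}}" by auto
    then show ?thesis using sets_dist_vimage[of "{s<..}" y] sets_dist_vimage[of "{..R}" p] by auto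
  qed
  have sub: "?A \<subseteq> {x. dist y x \<in> {s<..R + norm ?v}}"
  proof
    fix x assume "x \<in> ?A"
    then show "x \<in> {x. dist y x \<in> {s<..R + norm ?v}}"
      using dist_triangle[of y x p] by (auto simp: dist_norm)
  qed
  show i: "set_integrable lborel ?A (sing_term F y b)"
    by (rule set_integrable_subset[OF sing_term_shell(1)[OF s] _ sub]) (use A in simp)
  have vR: "norm ?v < R" using s R by linarith
  have Gm: "?G \<in> borel_measurable borel" using A by measurable
  have Gi: "integrable lborel ?G" using i by (simp add: set_integrable_def)
  have inner: "(LINT r|lborel. indicator {0<..} r * r\<^sup>2 * ?G (y + r *\<^sub>R n)) =
      coeff_at F y b n * (prim b (exit_dist ?v R n) - prim b s)" if n: "norm n = 1" for n
  proof -
    have "indicator {0<..} r * r\<^sup>2 * ?G (y + r *\<^sub>R n) =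
        coeff_at F y b n * (indicator {s<..exit_dist ?v R n} r *\<^sub>R r powr (b + 2))" for r
    proof (cases "0 < r")
      case True
      have "dist p (y + r *\<^sub>R n) = norm (?v + r *\<^sub>R n)"
        by (simp add: dist_norm norm_minus_commute algebra_simps)
      then have "y + r *\<^sub>R n \<in> ?A \<longleftrightarrow> r \<in> {s<..exit_dist ?v R n}"
        using norm_ray_le_iff[OF n vR, of r] True n by (simp add: dist_polar)
      then have "indicator ?A (y + r *\<^sub>R n) = (indicator {s<..exit_dist ?v R n} r :: real)"
        by (simp add: indicator_def)
      then show ?thesis using True n by (simp add: sing_term_polar powr_add mult_ac)
    qed (use s in \<open>auto simp: indicator_def\<close>)
    moreover have "s \<le> exit_dist ?v R n" using exit_dist_bounds(1)[OF n vR] R by linarith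
    ultimately show ?thesis using set_integral_powr(2)[OF s, of "exit_dist ?v R n" b]
      by (simp add: set_lebesgue_integral_def)
  qed
  have "(LINT x:?A|lborel. sing_term F y b x) = (LINT x|lborel. ?G x)"
    by (simp add: set_lebesgue_integral_def)
  also have "\<dots> = (LINT n|solid_angle. LINT r|lborel. indicator {0<..} r * r\<^sup>2 * ?G (y + r *\<^sub>R n))"
    by (rule polar_directional[OF Gm Gi])
  also have "\<dots> = (LINT n|solid_angle. coeff_at F y b n * (prim b (exit_dist ?v R n) - prim b s))"
    by (intro Bochner_Integration.integral_cong refl inner) simp
  also have "\<dots> = (LINT n|solid_angle. coeff_at F y b n * exit_prim ?v b R n
      + coeff_at F y b n * ((if b = -3 then ln R else 0) - prim b s))"
    by (intro Bochner_Integration.integral_cong refl) (simp add: exit_prim_def algebra_simps)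
  also have "\<dots> = exit_sum p b R + coeff_integral F y b * ((if b = -3 then ln R else 0) - prim b s)"
  proof -
    have "integrable solid_angle (\<lambda>n. coeff_at F y b n * exit_prim ?v b R n)"
      unfolding exit_prim_def
      by (intro integrable_coeff_times continuous_on_diff continuous_on_prim_exit vR continuous_on_const)
    then show ?thesis
      unfolding exit_sum_def coeff_integral_def using integrable_coeff by simp
  qed
  finally show "(LINT x:?A|lborel. sing_term F y b x) =
      exit_sum p b R + (if b = - 3 then coeff_integral F y b * ln R else 0) - coeff_integral F y b * prim b s"
    by (simp add: algebra_simps)
qed

lemma exit_sum_estimate:
  assumes C: "\<And>n. norm n = 1 \<Longrightarrow> \<bar>f n\<bar> \<le> C" and f: "f \<in> borel_measurable solid_angle"
    and M: "\<And>n. norm n = 1 \<Longrightarrow> \<bar>coeff_at F y b n\<bar> \<le> M"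
  shows "\<bar>LINT n|solid_angle. coeff_at F y b n * f n\<bar> \<le> M * measure solid_angle (sphere 0 1) * C"
proof -
  have bd: "norm (coeff_at F y b n * f n) \<le> M * C" if "norm n = 1" for n
    using C[OF that] M[OF that] by (simp add: abs_mult mult_mono)
  have "norm (LINT n|solid_angle. coeff_at F y b n * f n) \<le> (LINT n|solid_angle. norm (coeff_at F y b n * f n))"
    by (rule integral_norm_bound)
  also have "\<dots> \<le> (LINT n|solid_angle. M * C)"
  proof (rule integral_mono)
    have "(\<lambda>n. coeff_at F y b n * f n) \<in> borel_measurable solid_angle"
      using integrable_coeff[of b] f by (auto intro: borel_measurable_times)
    then show "integrable solid_angle (\<lambda>n. norm (coeff_at F y b n * f n))"
      using bd by (intro integrable_norm solid_angle.integrable_const_bound[of _ "M * C"] AE_I2) auto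
    show "integrable solid_angle (\<lambda>n. M * C)" by simp
  qed (use bd in auto)
  finally show ?thesis by (simp add: mult_ac)
qed

lemma exit_prim_measurable:
  "norm v < R \<Longrightarrow> exit_prim v b R \<in> borel_measurable solid_angle"
  unfolding exit_prim_def
  by (intro measurable_solid_angle_continuous continuous_on_diff continuous_on_prim_exit continuous_on_const)

lemma exit_sum_tendsto_0:
  assumes b: "b \<le> -3" and p: "p \<noteq> y"
  shows "(exit_sum p b \<longlongrightarrow> 0) at_top"
proof -
  let ?v = "y - p"
  have v: "0 < norm ?v" using p by simp
  obtain C where C: "0 < C" and small: "\<And>r n. 2 * norm ?v \<le> r \<Longrightarrow> norm n = 1 \<Longrightarrow>
      \<bar>exit_prim ?v b r n\<bar> \<le> C * r powr (decay_exponent b + 1)"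
    using exit_prim_small[OF b v] by blast
  obtain M where M: "\<And>n. norm n = 1 \<Longrightarrow> \<bar>coeff_at F y b n\<bar> \<le> M" using coeff_bounded by blast
  define A where "A = M * measure solid_angle (sphere 0 1) * C"
  show ?thesis
  proof (rule Lim_null_comparison)
    have "norm (exit_sum p b R) \<le> A * R powr (decay_exponent b + 1)" if R: "2 * norm ?v \<le> R" for R
    proof -
      have "norm ?v < R" using R v by linarith
      from exit_sum_estimate[OF small[OF R] exit_prim_measurable[OF this] M]
      show ?thesis by (simp add: exit_sum_def A_def mult_ac)
    qed
    then show "\<forall>\<^sub>F R in at_top. norm (exit_sum p b R) \<le> A * R powr (decay_exponent b + 1)"
      by (auto simp: eventually_at_top_linorder)
    have "decay_exponent b + 1 < 0" using b by (simp add: decay_exponent_def)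
    then have "((\<lambda>R. R powr (decay_exponent b + 1)) \<longlongrightarrow> 0) at_top"
      by (rule tendsto_neg_powr) (rule filterlim_ident)
    from tendsto_mult_right[OF this, of A]
    show "((\<lambda>R. A * R powr (decay_exponent b + 1)) \<longlongrightarrow> 0) at_top" by (simp add: mult.commute)
  qed
qed

text \<open>Up to the factor \<open>4 * pi\<close> this plays the part of the derivative of
  \<open>exit_sum\<close> in the radius; the subtracted multiple of \<open>1 / r\<close> corresponds
  to the \<open>ln R\<close> removed there.\<close>

definition radial_excess :: "real^3 \<Rightarrow> real \<Rightarrow> real \<Rightarrow> real" where
  "radial_excess p b r = r\<^sup>2 * sphere_avg p (sing_term F y b) r
     - (if b = - 3 then coeff_integral F y b / (4 * pi) * (1 / r) else 0)"

lemma integral_radial_excess: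
  assumes p: "p \<noteq> y" and \<alpha>: "2 * norm (y - p) \<le> \<alpha>" and \<beta>: "\<alpha> < \<beta>"
  shows "4 * pi * (LINT r:{\<alpha><..\<beta>}|lborel. radial_excess p b r) = exit_sum p b \<beta> - exit_sum p b \<alpha>"
proof -
  let ?S = "sing_term F y b"
  \<comment> \<open>The radius of an auxiliary hole around the singular point. At half the distance
    the hole stays inside the sphere of radius \<open>\<alpha>\<close>, and its contribution drops
    out of the difference of the two regions.\<close>
  let ?s = "norm (y - p) / 2"
  let ?A = "\<lambda>R. {x. ?s < dist y x \<and> dist p x \<le> R}"
  have v: "0 < norm (y - p)" using p by simp
  have \<alpha>0: "0 < \<alpha>" using v \<alpha> by linarith
  have s: "0 < ?s" "?s < \<alpha> - norm (y - p)" "?s < \<beta> - norm (y - p)" using v \<alpha> \<beta> by linarith+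
  have un: "?A \<beta> = ?A \<alpha> \<union> {x. dist p x \<in> {\<alpha><..\<beta>}}"
  proof -
    have "?s < dist y x" if "\<alpha> < dist p x" for x
      using that dist_triangle[of p x y] s(2) by (simp add: dist_norm norm_minus_commute)
    then show ?thesis using \<beta> by auto
  qed
  note iA = sing_term_region[OF s(1,2), of b] and iB = sing_term_region[OF s(1,3), of b]
  have i: "set_integrable lborel {x. dist p x \<in> {\<alpha><..\<beta>}} ?S"
    by (rule set_integrable_subset[OF iB(1)]) (use un in \<open>auto intro: sets_dist_vimage\<close>)
  have E: "{\<alpha><..\<beta>} \<in> sets borel" "{\<alpha><..\<beta>} \<subseteq> {0<..}" using \<alpha>0 by auto
  have "(LINT x:?A \<beta>|lborel. ?S x) = (LINT x:?A \<alpha>|lborel. ?S x) + (LINT x:{x. dist p x \<in> {\<alpha><..\<beta>}}|lborel. ?S x)"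
    unfolding un by (rule set_integral_Un[OF _ iA(1) i]) auto
  also have "(LINT x:{x. dist p x \<in> {\<alpha><..\<beta>}}|lborel. ?S x) = 4 * pi * (LINT r:{\<alpha><..\<beta>}|lborel. r\<^sup>2 * sphere_avg p ?S r)"
    by (rule polar_shell(2)[OF sing_term_borel E i, symmetric])
  finally have 1: "4 * pi * (LINT r:{\<alpha><..\<beta>}|lborel. r\<^sup>2 * sphere_avg p ?S r) =
      exit_sum p b \<beta> - exit_sum p b \<alpha> + (if b = - 3 then coeff_integral F y b * (ln \<beta> - ln \<alpha>) else 0)"
    unfolding iA(2) iB(2) by (cases "b = -3") (simp_all add: algebra_simps)
  have j: "set_integrable lborel {\<alpha><..\<beta>} (\<lambda>r. 1 / r)"
    and J: "(LINT r:{\<alpha><..\<beta>}|lborel. 1 / r) = ln \<beta> - ln \<alpha>"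
  proof -
    have eq: "indicator {\<alpha><..\<beta>} r *\<^sub>R (r powr (-3 + 2)) = indicator {\<alpha><..\<beta>} r *\<^sub>R (1 / r)" for r :: real
      using \<alpha>0 by (auto simp: indicator_def powr_minus_divide)
    show "set_integrable lborel {\<alpha><..\<beta>} (\<lambda>r. 1 / r)"
      using set_integral_powr(1)[OF \<alpha>0, of \<beta> "-3 + 2"] unfolding set_integrable_def eq .
    show "(LINT r:{\<alpha><..\<beta>}|lborel. 1 / r) = ln \<beta> - ln \<alpha>"
      using set_integral_powr(2)[OF \<alpha>0, of \<beta> "-3"] \<beta> unfolding set_lebesgue_integral_def eq
      by (simp add: prim_def)
  qed
  show ?thesis
  proof (cases "b = -3")
    case True
    have "(LINT r:{\<alpha><..\<beta>}|lborel. radial_excess p b r) = (LINT r:{\<alpha><..\<beta>}|lborel. r\<^sup>2 * sphere_avg p ?S r)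
      - (LINT r:{\<alpha><..\<beta>}|lborel. coeff_integral F y b / (4 * pi) * (1 / r))"
    proof -
      have eq: "radial_excess p b = (\<lambda>r. r\<^sup>2 * sphere_avg p ?S r - coeff_integral F y b / (4 * pi) * (1 / r))"
        using True by (auto simp: radial_excess_def)
      show ?thesis unfolding eq
        by (intro set_integral_diff(2) polar_shell(1)[OF sing_term_borel E i] set_integrable_mult_right j)
    qed
    also have "(LINT r:{\<alpha><..\<beta>}|lborel. coeff_integral F y b / (4 * pi) * (1 / r))
      = coeff_integral F y b / (4 * pi) * (ln \<beta> - ln \<alpha>)"
      unfolding J[symmetric] by (rule set_integral_mult_right)
    finally show ?thesis using 1 True by (simp add: right_diff_distrib)
  next
    case False
    then show ?thesis using 1 by (simp add: radial_excess_def)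
  qed
qed

text \<open>The spheres considered stay at distance at least \<open>norm (y - p)\<close> from the
  singular point, so a constant dominates the integrand and dominated convergence applies.\<close>

lemma continuous_on_radial_excess:
  assumes b: "b \<le> -3" and p: "p \<noteq> y"
  shows "continuous_on {2 * norm (y - p)..} (radial_excess p b)"
proof -
  let ?S = "sing_term F y b" and ?d = "norm (y - p)"
  have d: "0 < ?d" using p by simp
  obtain M where M: "0 < M" "\<And>n. norm n = 1 \<Longrightarrow> \<bar>coeff_at F y b n\<bar> \<le> M" using coeff_bounded by blast
  have far: "?d \<le> dist y (p + r *\<^sub>R n)" if "2 * ?d \<le> r" "norm n = 1" for r n
    using norm_triangle_ineq2[of "r *\<^sub>R n" "y - p"] that d
    by (simp add: dist_norm norm_minus_commute algebra_simps)
  have ne: "p + r *\<^sub>R n \<noteq> y" if "2 * ?d \<le> r" "norm n = 1" for r n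
    using far[OF that] d by (metis dist_self not_less)
  have "continuous_on {2 * ?d..} (\<lambda>r. LINT n|solid_angle. ?S (p + r *\<^sub>R n))"
  proof (rule continuous_on_sequentiallyI)
    fix u :: "nat \<Rightarrow> real" and a assume u: "\<forall>k. u k \<in> {2 * ?d..}" and a: "a \<in> {2 * ?d..}" and lim: "u \<longlonglongrightarrow> a"
    have cn: "continuous_on (sphere 0 1) (\<lambda>n. ?S (p + r *\<^sub>R n))" if r: "2 * ?d \<le> r" for r
    proof (rule continuous_on_compose2[OF continuous_on_sing_term])
      show "continuous_on (sphere 0 1) (\<lambda>n. p + r *\<^sub>R n)" by (intro continuous_intros)
      show "(\<lambda>n. p + r *\<^sub>R n) ` sphere 0 1 \<subseteq> - {y}"
      proof (rule image_subsetI)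
        fix n :: "real^3" assume "n \<in> sphere 0 1"
        then show "p + r *\<^sub>R n \<in> - {y}" using ne[OF r, of n] by simp
      qed
    qed
    show "(\<lambda>k. LINT n|solid_angle. ?S (p + u k *\<^sub>R n)) \<longlonglongrightarrow> (LINT n|solid_angle. ?S (p + a *\<^sub>R n))"
    proof (rule integral_dominated_convergence)
      show "(\<lambda>n. ?S (p + a *\<^sub>R n)) \<in> borel_measurable solid_angle"
        using a by (intro measurable_solid_angle_continuous cn) simp
      show "(\<lambda>n. ?S (p + u k *\<^sub>R n)) \<in> borel_measurable solid_angle" for k
        using u by (intro measurable_solid_angle_continuous cn) simp
      show "integrable solid_angle (\<lambda>n. ?d powr b * M)" by simp
      show "AE n in solid_angle. (\<lambda>k. ?S (p + u k *\<^sub>R n)) \<longlonglongrightarrow> ?S (p + a *\<^sub>R n)"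
      proof (rule AE_I2)
        fix n assume "n \<in> space solid_angle"
        then have n: "norm n = 1" by simp
        have ne: "p + a *\<^sub>R n \<noteq> y" using ne[of a n] a n by auto
        have "isCont ?S (p + a *\<^sub>R n)"
          using continuous_on_sing_term ne by (subst (asm) continuous_on_eq_continuous_at) auto
        moreover have "(\<lambda>k. p + u k *\<^sub>R n) \<longlonglongrightarrow> p + a *\<^sub>R n" by (intro tendsto_intros lim)
        ultimately show "(\<lambda>k. ?S (p + u k *\<^sub>R n)) \<longlonglongrightarrow> ?S (p + a *\<^sub>R n)" by (rule isCont_tendsto_compose)
      qed
      show "AE n in solid_angle. norm (?S (p + u k *\<^sub>R n)) \<le> ?d powr b * M" for k
      proof (rule AE_I2)
        fix n assume "n \<in> space solid_angle"
        then have n: "norm n = 1" by simp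
        let ?x = "p + u k *\<^sub>R n"
        have x: "?d \<le> norm (?x - y)" using far[of "u k" n] u n by (simp add: dist_norm norm_minus_commute)
        then have "norm (?x - y) powr b \<le> ?d powr b" using d b by (intro powr_mono2') auto
        moreover have "norm (sgn (?x - y)) = 1" using ne[of "u k" n] u n by (simp add: norm_sgn)
        ultimately show "norm (?S ?x) \<le> ?d powr b * M"
          using M by (simp add: sing_term_def abs_mult mult_mono)
      qed
    qed
  qed
  then show ?thesis
    unfolding radial_excess_def sphere_avg_def using d
    by (cases "b = -3") (auto intro!: continuous_intros)
qed

text \<open>The Lipschitz estimate bounds the integral over every interval starting at
  \<open>r\<close> by a multiple of its length. Continuity turns this into a pointwise bound by
  \<open>r powr decay_exponent b\<close>, an integrable power.\<close>

lemma radial_excess_integrable: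
  assumes b: "b \<le> -3" and p: "p \<noteq> y"
  shows "set_integrable lborel {2 * norm (y - p)<..} (radial_excess p b)"
proof -
  let ?v = "y - p"
  have v: "0 < norm ?v" using p by simp
  obtain C where C: "0 < C" and lip: "\<And>r s n. 2 * norm ?v \<le> r \<Longrightarrow> r < s \<Longrightarrow> norm n = 1 \<Longrightarrow>
      \<bar>exit_prim ?v b s n - exit_prim ?v b r n\<bar> \<le> C * (s - r) * r powr decay_exponent b"
    using exit_prim_lipschitz[OF b v] by blast
  obtain M where M: "0 < M" "\<And>n. norm n = 1 \<Longrightarrow> \<bar>coeff_at F y b n\<bar> \<le> M" using coeff_bounded by blast
  define A where "A = M * measure solid_angle (sphere 0 1) * C / (4 * pi)"
  have bound: "\<bar>radial_excess p b r\<bar> \<le> A * r powr decay_exponent b" if r: "2 * norm ?v \<le> r" for r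
  proof (rule continuous_bound_by_integrals[where h="radial_excess p b" and a=r])
    show "continuous_on {r..r+1} (radial_excess p b)"
      by (rule continuous_on_subset[OF continuous_on_radial_excess[OF b p]]) (use r in auto)
    fix s assume s: "r < s"
    have vr: "norm ?v < r" "norm ?v < s" using r s v by linarith+
    have m: "(\<lambda>n. exit_prim ?v b s n - exit_prim ?v b r n) \<in> borel_measurable solid_angle"
      using exit_prim_measurable[OF vr(1)] exit_prim_measurable[OF vr(2)] by (rule borel_measurable_diff[rotated])
    have int: "integrable solid_angle (\<lambda>n. coeff_at F y b n * exit_prim ?v b R n)" if "norm ?v < R" for R
      unfolding exit_prim_def
      by (intro integrable_coeff_times continuous_on_diff continuous_on_prim_exit that continuous_on_const)
    have "exit_sum p b s - exit_sum p b r =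
      (LINT n|solid_angle. coeff_at F y b n * (exit_prim ?v b s n - exit_prim ?v b r n))"
      unfolding exit_sum_def right_diff_distrib
      using Bochner_Integration.integral_diff[OF int[OF vr(2)] int[OF vr(1)]] by simp
    also have "\<bar>\<dots>\<bar> \<le> M * measure solid_angle (sphere 0 1) * (C * (s - r) * r powr decay_exponent b)"
      by (rule exit_sum_estimate[OF lip[OF r s] m M(2)])
    finally have "\<bar>4 * pi * (LINT q:{r<..s}|lborel. radial_excess p b q)\<bar>
        \<le> M * measure solid_angle (sphere 0 1) * (C * (s - r) * r powr decay_exponent b)"
      unfolding integral_radial_excess[OF p r s] .
    then show "\<bar>LINT q:{r<..s}|lborel. radial_excess p b q\<bar> \<le> A * r powr decay_exponent b * (s - r)"
      by (simp add: A_def abs_mult field_simps)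
  qed
  have c: "decay_exponent b < -1" using b by (simp add: decay_exponent_def)
  have i: "set_integrable lborel {2 * norm ?v<..} (\<lambda>r. A * r powr decay_exponent b)"
    using set_integrable_powr_to_inf[OF _ c, of "2 * norm ?v"] v by simp
  show ?thesis
  proof (rule set_integrable_bound[OF i])
    have "continuous_on {2 * norm ?v<..} (radial_excess p b)"
      by (rule continuous_on_subset[OF continuous_on_radial_excess[OF b p]]) auto
    then show "set_borel_measurable lborel {2 * norm ?v<..} (radial_excess p b)"
      unfolding set_borel_measurable_def
      using borel_measurable_continuous_on_indicator[of "{2 * norm ?v<..}" "radial_excess p b"] by simp
    show "AE r in lborel. r \<in> {2 * norm ?v<..} \<longrightarrow> norm (radial_excess p b r) \<le> norm (A * r powr decay_exponent b)"
      using bound by (auto intro!: AE_I2 order_trans[OF bound])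
  qed
qed

end

subsection \<open>Assembling the decomposition\<close>

context two_singular_points begin

lemma norm_zy: "norm (z - y) = dist y z"
  by (simp add: dist_norm norm_minus_commute)

lemma coeff_integral_sing_sum:
  "(\<Sum>b\<in>sing_exponents F z. if b = - 3 then coeff_integral F z b * c else 0) = coeff_integral F z (- 3) * c"
proof (cases "- 3 \<in> sing_exponents F z")
  case True
  then show ?thesis using Z.finite_sing_exponents by simp
next
  case False
  then have "coeff_integral F z (- 3) = 0"
    using Z.coeff_off_exponents[of "-3"] by (simp add: sing_exponents_def coeff_integral_def)
  moreover have "(\<Sum>b\<in>sing_exponents F z. if b = - 3 then coeff_integral F z b * c else 0) = 0"
    using False by (intro sum.neutral) auto
  ultimately show ?thesis by simp
qed

text \<open>The term \<open>1 / r\<close> of the outer integrand is exactly the one subtracted in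
  \<open>radial_excess\<close> for \<open>b = - 3\<close>. Since the sphere avoids both points, the
  average of the regularized function splits into averages of its parts.\<close>

lemma outer_integrand_eq:
  assumes r: "dist y z < r"
  shows "outer_integrand F y z r =
    r\<^sup>2 * sphere_avg y F r - (\<Sum>b\<in>sing_exponents F z. Z.radial_excess y b r)"
proof -
  have r0: "0 < r" using r zero_le_dist[of y z] by linarith
  have int: "integrable solid_angle (\<lambda>n. G (y + r *\<^sub>R n))" if G: "continuous_on (- {y, z}) G" for G :: "real^3 \<Rightarrow> real"
  proof -
    have c: "continuous_on (sphere 0 1) (\<lambda>n. G (y + r *\<^sub>R n))"
    proof (rule continuous_on_compose2[OF G])
      show "continuous_on (sphere 0 1) (\<lambda>n. y + r *\<^sub>R n)" by (intro continuous_intros)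
      show "(\<lambda>n. y + r *\<^sub>R n) ` sphere 0 1 \<subseteq> - {y, z}"
      proof (rule image_subsetI)
        fix n :: "real^3" assume n: "n \<in> sphere 0 1"
        then have "dist y (y + r *\<^sub>R n) = r" using dist_polar[of n r y] r0 by simp
        then show "y + r *\<^sub>R n \<in> - {y, z}" using r r0 by auto
      qed
    qed
    then have "bounded ((\<lambda>n. G (y + r *\<^sub>R n)) ` sphere 0 1)"
      by (intro compact_imp_bounded compact_continuous_image) auto
    then obtain M where "\<forall>n\<in>sphere 0 1. norm (G (y + r *\<^sub>R n)) \<le> M" unfolding bounded_iff by auto
    then show ?thesis
      by (intro solid_angle.integrable_const_bound[of _ M] measurable_solid_angle_continuous c AE_I2) auto
  qed
  have i: "integrable solid_angle (\<lambda>n. sing_term F z b (y + r *\<^sub>R n))" for b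
    by (intro int continuous_on_subset[OF Z.continuous_on_sing_term]) auto
  have avg: "reg_avg F y z r = sphere_avg y F r - (\<Sum>b\<in>sing_exponents F z. sphere_avg y (sing_term F z b) r)"
    unfolding reg_avg_def sphere_avg_def regularized_sing_term
    using int[OF continuous] i
    by (subst Bochner_Integration.integral_diff) (auto simp: diff_divide_distrib sum_divide_distrib)
  have "(\<Sum>b\<in>sing_exponents F z. Z.radial_excess y b r) =
    r\<^sup>2 * (\<Sum>b\<in>sing_exponents F z. sphere_avg y (sing_term F z b) r)
    - (\<Sum>b\<in>sing_exponents F z. if b = - 3 then coeff_integral F z b * (1 / (4 * pi * r)) else 0)"
    unfolding Z.radial_excess_def sum_distrib_left sum_subtractf[symmetric] by (intro sum.cong) auto
  then show ?thesis
    unfolding outer_integrand_def avg Z.pf_at_cube coeff_integral_sing_sum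
    by (simp add: right_diff_distrib)
qed

text \<open>Close to the sphere through \<open>z\<close> only the regularized function as a whole is
  under control; beyond \<open>2 * dist y z\<close> it is split into \<open>F\<close>, integrable at
  infinity, and the decaying excesses.\<close>

lemma outer_integrand_integrable: "set_integrable lborel {dist y z<..} (outer_integrand F y z)"
proof -
  let ?d = "dist y z"
  have d: "0 < ?d" using neq by simp
  have E: "{2 * ?d<..} \<in> sets borel" "{2 * ?d<..} \<subseteq> {0<..}" using d by auto
  have "set_integrable lborel {x. dist y x \<in> {2 * ?d<..}} F"
  proof (rule set_integrable_subset[OF integrable_outside[OF radius(1)]])
    show "{x. dist y x \<in> {2 * ?d<..}} \<in> sets lborel" by (rule sets_dist_vimage) simp
    show "{x. dist y x \<in> {2 * ?d<..}} \<subseteq> - (cball y radius \<union> cball z radius)"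
    proof
      fix x assume "x \<in> {x. dist y x \<in> {2 * ?d<..}}"
      then show "x \<in> - (cball y radius \<union> cball z radius)"
        using dist_triangle[of y x z] radius by auto
    qed
  qed
  from polar_shell(1)[OF F_borel E this]
  have 1: "set_integrable lborel {2 * ?d<..} (\<lambda>r. r\<^sup>2 * sphere_avg y F r)" .
  have "set_integrable lborel {2 * ?d<..} (Z.radial_excess y b)" if "b \<in> sing_exponents F z" for b
    using Z.radial_excess_integrable[of b y] neq that unfolding norm_zy by (simp add: sing_exponents_def)
  then have 2: "set_integrable lborel {2 * ?d<..} (\<lambda>r. \<Sum>b\<in>sing_exponents F z. Z.radial_excess y b r)"
    unfolding set_integrable_def scaleR_sum_right by (intro Bochner_Integration.integrable_sum)
  have far: "set_integrable lborel {2 * ?d<..} (outer_integrand F y z)"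
  proof -
    have "set_integrable lborel {2 * ?d<..} (outer_integrand F y z) \<longleftrightarrow>
      set_integrable lborel {2 * ?d<..} (\<lambda>r. r\<^sup>2 * sphere_avg y F r - (\<Sum>b\<in>sing_exponents F z. Z.radial_excess y b r))"
      using d by (intro set_integrable_cong refl outer_integrand_eq) (unfold greaterThan_iff, linarith)
    then show ?thesis using set_integral_diff(1)[OF 1 2] by simp
  qed
  have near: "set_integrable lborel {?d<..2 * ?d} (outer_integrand F y z)"
    unfolding outer_integrand_def
  proof (intro set_integral_add(1) reg_avg_shell(1)[OF d])
    have "set_integrable lborel {?d..2 * ?d} (\<lambda>r. 1 / r * pf_at (\<lambda>x. norm (x - z) ^ 3 * F x) z)"
      using d by (intro borel_integrable_atLeastAtMost' continuous_intros) auto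
    then show "set_integrable lborel {?d<..2 * ?d} (\<lambda>r. 1 / r * pf_at (\<lambda>x. norm (x - z) ^ 3 * F x) z)"
      by (rule set_integrable_subset) auto
  qed auto
  have "r \<in> {?d<..} \<longleftrightarrow> r \<in> {?d<..2 * ?d} \<union> {2 * ?d<..}" for r
    using d unfolding Un_iff greaterThan_iff greaterThanAtMost_iff by linarith
  then have "{?d<..} = {?d<..2 * ?d} \<union> {2 * ?d<..}" by blast
  then show ?thesis using set_integrable_Un[OF near far] by simp
qed

lemma tendsto_outer_integral:
  "((\<lambda>R. LINT r:{dist y z<..R}|lborel. outer_integrand F y z r)
     \<longlongrightarrow> (LINT r:{dist y z<..}|lborel. outer_integrand F y z r)) at_top"
proof -
  let ?d = "dist y z"
  \<comment> \<open>The limit theorem used is about closed half-lines, so the open end is moved into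
    the integrand.\<close>
  let ?f = "\<lambda>r. indicator {?d<..} r * outer_integrand F y z r"
  have eq: "indicator {?d..} r *\<^sub>R ?f r = indicator {?d<..} r *\<^sub>R outer_integrand F y z r"
    "indicator {?d..R} r *\<^sub>R ?f r = indicator {?d<..R} r *\<^sub>R outer_integrand F y z r" for r R
    by (auto simp: indicator_def)
  have "set_integrable lborel {?d..} ?f"
    using outer_integrand_integrable unfolding set_integrable_def eq .
  from tendsto_set_lebesgue_integral_at_top[OF _ this]
  show ?thesis unfolding set_lebesgue_integral_def eq by simp
qed

lemma outer_integral_finite:
  assumes R: "dist y z < R"
  shows "4 * pi * (LINT r:{dist y z<..R}|lborel. outer_integrand F y z r) =
    (LINT x:{x. dist y x \<in> {dist y z<..R}}|lborel. regularized F z x)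
      + coeff_integral F z (- 3) * ln (R / dist y z)"
proof -
  let ?d = "dist y z"
  have d: "0 < ?d" using neq by simp
  have R0: "0 < R" using d R by linarith
  let ?c = "coeff_integral F z (- 3) / (4 * pi)"
  have eq: "indicator {?d<..R} r *\<^sub>R (r powr (-3 + 2)) = indicator {?d<..R} r *\<^sub>R (1 / r)" for r :: real
  proof (cases "r \<in> {?d<..R}")
    case True
    then have "0 < r" using d unfolding greaterThanAtMost_iff by linarith
    then show ?thesis by (simp add: powr_minus_divide)
  qed simp
  have j: "set_integrable lborel {?d<..R} (\<lambda>r. 1 / r)"
    using set_integral_powr(1)[OF d, of R "-3 + 2"] unfolding set_integrable_def eq .
  have J: "(LINT r:{?d<..R}|lborel. 1 / r) = ln (R / ?d)"
    using set_integral_powr(2)[OF d, of R "-3"] R d R0 unfolding set_lebesgue_integral_def eq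
    by (simp add: prim_def ln_div)
  have i: "set_integrable lborel {?d<..R} (\<lambda>r. r\<^sup>2 * reg_avg F y z r)"
    by (rule reg_avg_shell(1)[OF d]) auto
  have "(LINT r:{?d<..R}|lborel. outer_integrand F y z r) =
      (LINT r:{?d<..R}|lborel. r\<^sup>2 * reg_avg F y z r) + (LINT r:{?d<..R}|lborel. 1 / r * ?c)"
    unfolding outer_integrand_def Z.pf_at_cube
    by (intro set_integral_add(2) i set_integrable_mult_left j)
  also have "(LINT r:{?d<..R}|lborel. 1 / r * ?c) = ln (R / ?d) * ?c"
    unfolding J[symmetric] by (rule set_integral_mult_left)
  also have "(LINT r:{?d<..R}|lborel. r\<^sup>2 * reg_avg F y z r) =
      (LINT x:{x. dist y x \<in> {?d<..R}}|lborel. regularized F z x) / (4 * pi)"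
  proof -
    have "{?d<..R} \<subseteq> {?d..R}" by auto
    from reg_avg_shell(2)[OF d _ this] show ?thesis by (simp add: field_simps)
  qed
  finally show ?thesis by (simp add: field_simps)
qed

lemma tendsto_truncated:
  "((\<lambda>R. LINT x:- (cball y radius \<union> cball z radius) \<inter> cball y R|lborel. F x)
     \<longlongrightarrow> (LINT x:- (cball y radius \<union> cball z radius)|lborel. F x)) at_top"
  unfolding set_lebesgue_integral_def
proof (rule integral_dominated_convergence_at_top)
  let ?U = "- (cball y radius \<union> cball z radius)"
  have i: "set_integrable lborel ?U F" by (rule integrable_outside[OF radius(1)])
  show "integrable lborel (\<lambda>x. norm (indicator ?U x *\<^sub>R F x))"
    using i unfolding set_integrable_def by (rule integrable_norm)
  show "(\<lambda>x. indicator ?U x *\<^sub>R F x) \<in> borel_measurable lborel"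
    using i unfolding set_integrable_def by (rule borel_measurable_integrable)
  show "(\<lambda>x. indicator (?U \<inter> cball y R) x *\<^sub>R F x) \<in> borel_measurable lborel" for R
  proof -
    have "set_integrable lborel (?U \<inter> cball y R) F" by (rule set_integrable_subset[OF i]) auto
    then show ?thesis unfolding set_integrable_def by (rule borel_measurable_integrable)
  qed
  show "\<forall>\<^sub>F R in at_top. AE x in lborel. norm (indicator (?U \<inter> cball y R) x *\<^sub>R F x) \<le> norm (indicator ?U x *\<^sub>R F x)"
    by (intro always_eventually allI AE_I2) (auto simp: indicator_def)
  show "AE x in lborel. ((\<lambda>R. indicator (?U \<inter> cball y R) x *\<^sub>R F x) \<longlongrightarrow> indicator ?U x *\<^sub>R F x) at_top"
  proof (rule AE_I2)
    fix x
    have "\<forall>\<^sub>F R in at_top. dist y x \<le> R" by (rule eventually_ge_at_top)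
    then show "((\<lambda>R. indicator (?U \<inter> cball y R) x *\<^sub>R F x) \<longlongrightarrow> indicator ?U x *\<^sub>R F x) at_top"
      by (intro tendsto_eventually) (auto elim!: eventually_mono simp: indicator_def)
  qed
qed

text \<open>The shell around \<open>y\<close> from \<open>radius\<close> to \<open>R\<close> is
  \<open>cball z radius\<close> together with \<open>?V\<close>. On \<open>?V\<close> the function
  splits into \<open>F\<close> and \<open>sing_z\<close>, and the integral of \<open>sing_z\<close>
  there is that over \<open>?W\<close> less that over \<open>cball y radius\<close>; the latter also
  occurs in \<open>radial_value\<close> and cancels.\<close>

lemma truncated_identity:
  assumes R: "2 * dist y z \<le> R" and s1: "0 < s1" and s2: "0 < s2"
  shows "4 * pi * radial_value s1 + 4 * pi * (LINT r:{dist y z<..R}|lborel. outer_integrand F y z r)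
    = Y.local_pf s1 radius + Z.local_pf s2 radius
      + (LINT x:- (cball y radius \<union> cball z radius) \<inter> cball y R|lborel. F x)
      - (\<Sum>b\<in>sing_exponents F z. Z.exit_sum y b R) - coeff_integral F z (- 3) * ln (dist y z / s2)"
proof -
  let ?d = "dist y z" and ?reg = "regularized F z"
  let ?K = "coeff_integral F z (- 3)" and ?E = "sing_exponents F z"
  let ?A = "\<lambda>s t. {x. dist y x \<in> {s<..t}}"
  let ?V = "- (cball y radius \<union> cball z radius) \<inter> cball y R"
  let ?W = "{x. radius < dist z x \<and> dist y x \<le> R}"
  have d: "0 < ?d" using neq by simp
  have dR: "?d < R" and R0: "0 < R" using d R by linarith+
  have in_z: "radius < dist y x \<and> dist y x \<le> R" if "dist z x \<le> radius" for x
    using that dist_triangle[of y z x] dist_triangle[of y x z] radius R d by (simp add: dist_commute)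
  have in_y: "radius < dist z x \<and> dist y x \<le> R" if "dist y x \<le> radius" for x
    using that dist_triangle[of y z x] radius R d by (simp add: dist_commute)
  have iV: "set_integrable lborel ?V F"
    by (rule set_integrable_subset[OF integrable_outside[OF radius(1)]]) auto
  have ireg: "set_integrable lborel {x. dist y x \<in> E} ?reg" if "E \<in> sets borel" "E \<subseteq> {radius..R}" for E
    by (rule regularized_z_shell_integrable[OF radius(1) that])
  have iA: "set_integrable lborel (?A radius R) ?reg" by (rule ireg) auto
  have iz: "set_integrable lborel (cball z radius) ?reg"
    by (rule Z.regularized_integrable_cball[OF radius(2)])
  have iVr: "set_integrable lborel ?V ?reg" by (rule set_integrable_subset[OF iA]) auto
  have iVs: "set_integrable lborel ?V sing_z"
    using set_integral_diff(1)[OF iV iVr] by (simp add: regularized_sing_term)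
  have zr: "z \<notin> cball y radius" using radius by auto
  have iy: "set_integrable lborel (cball y radius) sing_z" by (rule sing_z_integrable[OF compact_cball zr])
  have sR: "radius < R - norm (z - y)" unfolding norm_zy using R radius by linarith
  note W = Z.sing_term_region[OF radius(1) sR]
  have "(LINT x:?A radius ?d|lborel. ?reg x) + (LINT x:?A ?d R|lborel. ?reg x) = (LINT x:?A radius R|lborel. ?reg x)"
  proof -
    have "?A radius R = ?A radius ?d \<union> ?A ?d R" using radius dR by auto
    moreover have "(LINT x:?A radius ?d \<union> ?A ?d R|lborel. ?reg x) =
        (LINT x:?A radius ?d|lborel. ?reg x) + (LINT x:?A ?d R|lborel. ?reg x)"
      using radius dR by (intro set_integral_Un ireg) auto
    ultimately show ?thesis by simp
  qed
  also have "\<dots> = (LINT x:cball z radius|lborel. ?reg x) + (LINT x:?V|lborel. ?reg x)"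
  proof -
    have "?A radius R = cball z radius \<union> ?V" using in_z by (auto simp: not_le)
    moreover have "cball z radius \<inter> ?V = {}" by auto
    ultimately show ?thesis using set_integral_Un[OF _ iz iVr] by simp
  qed
  also have "(LINT x:?V|lborel. ?reg x) = (LINT x:?V|lborel. F x) - (LINT x:?V|lborel. sing_z x)"
    unfolding regularized_sing_term by (rule set_integral_diff(2)[OF iV iVs])
  also have "(LINT x:?V|lborel. sing_z x) = (LINT x:?W|lborel. sing_z x) - (LINT x:cball y radius|lborel. sing_z x)"
  proof -
    have "?W = cball y radius \<union> ?V" using in_y by (auto simp: not_le)
    moreover have "cball y radius \<inter> ?V = {}" by auto
    ultimately show ?thesis using set_integral_Un[OF _ iy iVs] by simp
  qed
  also have "(LINT x:?W|lborel. sing_z x) = (\<Sum>b\<in>?E. LINT x:?W|lborel. sing_term F z b x)"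
    using W(1) unfolding set_integrable_def set_lebesgue_integral_def scaleR_sum_right
    by (subst Bochner_Integration.integral_sum) auto
  \<comment> \<open>The sum of \<open>prim b radius\<close> completes the integral over
    \<open>cball z radius\<close> to \<open>Z.local_pf\<close>, and \<open>ln R\<close> meets its
    opposite from the outer integral.\<close>
  also have "\<dots> = (\<Sum>b\<in>?E. Z.exit_sum y b R) + ?K * ln R - (\<Sum>b\<in>?E. coeff_integral F z b * prim b radius)"
    unfolding W(2) sum_subtractf sum.distrib coeff_integral_sing_sum by simp
  finally have key: "(LINT x:?A radius ?d|lborel. ?reg x) + (LINT x:?A ?d R|lborel. ?reg x) =
      (LINT x:cball z radius|lborel. ?reg x) + ((LINT x:?V|lborel. F x)
       - ((\<Sum>b\<in>?E. Z.exit_sum y b R) + ?K * ln R - (\<Sum>b\<in>?E. coeff_integral F z b * prim b radius)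
          - (LINT x:cball y radius|lborel. sing_z x)))" .
  have ln: "?K * ln (R / ?d) = ?K * ln R - ?K * ln ?d" "?K * ln (?d / s2) = ?K * ln ?d - ?K * ln s2"
    using d R0 s2 by (simp_all add: ln_div right_diff_distrib)
  have "4 * pi * radial_value s1 = Y.local_pf s1 radius + (LINT x:?A radius ?d|lborel. ?reg x)
     - (LINT x:cball y radius|lborel. sing_z x)"
    by (simp add: radial_value_def)
  then show ?thesis
    using key unfolding outer_integral_finite[OF dR] ln Z.local_pf_def by linarith
qed

lemma pf_value_eq:
  assumes s1: "0 < s1" and s2: "0 < s2"
  shows "pf_value s1 s2 = 4 * pi * radial_value s1
    + 4 * pi * (LINT r:{dist y z<..}|lborel. outer_integrand F y z r)
    + coeff_integral F z (- 3) * ln (dist y z / s2)"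
proof -
  let ?U = "- (cball y radius \<union> cball z radius)"
  let ?E = "sing_exponents F z"
  have "((\<lambda>R. \<Sum>b\<in>?E. Z.exit_sum y b R) \<longlongrightarrow> (\<Sum>b\<in>?E. 0)) at_top"
    using neq by (intro tendsto_sum Z.exit_sum_tendsto_0) (auto simp: sing_exponents_def)
  then have "((\<lambda>R. Y.local_pf s1 radius + Z.local_pf s2 radius
      + (LINT x:?U \<inter> cball y R|lborel. F x)
      - (\<Sum>b\<in>?E. Z.exit_sum y b R) - coeff_integral F z (- 3) * ln (dist y z / s2))
    \<longlongrightarrow> Y.local_pf s1 radius + Z.local_pf s2 radius + (LINT x:?U|lborel. F x)
      - (\<Sum>b\<in>?E. 0) - coeff_integral F z (- 3) * ln (dist y z / s2)) at_top"
    by (intro tendsto_add tendsto_diff tendsto_const tendsto_truncated)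
  moreover have "\<forall>\<^sub>F R in at_top. Y.local_pf s1 radius + Z.local_pf s2 radius
      + (LINT x:?U \<inter> cball y R|lborel. F x)
      - (\<Sum>b\<in>?E. Z.exit_sum y b R) - coeff_integral F z (- 3) * ln (dist y z / s2)
    = 4 * pi * radial_value s1 + 4 * pi * (LINT r:{dist y z<..R}|lborel. outer_integrand F y z r)"
    using eventually_ge_at_top[of "2 * dist y z"]
    by eventually_elim (rule truncated_identity[OF _ s1 s2, symmetric])
  ultimately have "((\<lambda>R. 4 * pi * radial_value s1 + 4 * pi * (LINT r:{dist y z<..R}|lborel. outer_integrand F y z r))
    \<longlongrightarrow> Y.local_pf s1 radius + Z.local_pf s2 radius + (LINT x:?U|lborel. F x)
      - (\<Sum>b\<in>?E. 0) - coeff_integral F z (- 3) * ln (dist y z / s2)) at_top"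
    by (rule Lim_transform_eventually)
  moreover have "((\<lambda>R. 4 * pi * radial_value s1 + 4 * pi * (LINT r:{dist y z<..R}|lborel. outer_integrand F y z r))
    \<longlongrightarrow> 4 * pi * radial_value s1 + 4 * pi * (LINT r:{dist y z<..}|lborel. outer_integrand F y z r)) at_top"
    by (intro tendsto_intros tendsto_outer_integral)
  ultimately have "Y.local_pf s1 radius + Z.local_pf s2 radius + (LINT x:?U|lborel. F x)
      - (\<Sum>b\<in>?E. 0) - coeff_integral F z (- 3) * ln (dist y z / s2)
    = 4 * pi * radial_value s1 + 4 * pi * (LINT r:{dist y z<..}|lborel. outer_integrand F y z r)"
    by (rule tendsto_unique[OF trivial_limit_at_top_linorder])
  then show ?thesis by (simp add: pf_value_def)
qed

lemma Pf_integral_decomposition: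
  assumes "0 < s1" "0 < s2"
  shows "(\<exists>L. has_Pf_integral y z s1 s2 F L) \<and> (\<exists>L. has_Pf_radial y z s1 F L) \<and>
     set_integrable lborel {dist y z<..} (outer_integrand F y z) \<and>
     Pf_integral y z s1 s2 F = 4 * pi * Pf_radial y z s1 F
       + 4 * pi * (LINT r:{dist y z<..}|lborel. outer_integrand F y z r)
       + 4 * pi * pf_at (\<lambda>x. norm (x - z) ^ 3 * F x) z * ln (dist y z / s2)"
  using has_Pf_integral_pf_value[OF assms] has_Pf_radial_radial_value[OF assms(1)] outer_integrand_integrable
  by (auto simp: Pf_integral_eq[OF assms] Pf_radial_eq[OF assms(1)] pf_value_eq[OF assms] Z.pf_at_cube)

end

text \<open>Commuting the union and the sum makes the two defining predicates equal. This lets the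
  decomposition for the exchanged points speak about the same partie finie.\<close>

lemma Pf_integral_swap: "Pf_integral y z s1 s2 F = Pf_integral z y s2 s1 F"
  by (simp add: Pf_integral_def has_Pf_integral_def Un_commute add_ac)

theorem proposition2:
  fixes y1 y2 :: "real^3" and F :: "real^3 \<Rightarrow> real" and s1 s2 :: real
  assumes "y1 \<noteq> y2"
    and "F \<in> class_F y1 y2"
    and "\<exists>R. set_integrable lborel {x. R < norm x} F"
    and "0 < s1" and "0 < s2"
  shows "(\<exists>L. has_Pf_integral y1 y2 s1 s2 F L) \<and>
    ((\<exists>L. has_Pf_radial y1 y2 s1 F L) \<and>
     set_integrable lborel {dist y1 y2<..} (outer_integrand F y1 y2) \<and>
     Pf_integral y1 y2 s1 s2 F =
       4 * pi * Pf_radial y1 y2 s1 F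
       + 4 * pi * (LINT r:{dist y1 y2<..}|lborel. outer_integrand F y1 y2 r)
       + 4 * pi * pf_at (\<lambda>x. norm (x - y2) ^ 3 * F x) y2 * ln (dist y1 y2 / s2)) \<and>
    ((\<exists>L. has_Pf_radial y2 y1 s2 F L) \<and>
     set_integrable lborel {dist y1 y2<..} (outer_integrand F y2 y1) \<and>
     Pf_integral y1 y2 s1 s2 F =
       4 * pi * Pf_radial y2 y1 s2 F
       + 4 * pi * (LINT r:{dist y1 y2<..}|lborel. outer_integrand F y2 y1 r)
       + 4 * pi * pf_at (\<lambda>x. norm (x - y1) ^ 3 * F x) y1 * ln (dist y1 y2 / s1))"
proof -
  have "smooth_on (- {y1, y2}) F" using assms(2) by (simp add: class_F_def)
  then have "Ck_on 0 (- {y1, y2}) F" unfolding smooth_on_def by blast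
  then have P: "two_singular_points F y1 y2"
    using assms by (simp add: two_singular_points_def class_F_def)
  note Q = two_singular_points.swap[OF P]
  show ?thesis
    using two_singular_points.Pf_integral_decomposition[OF P assms(4,5)]
      two_singular_points.Pf_integral_decomposition[OF Q assms(5,4)]
    unfolding Pf_integral_swap[of y2 y1 s2 s1 F] dist_commute[of y2 y1] by blast
qed

end
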